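(* Let $\Bbbk$ be a field with $\mathrm{char}\,\Bbbk\ne2$. (1) Every pair of skew-symmetric bilinear forms over $\Bbbk$ is weakly congruent to $\tilde{\mathfrak A}^\rho$ for some $\rho\in\tilde{\mathfrak F}(\Bbbk)$. (2) For $\rho,\rho'\in\tilde{\mathfrak F}(\Bbbk)$, the pairs $\tilde{\mathfrak A}^\rho$ and $\tilde{\mathfrak A}^{\rho'}$ are weakly congruent if and only if $\rho$ and $\rho'$ belong to the same orbit of $\mathfrak g=\mathrm{GL}(2,\Bbbk)$.
   Context: For pairs $\mathbf A=(A_1,A_2)$ of square matrices: $\mathbf A\circ Q=(q_{11}A_1+q_{21}A_2,\,q_{12}A_1+q_{22}A_2)$ for $Q=(q_{ij})\in\mathrm{GL}(2,\Bbbk)$, and $P\circ\mathbf A=(PA_1P^\top,PA_2P^\top)$; $\mathbf A,\mathbf A'$ are weakly congruent if $\mathbf A'=P\circ\mathbf A\circ Q$ for invertible $P,Q$. Direct sums are blockwise. For a pair $R=(R_1,R_2)$ of $r\times s$ matrices, $R^+=\left(\begin{pmatrix}0&R_i\\-R_i^\top&0\end{pmatrix}\right)_{i=1,2}$. Pairs: $R_f=(I_d,F(f))$ for $f\in\Bbbk[x]$ monic of degree $d$, $F(f)$ its companion matrix; $R_{\infty,d}=(F(x^d),I_d)$; $R_{-,d}=((I_{d-1}\mid0),(0\mid I_{d-1}))$ ($(d-1)\times d$ matrices). An irreducible homogeneous polynomial $g\in\Bbbk[x_1,x_2]$ is unital if $g=x_2$ or its leading coefficient with respect to $x_1$ is $1$.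 $\mathcal P=\mathcal P(\Bbbk)$ is the set of unital irreducible homogeneous polynomials in $\Bbbk[x_1,x_2]$, and $\tilde{\mathcal P}=\mathcal P\cup\{\varepsilon\}$ with a formal symbol $\varepsilon$. $\mathfrak g$ acts on $\Bbbk[x_1,x_2]$ by $Q\circ h=h(q_{11}x_1+q_{12}x_2,\,q_{21}x_1+q_{22}x_2)$; for $g\in\mathcal P$, $Q*g$ is the unique $g'\in\mathcal P$ with $Q\circ g=\lambda g'$ for some nonzero $\lambda\in\Bbbk$, and $Q*\varepsilon=\varepsilon$. $\tilde{\mathfrak F}(\Bbbk)$ is the set of functions $\rho:\tilde{\mathcal P}\times\mathbb N\to\mathbb Z_{\ge0}$ with $\rho(g,d)=0$ for almost all $(g,d)$; $\mathfrak g$ acts by $(\rho*Q)(g,d)=\rho(Q*g,d)$. For $(g,d)\in\tilde{\mathcal P}\times\mathbb N$ set $R(g,d)=R_{-,d}^+$ if $g=\varepsilon$, $R(g,d)=R_{\infty,d}^+$ if $g=x_2$, and $R(g,d)=R^+_{g(x,1)^d}$ otherwise. Finally $\tilde{\mathfrak A}^\rho=\bigoplus_{(g,d)}R(g,d)^{\rho(g,d)}$. *)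

theory Defs
  imports "Jordan_Normal_Form.Matrix" "HOL-Computational_Algebra.Polynomial"
    "HOL-Computational_Algebra.Polynomial_Factorial"
begin

type_synonym 'a mpair = "'a mat \<times> 'a mat"

definition sq_pair :: "'a mpair \<Rightarrow> nat \<Rightarrow> bool" where
  "sq_pair A n \<longleftrightarrow> fst A \<in> carrier_mat n n \<and> snd A \<in> carrier_mat n n"

definition pair_act_right :: "'a::field mpair \<Rightarrow> 'a mat \<Rightarrow> 'a mpair" where
  "pair_act_right A Q =
     (Q $$ (0,0) \<cdot>\<^sub>m fst A + Q $$ (1,0) \<cdot>\<^sub>m snd A,
      Q $$ (0,1) \<cdot>\<^sub>m fst A + Q $$ (1,1) \<cdot>\<^sub>m snd A)"

definition pair_act_left :: "'a::field mat \<Rightarrow> 'a mpair \<Rightarrow> 'a mpair" where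
  "pair_act_left P A = (P * fst A * transpose_mat P, P * snd A * transpose_mat P)"

definition weakly_congruent :: "'a::field mpair \<Rightarrow> 'a mpair \<Rightarrow> bool" where
  "weakly_congruent A B \<longleftrightarrow>
     (\<exists>n P Q. sq_pair A n \<and> sq_pair B n \<and>
        P \<in> carrier_mat n n \<and> invertible_mat P \<and>
        Q \<in> carrier_mat 2 2 \<and> invertible_mat Q \<and>
        B = pair_act_left P (pair_act_right A Q))"

definition dsum_pair :: "'a::field mpair \<Rightarrow> 'a mpair \<Rightarrow> 'a mpair" where
  "dsum_pair A B =
     (four_block_mat (fst A) (0\<^sub>m (dim_row (fst A)) (dim_col (fst B)))
                     (0\<^sub>m (dim_row (fst B)) (dim_col (fst A))) (fst B),
      four_block_mat (snd A) (0\<^sub>m (dim_row (snd A)) (dim_col (snd B)))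
                     (0\<^sub>m (dim_row (snd B)) (dim_col (snd A))) (snd B))"

definition dsum_list :: "'a::field mpair list \<Rightarrow> 'a mpair" where
  "dsum_list L = foldr dsum_pair L (0\<^sub>m 0 0, 0\<^sub>m 0 0)"

definition plus_mat :: "'a::field mat \<Rightarrow> 'a mat" where
  "plus_mat R = four_block_mat (0\<^sub>m (dim_row R) (dim_row R)) R
                  (- transpose_mat R) (0\<^sub>m (dim_col R) (dim_col R))"

definition plus_pair :: "'a::field mpair \<Rightarrow> 'a mpair" where
  "plus_pair R = (plus_mat (fst R), plus_mat (snd R))"

definition companion :: "'a::field poly \<Rightarrow> 'a mat" where
  "companion f = (let d = degree f in
     mat d d (\<lambda>(i,j). if j = d - 1 then - coeff f i else if i = j + 1 then 1 else 0))"

definition R_fin :: "'a::field poly \<Rightarrow> 'a mpair" where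
  "R_fin f = (1\<^sub>m (degree f), companion f)"

definition R_inf :: "nat \<Rightarrow> 'a::field mpair" where
  "R_inf d = (companion (monom 1 d), 1\<^sub>m d)"

definition R_minus :: "nat \<Rightarrow> 'a::field mpair" where
  "R_minus d = (mat (d - 1) d (\<lambda>(i,j). if j = i then 1 else 0),
                mat (d - 1) d (\<lambda>(i,j). if j = i + 1 then 1 else 0))"

text \<open>k[x1,x2] is represented as ('a poly) poly: the outer variable is x1, the
  inner variable (coefficient ring k[x2]) is x2.\<close>

definition var_x2 :: "'a::field poly poly" where
  "var_x2 = [:[:0, 1:]:]"

definition homogeneous2 :: "'a::field poly poly \<Rightarrow> bool" where
  "homogeneous2 g \<longleftrightarrow> (\<exists>d. \<forall>i j. coeff (coeff g i) j \<noteq> 0 \<longrightarrow> i + j = d)"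

definition unital :: "'a::field poly poly \<Rightarrow> bool" where
  "unital g \<longleftrightarrow> g = var_x2 \<or> lead_coeff g = 1"

definition PP :: "'a::field poly poly set" where
  "PP = {g. homogeneous2 g \<and> irreducible g \<and> unital g}"

text \<open>None plays the role of the formal symbol epsilon.\<close>
definition PPt :: "'a::field poly poly option set" where
  "PPt = insert None (Some ` PP)"

definition lin2 :: "'a::field \<Rightarrow> 'a \<Rightarrow> 'a poly poly" where
  "lin2 a b = [:[:0, b:], [:a:]:]"

definition eval2 :: "'a::field poly poly \<Rightarrow> 'a poly poly \<Rightarrow> 'a poly poly \<Rightarrow> 'a poly poly" where
  "eval2 h A B = poly (map_poly (\<lambda>c. poly (map_poly (\<lambda>a. [:[:a:]:]) c) B) h) A"

definition gl_act :: "'a::field mat \<Rightarrow> 'a poly poly \<Rightarrow> 'a poly poly" where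
  "gl_act Q h = eval2 h (lin2 (Q $$ (0,0)) (Q $$ (0,1))) (lin2 (Q $$ (1,0)) (Q $$ (1,1)))"

definition gl_star :: "'a::field mat \<Rightarrow> 'a poly poly \<Rightarrow> 'a poly poly" where
  "gl_star Q g = (THE g'. g' \<in> PP \<and> (\<exists>c. c \<noteq> 0 \<and> gl_act Q g = [:[:c:]:] * g'))"

definition gl_star_t :: "'a::field mat \<Rightarrow> 'a poly poly option \<Rightarrow> 'a poly poly option" where
  "gl_star_t Q g = map_option (gl_star Q) g"

type_synonym 'a rho = "'a poly poly option \<times> nat \<Rightarrow> nat"

definition Ft :: "'a::field rho set" where
  "Ft = {\<rho>. finite {x. \<rho> x \<noteq> 0} \<and>
              (\<forall>g d. \<rho> (g, d) \<noteq> 0 \<longrightarrow> g \<in> PPt \<and> d \<ge> 1)}"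

definition rho_act :: "'a::field rho \<Rightarrow> 'a mat \<Rightarrow> 'a rho" where
  "rho_act \<rho> Q = (\<lambda>(g, d). if g \<in> PPt \<and> d \<ge> 1 then \<rho> (gl_star_t Q g, d) else 0)"

definition R_gd :: "'a::field poly poly option \<Rightarrow> nat \<Rightarrow> 'a mpair" where
  "R_gd g d = (case g of
       None \<Rightarrow> plus_pair (R_minus d)
     | Some h \<Rightarrow> if h = var_x2 then plus_pair (R_inf d)
                 else plus_pair (R_fin ((map_poly (\<lambda>c. poly c 1) h) ^ d)))"

text \<open>The direct sum over all (g,d) of R(g,d)^rho(g,d), taken in some fixed order
  (a list containing each (g,d) exactly rho(g,d) times).\<close>
definition A_rho :: "'a::field rho \<Rightarrow> 'a mpair" where
  "A_rho \<rho> = dsum_list (map (\<lambda>(g,d). R_gd g d)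
                 (SOME L. \<forall>x. count_list L x = \<rho> x))"

end

(* Existence.  For a pair (A, B) of alternating forms on a space V one block is split off at a time.
   If the pencil has a nonzero polynomial vector in its kernel, one of minimal degree gives a block
   R_minus; a dual chain exists by a Fredholm alternative, and minimality of the degree rules out the
   bad case.  Otherwise, if A is degenerate, a maximal chain A y_0 = 0, A y_(i+1) = B y_i gives a block
   R_inf.  Otherwise B = A(T -, -) for an A-self-adjoint operator T, and a pair of vectors annihilated
   by p(T)^e with p irreducible and e maximal gives a block R_fin (p^e).  In each case the vectors chosen
   are isotropic for free: their Gram matrices are Hankel, hence symmetric, and alternating, hence zero.

   Uniqueness.  For a homogeneous form f of degree e+1 consider the space of polynomial vectors u,
   homogeneous of degree e, for which (x1 A1 - x2 A2) u is a constant vector times f.  Its dimension is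
   additive over direct sums and invariant under congruence, and the action of GL(2) on pairs transports
   it along the action on f.  For f = 0 and f = g^j its values on the blocks are piecewise linear in e
   and j, with a break at the index of the block, so second differences give back the multiplicities.
   The remaining implication follows from existence, applied to the transformed pair, and uniqueness. *)

theory Submission
  imports Defs "Jordan_Normal_Form.Determinant" "HOL-Library.Function_Algebras"
begin

section \<open>Linear algebra over explicit families\<close>

text \<open>Weak congruence mixes the two coordinates, so elementary divisors over a polynomial ring
  in one variable, which single out a variable, are not directly invariants. The solution spaces
  avoid this. A constant vector stays constant under constant row operations and under substitutions
  of the variables, so congruence and GL(2) both act by linear isomorphisms, and \<open>x2\<close>,
  the place at infinity, stands on the same footing as the other forms. The degree e+1 of f is that
  of a linear pencil times a vector of degree e, so all equations are between forms of one degree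
  and may be checked at \<open>x2 = 1\<close>. The form 0 sees only the blocks of epsilon. The form
  g^j sees a block of g twice, through R and through its transpose, and an epsilon block by a term
  linear in j, which the second difference removes. The hypothesis on the characteristic enters
  through two facts: a skew-symmetric form is alternating, and a Gram matrix that is both symmetric
  and skew-symmetric is zero.\<close>

locale linear_space = vector_space scale
  for scale :: "'a::field \<Rightarrow> 'b::ab_group_add \<Rightarrow> 'b" (infixr "*s" 75)
begin

text \<open>Only closure of \<open>S\<close> under two given operations is assumed, so that \<open>S\<close> may consist of
  sequences of vectors, which carry no vector space type class.\<close>

lemma functional_in_span:
  fixes f :: "'s \<Rightarrow> 'a" and \<phi> :: "'k \<Rightarrow> 's \<Rightarrow> 'a"
  assumes "finite K"
    and add: "\<And>u w. u \<in> S \<Longrightarrow> w \<in> S \<Longrightarrow> ad u w \<in> S"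
    and smul: "\<And>c w. w \<in> S \<Longrightarrow> sm c w \<in> S"
    and "\<And>k u w. k \<in> K \<Longrightarrow> u \<in> S \<Longrightarrow> w \<in> S \<Longrightarrow> \<phi> k (ad u w) = \<phi> k u + \<phi> k w"
    and "\<And>k c w. k \<in> K \<Longrightarrow> w \<in> S \<Longrightarrow> \<phi> k (sm c w) = c * \<phi> k w"
    and "\<And>u w. u \<in> S \<Longrightarrow> w \<in> S \<Longrightarrow> f (ad u w) = f u + f w"
    and "\<And>c w. w \<in> S \<Longrightarrow> f (sm c w) = c * f w"
    and "\<And>w. w \<in> S \<Longrightarrow> (\<And>k. k \<in> K \<Longrightarrow> \<phi> k w = 0) \<Longrightarrow> f w = 0"
  shows "\<exists>c. \<forall>w\<in>S. f w = (\<Sum>k\<in>K. c k * \<phi> k w)"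
  using assms
proof (induction K arbitrary: S f rule: finite_induct)
  case empty
  then show ?case by auto
next
  case (insert k K)
  let ?S = "{w\<in>S. \<phi> k w = 0}"
  have "\<exists>c. \<forall>w\<in>?S. f w = (\<Sum>k\<in>K. c k * \<phi> k w)"
  proof (rule insert.IH)
    fix w assume "w \<in> ?S" "\<And>k'. k' \<in> K \<Longrightarrow> \<phi> k' w = 0"
    then show "f w = 0" using insert.prems(7)[of w] by auto
  qed (use insert.prems in auto)
  then obtain c where c: "\<And>w. w \<in> S \<Longrightarrow> \<phi> k w = 0 \<Longrightarrow> f w = (\<Sum>k\<in>K. c k * \<phi> k w)" by auto
  show ?case
  proof (cases "\<forall>w\<in>S. \<phi> k w = 0")
    case True
    then show ?thesis using c insert.hyps by (intro exI[of _ c]) auto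
  next
    case False
    then obtain w1 where w1: "w1 \<in> S" "\<phi> k w1 \<noteq> 0" by auto
    \<comment> \<open>By the choice of \<open>c\<close>, \<open>g\<close> vanishes on the kernel of
      \<open>\<phi> k\<close>, so it is a multiple of \<open>\<phi> k\<close>; the factor is read
      off at \<open>w1\<close>.\<close>
    define g where "g w = f w - (\<Sum>k\<in>K. c k * \<phi> k w)" for w
    define a where "a = g w1 / \<phi> k w1"
    have gad: "g (ad u w) = g u + g w" if "u \<in> S" "w \<in> S" for u w
      using that insert.prems by (simp add: g_def sum.distrib algebra_simps)
    have gsm: "g (sm b w) = b * g w" if "w \<in> S" for b w
      using that insert.prems by (simp add: g_def sum_distrib_left algebra_simps)
    have g: "g w = a * \<phi> k w" if w: "w \<in> S" for w
    proof -
      define w' where "w' = ad w (sm (- (\<phi> k w / \<phi> k w1)) w1)"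
      have "w' \<in> S" using w w1 insert.prems by (auto simp: w'_def)
      moreover have "\<phi> k w' = 0" using w w1 insert.prems(1,2,3,4) by (simp add: w'_def)
      ultimately have "g w' = 0" using c by (simp add: g_def)
      moreover have "g w' = g w - (\<phi> k w / \<phi> k w1) * g w1"
        using w w1 insert.prems(1,2) by (simp add: w'_def gad gsm)
      ultimately show ?thesis by (simp add: a_def)
    qed
    show ?thesis
    proof (intro exI[of _ "c(k := a)"] ballI)
      fix w assume w: "w \<in> S"
      have "(\<Sum>j\<in>K. (c(k := a)) j * \<phi> j w) = (\<Sum>j\<in>K. c j * \<phi> j w)"
        using insert.hyps by (intro sum.cong) auto
      then have "(\<Sum>j\<in>insert k K. (c(k := a)) j * \<phi> j w) = a * \<phi> k w + (\<Sum>j\<in>K. c j * \<phi> j w)"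
        by (subst sum.insert[OF insert.hyps]) simp
      then show "f w = (\<Sum>j\<in>insert k K. (c(k := a)) j * \<phi> j w)"
        using g[OF w] by (simp add: g_def diff_eq_eq)
    qed
  qed
qed

text \<open>Stated for families because the chains to which it is applied are not known to be
  injective; a repetition counts as a linear relation.\<close>

lemma family_dependent:
  fixes y :: "nat \<Rightarrow> 'b"
  assumes "finite S" "\<And>i. i < n \<Longrightarrow> y i \<in> span S" "card S < n"
  obtains c where "\<exists>i<n. c i \<noteq> 0" "(\<Sum>i<n. c i *s y i) = 0"
proof (cases "inj_on y {..<n}")
  case True
  have "\<not> independent (y ` {..<n})"
  proof
    assume "independent (y ` {..<n})"
    then have "card (y ` {..<n}) \<le> card S"
      using independent_span_bound[OF assms(1)] assms(2) by blast
    with True assms(3) show False by (simp add: card_image)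
  qed
  then obtain u where u: "\<exists>v\<in>y ` {..<n}. u v \<noteq> 0" "(\<Sum>v\<in>y ` {..<n}. u v *s v) = 0"
    using dependent_finite[of "y ` {..<n}"] by auto
  from u(2) have "(\<Sum>i<n. u (y i) *s y i) = 0" by (simp add: sum.reindex[OF True])
  with u(1) show thesis by (intro that[of "\<lambda>i. u (y i)"]) auto
next
  case False
  then obtain i j where ij: "i < n" "j < n" "i \<noteq> j" "y i = y j" by (auto simp: inj_on_def)
  have "(\<Sum>k<n. (if k = i then 1 else if k = j then -1 else 0) *s y k)
      = (\<Sum>k<n. if k = i then y i else 0) + (\<Sum>k<n. if k = j then - y j else 0)"
    unfolding sum.distrib[symmetric] using ij by (intro sum.cong) auto
  also have "\<dots> = 0" using ij by (simp add: sum.delta)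
  finally show thesis using ij
    by (intro that[of "\<lambda>k. if k = i then 1 else if k = j then -1 else 0"]) auto
qed

lemma dim_less:
  assumes "subspace V'" "V' \<subseteq> V" "x \<in> V" "x \<notin> V'" "V \<subseteq> span S" "finite S"
  shows "dim V' < dim V"
proof -
  obtain B where B: "B \<subseteq> V'" "independent B" "V' \<subseteq> span B" "card B = dim V'"
    by (rule basis_exists)
  have fB: "finite B" using independent_span_bound[OF assms(6) B(2)] B(1) assms by blast
  have sB: "span B = V'" using B assms(1) span_subspace by blast
  have "independent (insert x B)" using B(2) sB assms(4) independent_insertI by blast
  moreover obtain C where C: "C \<subseteq> V" "independent C" "V \<subseteq> span C" "card C = dim V"
    by (rule basis_exists)
  have "finite C" using independent_span_bound[OF assms(6) C(2)] C(1) assms by blast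
  ultimately have "card (insert x B) \<le> card C"
    using independent_span_bound[of C "insert x B"] C B(1) assms(2,3) by blast
  moreover have "x \<notin> B" using B(1) assms(4) by blast
  ultimately show ?thesis using B C fB by simp
qed

text \<open>Coefficients belong to positions of the list, not to vectors: the Gram matrix depends on
  the order, and a repeated entry violates independence by itself.\<close>

definition lincomb :: "(nat \<Rightarrow> 'a) \<Rightarrow> 'b list \<Rightarrow> 'b" where
  "lincomb c xs = (\<Sum>i<length xs. c i *s (xs ! i))"

lemma lincomb_Nil [simp]: "lincomb c [] = 0"
  by (simp add: lincomb_def)

lemma lincomb_append:
  "lincomb c (xs @ ys) = lincomb c xs + lincomb (\<lambda>i. c (length xs + i)) ys"
proof -
  have "(\<Sum>i<length xs + length ys. c i *s ((xs @ ys) ! i))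
      = (\<Sum>i<length xs. c i *s ((xs @ ys) ! i))
      + (\<Sum>i<length ys. c (length xs + i) *s ((xs @ ys) ! (length xs + i)))"
    by (simp add: lessThan_atLeast0 sum.atLeastLessThan_concat[symmetric, of 0 "length xs" "length xs + length ys"]
       sum.atLeastLessThan_shift_0[of _ "length xs"] o_def)
  then show ?thesis by (simp add: lincomb_def nth_append)
qed

lemma lincomb_cong:
  "(\<And>i. i < length xs \<Longrightarrow> c i = d i) \<Longrightarrow> lincomb c xs = lincomb d xs"
  by (simp add: lincomb_def)

lemma lincomb_in_subspace: "subspace V \<Longrightarrow> set xs \<subseteq> V \<Longrightarrow> lincomb c xs \<in> V"
  unfolding lincomb_def by (intro subspace_sum subspace_scale) auto

lemma lincomb_map: "lincomb c (map f [0..<n]) = (\<Sum>i<n. c i *s f i)"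
  by (simp add: lincomb_def)

lemma in_span_family:
  assumes "finite K" "x \<in> span (v ` K)"
  obtains c where "x = (\<Sum>i\<in>K. c i *s v i)"
proof -
  let ?T = "{x. \<exists>c. x = (\<Sum>i\<in>K. c i *s v i)}"
  have "subspace ?T"
  proof (rule subspaceI)
    show "0 \<in> ?T" by (auto intro!: exI[of _ "\<lambda>_. 0"])
    fix x y assume "x \<in> ?T" "y \<in> ?T"
    then obtain c d where "x = (\<Sum>i\<in>K. c i *s v i)" "y = (\<Sum>i\<in>K. d i *s v i)" by auto
    then show "x + y \<in> ?T"
      by (auto intro!: exI[of _ "\<lambda>i. c i + d i"] simp: scale_left_distrib sum.distrib)
  next
    fix a x assume "x \<in> ?T"
    then obtain c where "x = (\<Sum>i\<in>K. c i *s v i)" by auto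
    then show "a *s x \<in> ?T"
      by (auto intro!: exI[of _ "\<lambda>i. a * c i"] simp: scale_sum_right)
  qed
  moreover have "v i \<in> ?T" if "i \<in> K" for i
  proof -
    have "(\<Sum>j\<in>K. (if j = i then 1 else 0) *s v j) = (\<Sum>j\<in>K. if j = i then v j else 0)"
      by (intro sum.cong) auto
    also have "\<dots> = v i" using that assms(1) by simp
    finally have "\<exists>c. v i = (\<Sum>j\<in>K. c j *s v j)" by (intro exI) (rule sym)
    then show ?thesis by simp
  qed
  ultimately have "span (v ` K) \<subseteq> ?T" by (intro span_minimal) auto
  with assms(2) that show thesis by blast
qed

end

section \<open>Alternating forms and their Gram matrices\<close>

locale alternating_form = linear_space scale
  for scale :: "'a::field \<Rightarrow> 'v::ab_group_add \<Rightarrow> 'v" (infixr "*s" 75) +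
  fixes A :: "'v \<Rightarrow> 'v \<Rightarrow> 'a"
  assumes add_l: "A (x + y) z = A x z + A y z"
    and scale_l: "A (c *s x) z = c * A x z"
    and skew: "A x y = - A y x"
    and two: "(2::'a) \<noteq> 0"
begin

lemma self [simp]: "A x x = 0"
proof -
  have "2 * A x x = A x x + A x x" by simp
  also have "\<dots> = 0" using skew[of x x] by (metis add.right_inverse)
  finally show ?thesis using two by simp
qed

lemma add_r: "A z (x + y) = A z x + A z y"
  using skew add_l by (metis minus_add_distrib)

lemma scale_r: "A z (c *s x) = c * A z x"
  using skew scale_l by (metis mult_minus_right)

lemma zero_l [simp]: "A 0 x = 0"
  using scale_l[of 0 0 x] by simp

lemma zero_r [simp]: "A x 0 = 0"
  using scale_r[of x 0 0] by simp

lemma minus_l: "A (- x) z = - A x z"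
  using scale_l[of "-1" x z] by simp

lemma minus_r: "A z (- x) = - A z x"
  using scale_r[of z "-1" x] by simp

lemma diff_l: "A (x - y) z = A x z - A y z"
  using add_l[of x "- y" z] minus_l by simp

lemma diff_r: "A z (x - y) = A z x - A z y"
  using add_r[of z x "- y"] minus_r by simp

lemma sum_l: "A (sum f K) z = (\<Sum>k\<in>K. A (f k) z)"
  by (induction K rule: infinite_finite_induct) (auto simp: add_l)

lemma sum_r: "A z (sum f K) = (\<Sum>k\<in>K. A z (f k))"
  by (induction K rule: infinite_finite_induct) (auto simp: add_r)

lemmas form_simps = add_l add_r scale_l scale_r minus_l minus_r diff_l diff_r sum_l sum_r

lemma vanish_on_span:
  assumes "t \<in> span S" "\<And>b. b \<in> S \<Longrightarrow> A x b = 0"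
  shows "A x t = 0"
  using assms(1) by (induction t rule: span_induct_alt) (auto simp: form_simps assms(2))

definition gram :: "'v list \<Rightarrow> 'a mat" where
  "gram xs = mat (length xs) (length xs) (\<lambda>(i,j). A (xs ! i) (xs ! j))"

lemma gram_append:
  assumes "\<And>x y. x \<in> set xs \<Longrightarrow> y \<in> set ys \<Longrightarrow> A x y = 0"
  shows "gram (xs @ ys) = four_block_mat (gram xs) (0\<^sub>m (length xs) (length ys))
     (0\<^sub>m (length ys) (length xs)) (gram ys)"
proof -
  have "A y x = 0" if "x \<in> set xs" "y \<in> set ys" for x y
    using assms[OF that] skew[of y x] by simp
  then show ?thesis
    by (intro eq_matI) (auto simp: gram_def nth_append assms)
qed

text \<open>This is how a block \<open>R^+\<close> is recognised later: two isotropic families whose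
  mutual pairing is \<open>R\<close>.\<close>

lemma gram_plus:
  assumes "R \<in> carrier_mat r s"
    and "\<And>i j. i < r \<Longrightarrow> j < r \<Longrightarrow> A (u i) (u j) = 0"
    and "\<And>i j. i < s \<Longrightarrow> j < s \<Longrightarrow> A (w i) (w j) = 0"
    and "\<And>i j. i < r \<Longrightarrow> j < s \<Longrightarrow> A (u i) (w j) = R $$ (i,j)"
  shows "gram (map u [0..<r] @ map w [0..<s]) = plus_mat R"
proof -
  have 1: "A (w j) (u i) = - R $$ (i,j)" if "i < r" "j < s" for i j
    using assms(4)[OF that] skew[of "w j" "u i"] by simp
  show ?thesis
    using assms(1)
    by (intro eq_matI) (auto simp: gram_def plus_mat_def nth_append assms(2-4) 1)
qed

end

section \<open>Pairs of alternating forms and orthogonal splittings\<close>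

locale form_pair = linear_space scale + A: alternating_form scale A + B: alternating_form scale B
  for scale :: "'a::field \<Rightarrow> 'v::ab_group_add \<Rightarrow> 'v" (infixr "*s" 75)
    and A B :: "'v \<Rightarrow> 'v \<Rightarrow> 'a"
begin

text \<open>Fredholm alternative for chains \<open>A t (w j) = B t (w (j - 1))\<close>: if \<open>h (w 0)\<close> vanishes on all of
  them, it is a combination of the defining equations, and \<open>y j\<close> collects the coefficients of the
  equations that contain \<open>w j\<close>.\<close>

lemma chain_alternative:
  fixes h :: "'v \<Rightarrow> 'a" and m :: nat
  assumes V: "subspace V" "finite S" "V = span S" and K: "finite K" "K \<subseteq> V" and m: "m \<ge> 1"
    and h: "\<And>x y. h (x + y) = h x + h y" "\<And>c x. h (c *s x) = c * h x"
    and no: "\<not> (\<exists>w. (\<forall>i. w i \<in> V) \<and> (\<forall>b\<in>K. A b (w 0) = 0) \<and>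
       (\<forall>j\<ge>1. j < m \<longrightarrow> (\<forall>t\<in>V. A t (w j) = B t (w (j - 1)))) \<and> h (w 0) = 1)"
  obtains y where "y 0 \<in> span K" "\<And>j. j \<le> m \<Longrightarrow> y j \<in> V" "y m = 0"
    "\<And>t. t \<in> V \<Longrightarrow> h t = A (y 0) t - B (y 1) t"
    "\<And>j t. 1 \<le> j \<Longrightarrow> j < m \<Longrightarrow> t \<in> V \<Longrightarrow> A (y j) t = B (y (Suc j)) t"
proof -
  define T where "T = {w :: nat \<Rightarrow> 'v. \<forall>i. w i \<in> V}"
  \<comment> \<open>The unknown is the whole sequence \<open>w\<close>. The functional for
    \<open>(j, b)\<close> measures the failure of the equation for \<open>w j\<close> tested at
    \<open>b\<close>; for \<open>j = 0\<close> there is no \<open>B\<close>-term and only the tests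
    in \<open>K\<close> are imposed.\<close>
  define \<phi> where "\<phi> = (\<lambda>(j :: nat, b) w. A b (w j) - (if j = 0 then 0 else B b (w (j - 1))))"
  define Kj where "Kj j = (if j = 0 then K else S)" for j :: nat
  define K' where "K' = Sigma {..<m} Kj"
  have SV: "S \<subseteq> V" using V span_superset by auto
  have "\<exists>c. \<forall>w\<in>T. h (w 0) = (\<Sum>k\<in>K'. c k * \<phi> k w)"
  proof (rule functional_in_span[where ad = "\<lambda>u w i. u i + w i" and sm = "\<lambda>c w i. c *s w i"])
    show "finite K'" using V K by (auto simp: K'_def Kj_def)
    fix w assume w: "w \<in> T" and ker: "\<And>k. k \<in> K' \<Longrightarrow> \<phi> k w = 0"
    have 1: "A b (w 0) = 0" if "b \<in> K" for b
      using ker[of "(0,b)"] that m by (auto simp: \<phi>_def K'_def Kj_def)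
    have 2: "A t (w j) = B t (w (j-1))" if "t \<in> V" "1 \<le> j" "j < m" for t j
    proof -
      have "A b (w j) = B b (w (j-1))" if "b \<in> S" for b
        using ker[of "(j,b)"] that \<open>1 \<le> j\<close> \<open>j < m\<close> by (auto simp: \<phi>_def K'_def Kj_def)
      note S = this
      have "t \<in> span S" using that V by simp
      then show ?thesis
        by (induction t rule: span_induct_alt) (auto simp: A.form_simps B.form_simps S)
    qed
    have h0: "h 0 = 0" using h(2)[of 0 0] by simp
    show "h (w 0) = 0"
    proof (rule ccontr)
      \<comment> \<open>The chain equations are homogeneous, so a nonzero value could be scaled to
        1, which \<open>no\<close> excludes.\<close>
      assume nz: "h (w 0) \<noteq> 0"
      have "\<exists>w'. (\<forall>i. w' i \<in> V) \<and> (\<forall>b\<in>K. A b (w' 0) = 0) \<and>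
       (\<forall>j\<ge>1. j < m \<longrightarrow> (\<forall>t\<in>V. A t (w' j) = B t (w' (j - 1)))) \<and> h (w' 0) = 1"
        using w nz V 1 2 by (intro exI[of _ "\<lambda>i. (1 / h (w 0)) *s w i"])
          (auto simp: T_def h A.form_simps B.form_simps intro: subspace_scale)
      with no show False by blast
    qed
  qed (use V h in \<open>auto simp: T_def \<phi>_def A.form_simps B.form_simps algebra_simps
      intro: subspace_add subspace_scale\<close>)
  then obtain c where c: "\<And>w. w \<in> T \<Longrightarrow> h (w 0) = (\<Sum>k\<in>K'. c k * \<phi> k w)" by auto
  define y where "y j = (if j < m then \<Sum>b\<in>Kj j. c (j, b) *s b else 0)" for j
  have eq: "h (w 0) = (\<Sum>j<m. A (y j) (w j) - (if j = 0 then 0 else B (y j) (w (j-1))))"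
    if "w \<in> T" for w
  proof -
    have "(\<Sum>k\<in>K'. c k * \<phi> k w) = (\<Sum>j<m. \<Sum>b\<in>Kj j. c (j,b) * \<phi> (j,b) w)"
      unfolding K'_def using V K by (subst sum.Sigma) (auto simp: Kj_def split_def)
    also have "\<dots> = (\<Sum>j<m. A (y j) (w j) - (if j = 0 then 0 else B (y j) (w (j-1))))"
      by (intro sum.cong) (auto simp: y_def \<phi>_def A.form_simps B.form_simps sum_subtractf algebra_simps)
    finally show ?thesis using c[OF that] by simp
  qed
  \<comment> \<open>A sequence concentrated at one index isolates the two groups of equations that
    contain \<open>w k\<close>. For \<open>k + 1 = m\<close> the second group is absent, in
    agreement with \<open>y m = 0\<close>.\<close>
  have single: "(if k = 0 then h t else 0) = A (y k) t - B (y (Suc k)) t" if "k < m" "t \<in> V" for k t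
  proof -
    define w where "w i = (if i = k then t else 0)" for i :: nat
    have wT: "w \<in> T" using that V by (auto simp: w_def T_def subspace_0)
    have "h (w 0) = (\<Sum>j<m. (if j = k then A (y k) t else 0) - (if j = Suc k then B (y (Suc k)) t else 0))"
      unfolding eq[OF wT] by (intro sum.cong) (auto simp: w_def)
    also have "\<dots> = A (y k) t - (if Suc k < m then B (y (Suc k)) t else 0)"
      using that by (simp add: sum_subtractf sum.delta)
    also have "(if Suc k < m then B (y (Suc k)) t else 0) = B (y (Suc k)) t"
      by (auto simp: y_def)
    finally show ?thesis using h(2)[of 0 0] by (auto simp: w_def)
  qed
  show thesis
  proof (rule that[of y])
    show "y 0 \<in> span K" using m by (auto simp: y_def Kj_def intro!: span_sum span_scale intro: span_base)
    show "y j \<in> V" if "j \<le> m" for j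
      using V K SV by (auto simp: y_def Kj_def subspace_0 intro!: subspace_sum subspace_scale)
    show "y m = 0" by (simp add: y_def)
    show "h t = A (y 0) t - B (y 1) t" if "t \<in> V" for t using single[of 0 t] that m by simp
    show "A (y j) t = B (y (Suc j)) t" if "1 \<le> j" "j < m" "t \<in> V" for j t
      using single[of j t] that by simp
  qed
qed

text \<open>\<open>V\<close> is the direct sum of the span of the linearly independent list \<open>xs\<close> and of \<open>V'\<close>, and the two
  summands are orthogonal for both forms.\<close>

definition splits :: "'v set \<Rightarrow> 'v list \<Rightarrow> 'v set \<Rightarrow> bool" where
  "splits V xs V' \<longleftrightarrow> subspace V' \<and> V' \<subseteq> V \<and> set xs \<subseteq> V \<and>
     (\<forall>v\<in>V. \<exists>c. v - lincomb c xs \<in> V') \<and>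
     (\<forall>c. lincomb c xs \<in> V' \<longrightarrow> (\<forall>i<length xs. c i = 0)) \<and>
     (\<forall>x\<in>set xs. \<forall>t\<in>V'. A x t = 0 \<and> B x t = 0)"

text \<open>The complement is the common orthogonal space of \<open>xs\<close>: \<open>ex\<close>
  corrects every vector into it, and \<open>inj\<close> makes it meet the span of \<open>xs\<close>
  trivially. Both forms are used jointly, since on a singular block neither Gram matrix is
  invertible by itself.\<close>

lemma splits_orthogonal:
  assumes V: "subspace V" and xs: "set xs \<subseteq> V"
    and ex: "\<And>v. v \<in> V \<Longrightarrow> \<exists>c. \<forall>x\<in>set xs. A x (v - lincomb c xs) = 0 \<and> B x (v - lincomb c xs) = 0"
    and inj: "\<And>c i. (\<And>x. x \<in> set xs \<Longrightarrow> A x (lincomb c xs) = 0 \<and> B x (lincomb c xs) = 0) \<Longrightarrow>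
       i < length xs \<Longrightarrow> c i = 0"
  shows "\<exists>V'. splits V xs V'"
proof (intro exI)
  let ?V = "{v\<in>V. \<forall>x\<in>set xs. A x v = 0 \<and> B x v = 0}"
  have "subspace ?V" using V
    by (auto intro!: subspaceI intro: subspace_add subspace_scale subspace_0 simp: A.form_simps B.form_simps)
  moreover have "\<exists>c. v - lincomb c xs \<in> ?V" if "v \<in> V" for v
    using ex[OF that] V xs that by (auto intro: subspace_diff lincomb_in_subspace)
  moreover have "c i = 0" if "lincomb c xs \<in> ?V" "i < length xs" for c i
    using inj[of c i] that by auto
  ultimately show "splits V xs ?V" using xs unfolding splits_def by auto
qed

fun realizes :: "'v set \<Rightarrow> ('a poly poly option \<times> nat) list \<Rightarrow> bool" where
  "realizes V [] \<longleftrightarrow> V = {0}"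
| "realizes V (p # L) \<longleftrightarrow> (\<exists>xs V'. splits V xs V' \<and> realizes V' L \<and>
     (A.gram xs, B.gram xs) = R_gd (fst p) (snd p))"

end

section \<open>Splitting off canonical blocks\<close>

text \<open>Each use of \<open>step\<close> moves one unit from the right index to the left; after
  \<open>j - i\<close> moves the indices are exchanged. All indices on the way stay below
  \<open>d\<close>, where alone the relations of a chain hold.\<close>

lemma hankel_symmetric:
  fixes g :: "nat \<Rightarrow> nat \<Rightarrow> 'a"
  assumes step: "\<And>i j. Suc i < d \<Longrightarrow> Suc j < d \<Longrightarrow> g i (Suc j) = g (Suc i) j"
    and "i < d" "j < d"
  shows "g i j = g j i"
proof -
  have shift: "g i (i + k) = g (i + k) i" if "i + k < d" for i k
  proof -
    have "g i (j + k) = g (i + k) j" if "i + k < d" "j + k < d" for j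
      using that
    proof (induction k arbitrary: i)
      case (Suc k)
      have "g i (j + Suc k) = g (Suc i) (j + k)" using step[of i "j + k"] Suc.prems by simp
      also have "\<dots> = g (Suc i + k) j" using Suc.IH[of "Suc i"] Suc.prems by simp
      finally show ?case by simp
    qed simp
    from this[of i] show ?thesis using that by simp
  qed
  show ?thesis
    using shift[of i "j - i"] shift[of j "i - j"] assms(2,3) by (cases "i \<le> j") auto
qed

lemma (in alternating_form) hankel_isotropic:
  assumes "\<And>i j. Suc i < d \<Longrightarrow> Suc j < d \<Longrightarrow> A (y i) (y (Suc j)) = A (y (Suc i)) (y j)"
    and "i < d" "j < d"
  shows "A (y i) (y j) = 0"
proof -
  have "A (y i) (y j) = A (y j) (y i)"
    by (rule hankel_symmetric[of d "\<lambda>i j. A (y i) (y j)"]) (use assms in auto)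
  with skew[of "y i" "y j"] have "2 * A (y i) (y j) = 0" by (simp add: eq_neg_iff_add_eq_0)
  with two show ?thesis by simp
qed

lemma sum_pick:
  fixes n k :: nat
  assumes "k < n" "\<And>i. i < n \<Longrightarrow> f i = (if i = k then c else 0)"
  shows "(\<Sum>i<n. f i) = c"
proof -
  have "(\<Sum>i<n. f i) = (\<Sum>i<n. if i = k then c else 0)" by (intro sum.cong) (auto simp: assms(2))
  with assms(1) show ?thesis by simp
qed

section \<open>Regular blocks, and polynomial vectors in the kernel of the pencil\<close>

context form_pair
begin

text \<open>Both regular cases end here, the one at infinity with the two forms exchanged. Replacing
  \<open>x\<close> by the basis \<open>u\<close> of its span that is dual to \<open>w\<close> turns
  the \<open>A\<close>-pairing into the identity; the \<open>B\<close>-pairing of \<open>u\<close>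
  with \<open>w\<close> is then \<open>F\<close>, because \<open>Fw\<close> expresses it through
  \<open>A\<close>. The relation \<open>Fx\<close> makes \<open>u\<close> isotropic for
  \<open>B\<close> as well.\<close>

lemma regular_block:
  fixes x w :: "nat \<Rightarrow> 'v"
  assumes V: "subspace V" and xV: "\<And>i. i < D \<Longrightarrow> x i \<in> V" and wV: "\<And>i. i < D \<Longrightarrow> w i \<in> V"
    and xx: "\<And>i j. i < D \<Longrightarrow> j < D \<Longrightarrow> A (x i) (x j) = 0"
    and ww: "\<And>i j. i < D \<Longrightarrow> j < D \<Longrightarrow> A (w i) (w j) = 0"
    and sym: "\<And>i j. i < D \<Longrightarrow> j < D \<Longrightarrow> A (x i) (w j) = A (x j) (w i)"
    and nondeg: "\<And>c j. (\<And>i. i < D \<Longrightarrow> (\<Sum>j<D. c j * A (x i) (w j)) = 0) \<Longrightarrow> j < D \<Longrightarrow> c j = 0"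
    and Fx: "\<And>v j. v \<in> V \<Longrightarrow> j < D \<Longrightarrow> B v (x j) = A v (\<Sum>i<D. F $$ (i,j) *s x i)"
    and Fw: "\<And>v j. v \<in> V \<Longrightarrow> j < D \<Longrightarrow> B v (w j) = A v (\<Sum>i<D. F $$ (i,j) *s w i)"
    and F: "F \<in> carrier_mat D D"
  shows "\<exists>xs V'. splits V xs V' \<and> length xs = 2 * D \<and>
    A.gram xs = plus_mat (1\<^sub>m D) \<and> B.gram xs = plus_mat F"
proof -
  let ?X = "x ` {..<D}"
  have XV: "span ?X \<subseteq> V" using xV V by (intro span_minimal) auto
  \<comment> \<open>If no vector of the span pairs nontrivially with \<open>w i\<close> while
    killing the other \<open>w j\<close>, the functional of \<open>w i\<close> is a combination of
    the others, against \<open>nondeg\<close>.\<close>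
  have "\<exists>u. u \<in> span ?X \<and> (\<forall>j<D. A u (w j) = (if j = i then 1 else 0))" if i: "i < D" for i
  proof (cases "\<exists>u\<in>span ?X. (\<forall>j\<in>{..<D} - {i}. A u (w j) = 0) \<and> A u (w i) \<noteq> 0")
    case True
    then obtain u where "u \<in> span ?X" "\<forall>j\<in>{..<D} - {i}. A u (w j) = 0" "A u (w i) \<noteq> 0" by auto
    then show ?thesis
      by (intro exI[of _ "(1 / A u (w i)) *s u"]) (auto simp: A.form_simps intro: span_scale)
  next
    case False
    have "\<exists>c. \<forall>u\<in>span ?X. A u (w i) = (\<Sum>j\<in>{..<D} - {i}. c j * A u (w j))"
      by (rule functional_in_span[where ad = "(+)" and sm = scale])
        (use False in \<open>auto simp: A.form_simps intro: span_add span_scale\<close>)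
    then obtain c where c: "\<And>u. u \<in> span ?X \<Longrightarrow> A u (w i) = (\<Sum>j\<in>{..<D} - {i}. c j * A u (w j))"
      by auto
    define e where "e j = (if j = i then -1 else c j)" for j
    have "e i = 0"
    proof (rule nondeg)
      fix k assume "k < D"
      have "(\<Sum>j<D. e j * A (x k) (w j)) = - A (x k) (w i) + (\<Sum>j\<in>{..<D} - {i}. c j * A (x k) (w j))"
        using i by (subst sum.remove[of _ i]) (auto simp: e_def intro!: sum.cong)
      also have "\<dots> = 0" using c[of "x k"] \<open>k < D\<close> by (auto simp: span_base)
      finally show "(\<Sum>j<D. e j * A (x k) (w j)) = 0" .
    qed (use i in auto)
    then show ?thesis by (simp add: e_def)
  qed
  then obtain u where u: "\<And>i. i < D \<Longrightarrow> u i \<in> span ?X"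
    "\<And>i j. i < D \<Longrightarrow> j < D \<Longrightarrow> A (u i) (w j) = (if j = i then 1 else 0)" by metis
  \<comment> \<open>By construction \<open>e\<close> pairs to zero with every \<open>w j\<close>.
    Through \<open>sym\<close> this relation between rows of the pairing matrix becomes one between
    columns, to which \<open>nondeg\<close> applies.\<close>
  have xu: "x k = (\<Sum>i<D. A (x k) (w i) *s u i)" if k: "k < D" for k
  proof -
    define e where "e = x k - (\<Sum>i<D. A (x k) (w i) *s u i)"
    have "e \<in> span ?X" unfolding e_def
      using u k by (auto intro!: span_diff span_sum span_scale intro: span_base)
    then obtain d where d: "e = (\<Sum>i<D. d i *s x i)" using in_span_family[of "{..<D}" e x] by auto
    have ew: "A e (w j) = 0" if "j < D" for j
    proof -
      have "A e (w j) = A (x k) (w j) - (\<Sum>i<D. A (x k) (w i) * A (u i) (w j))"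
        by (simp add: e_def A.form_simps)
      also have "(\<Sum>i<D. A (x k) (w i) * A (u i) (w j)) = A (x k) (w j)"
        by (rule sum_pick[OF that]) (use u(2) that in auto)
      finally show ?thesis by simp
    qed
    have "d i = 0" if "i < D" for i
    proof (rule nondeg[OF _ that])
      fix j assume j: "j < D"
      have "(\<Sum>i<D. d i * A (x j) (w i)) = (\<Sum>i<D. d i * A (x i) (w j))"
        by (intro sum.cong) (use sym j in auto)
      also have "\<dots> = A e (w j)" by (simp add: d A.form_simps)
      finally show "(\<Sum>i<D. d i * A (x j) (w i)) = 0" using ew[OF j] by simp
    qed
    then have "e = 0" by (simp add: d)
    then show ?thesis by (simp add: e_def)
  qed
  have uV: "u i \<in> V" if "i < D" for i using u(1)[OF that] XV by blast
  have Ax: "A v t = 0" if "t \<in> span ?X" "\<And>k. k < D \<Longrightarrow> A v (x k) = 0" for v t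
    using A.vanish_on_span[OF that(1)] that(2) by auto
  have Bx: "B v t = 0" if "v \<in> V" "t \<in> span ?X" "\<And>k. k < D \<Longrightarrow> A v (x k) = 0" for v t
  proof (rule B.vanish_on_span[OF that(2)])
    fix b assume "b \<in> ?X"
    then show "B v b = 0" using that(1,3) by (auto simp: Fx A.form_simps)
  qed
  have ux: "A (u i) (x j) = 0" if "i < D" "j < D" for i j
  proof -
    have "A (x j) (u i) = 0" by (rule Ax[OF u(1)]) (use that xx in auto)
    then show ?thesis using A.skew[of "u i" "x j"] by simp
  qed
  have uu: "A (u i) (u j) = 0" if "i < D" "j < D" for i j
    by (rule Ax[OF u(1)]) (use that ux in auto)
  have Buu: "B (u i) (u j) = 0" if "i < D" "j < D" for i j
    by (rule Bx[OF uV u(1)]) (use that ux in auto)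
  have Bww: "B (w i) (w j) = 0" if "i < D" "j < D" for i j
    using that by (simp add: Fw wV A.form_simps ww)
  have Buw: "B (u i) (w j) = F $$ (i, j)" if "i < D" "j < D" for i j
  proof -
    have "B (u i) (w j) = (\<Sum>k<D. F $$ (k,j) * A (u i) (w k))"
      using that by (simp add: Fw uV A.form_simps)
    also have "\<dots> = F $$ (i, j)" by (rule sum_pick[OF that(1)]) (use u(2) that in auto)
    finally show ?thesis .
  qed
  define xs where "xs = map u [0..<D] @ map w [0..<D]"
  have lc: "lincomb c xs = (\<Sum>i<D. c i *s u i) + (\<Sum>i<D. c (D + i) *s w i)" for c
    by (simp add: xs_def lincomb_append lincomb_map)
  have Alw: "A (lincomb c xs) (w k) = c k" if "k < D" for c k
  proof -
    have "A (lincomb c xs) (w k) = (\<Sum>i<D. c i * A (u i) (w k)) + (\<Sum>i<D. c (D + i) * A (w i) (w k))"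
      by (simp add: lc A.form_simps)
    also have "(\<Sum>i<D. c i * A (u i) (w k)) = c k" by (rule sum_pick[OF that]) (use u(2) that in auto)
    finally show ?thesis using ww that by simp
  qed
  have Aul: "A (u k) (lincomb c xs) = c (D + k)" if "k < D" for c k
  proof -
    have "A (u k) (lincomb c xs) = (\<Sum>i<D. c i * A (u k) (u i)) + (\<Sum>i<D. c (D + i) * A (u k) (w i))"
      by (simp add: lc A.form_simps)
    also have "(\<Sum>i<D. c (D + i) * A (u k) (w i)) = c (D + k)"
      by (rule sum_pick[OF that]) (use u(2) that in auto)
    finally show ?thesis using uu that by simp
  qed
  have xsV: "set xs \<subseteq> V" using uV wV by (auto simp: xs_def)
  have "\<exists>V'. splits V xs V'"
  proof (rule splits_orthogonal[OF V xsV])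
    fix v assume v: "v \<in> V"
    \<comment> \<open>Coefficients read off by pairing with the dual vectors; the arguments are
      ordered as in \<open>Alw\<close> and \<open>Aul\<close>, so no signs appear.\<close>
    define c where "c i = (if i < D then A v (w i) else A (u (i - D)) v)" for i
    define v' where "v' = v - lincomb c xs"
    have v': "v' \<in> V" using v V xsV by (auto simp: v'_def intro: subspace_diff lincomb_in_subspace)
    have 1: "A v' (w k) = 0" if "k < D" for k
      using that by (simp add: v'_def A.diff_l Alw) (simp add: c_def)
    have 2: "A v' (u k) = 0" if "k < D" for k
    proof -
      have "A (u k) v' = 0" using that by (simp add: v'_def A.diff_r Aul) (simp add: c_def)
      then show ?thesis using A.skew[of v' "u k"] by simp
    qed
    have 3: "A v' (x k) = 0" if "k < D" for k
      by (subst xu[OF that]) (simp add: A.form_simps 2)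
    have 4: "B v' (u k) = 0" if "k < D" for k by (rule Bx[OF v' u(1)]) (use that 3 in auto)
    have 5: "B v' (w k) = 0" if "k < D" for k using that 1 by (simp add: Fw v' A.form_simps)
    have "A s v' = 0 \<and> B s v' = 0" if "s \<in> set xs" for s
      using that 1 2 4 5 A.skew[of s v'] B.skew[of s v'] by (auto simp: xs_def)
    then show "\<exists>c. \<forall>x\<in>set xs. A x (v - lincomb c xs) = 0 \<and> B x (v - lincomb c xs) = 0"
      unfolding v'_def by blast
  next
    fix c i assume *: "\<And>x. x \<in> set xs \<Longrightarrow> A x (lincomb c xs) = 0 \<and> B x (lincomb c xs) = 0"
      and "i < length xs"
    show "c i = 0"
    proof (cases "i < D")
      case True
      then have "A (w i) (lincomb c xs) = 0" using * by (auto simp: xs_def)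
      then show ?thesis using Alw[OF True, of c] A.skew[of "lincomb c xs" "w i"] by simp
    next
      case False
      with \<open>i < length xs\<close> have "i - D < D" by (auto simp: xs_def)
      then show ?thesis using Aul[of "i - D" c] False *[of "u (i - D)"] by (auto simp: xs_def)
    qed
  qed
  moreover have "A.gram xs = plus_mat (1\<^sub>m D)" unfolding xs_def
    by (rule A.gram_plus) (use uu ww u(2) in auto)
  moreover have "B.gram xs = plus_mat F" unfolding xs_def
    by (rule B.gram_plus[OF F]) (use Buu Bww Buw in auto)
  ultimately show ?thesis by (auto simp: xs_def)
qed

text \<open>The coefficients of a nonzero polynomial vector in the kernel of the pencil; the least possible
  \<open>m\<close> is the minimal index.\<close>

definition kernel_chain :: "'v set \<Rightarrow> nat \<Rightarrow> (nat \<Rightarrow> 'v) \<Rightarrow> bool" where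
  "kernel_chain V m v \<longleftrightarrow> (\<forall>i\<le>m. v i \<in> V) \<and> (\<exists>i\<le>m. v i \<noteq> 0) \<and> (\<forall>t\<in>V. B (v 0) t = 0) \<and>
     (\<forall>i<m. \<forall>t\<in>V. B (v (Suc i)) t = A (v i) t) \<and> (\<forall>t\<in>V. A (v m) t = 0)"

text \<open>\<open>R_minus 1\<close> has no rows and one column, so its block is the 1 x 1 zero
  pair. The vector is orthogonal to all of \<open>V\<close>, so the orthogonal space is no
  complement; an arbitrary linear complement serves instead.\<close>

lemma common_radical_block:
  assumes V: "subspace V" and v: "v \<in> V" "v \<noteq> 0"
    and "\<And>t. t \<in> V \<Longrightarrow> A v t = 0" "\<And>t. t \<in> V \<Longrightarrow> B v t = 0"
  shows "\<exists>xs V'. splits V xs V' \<and> xs \<noteq> [] \<and> (A.gram xs, B.gram xs) = R_gd None 1"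
proof -
  have "independent {v}" using v by simp
  then obtain S where S: "{v} \<subseteq> S" "S \<subseteq> V" "independent S" "V \<subseteq> span S"
    using maximal_independent_subset_extend[of "{v}" V] v by auto
  have vn: "v \<notin> span (S - {v})" using S(1,3) dependent_def by blast
  have sV: "span (S - {v}) \<subseteq> V" using S(2) V by (intro span_minimal) auto
  have lc: "lincomb c [v] = c 0 *s v" for c by (simp add: lincomb_def)
  have "splits V [v] (span (S - {v}))"
    unfolding splits_def
  proof (intro conjI ballI allI impI)
    fix t assume "t \<in> V"
    then obtain k where "t - k *s v \<in> span (S - {v})" using span_breakdown[of v S t] S by auto
    then show "\<exists>c. t - lincomb c [v] \<in> span (S - {v})" by (auto simp: lc intro: exI[of _ "\<lambda>_. k"])
  next
    fix c i assume c: "lincomb c [v] \<in> span (S - {v})" and "i < length [v]"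
    then have i: "i = 0" by simp
    show "c i = 0"
    proof (rule ccontr)
      assume "c i \<noteq> 0"
      then show False using vn span_scale[OF c, of "1 / c 0"] i by (simp add: lc)
    qed
  qed (use assms sV in auto)
  moreover have "A.gram [v] = plus_mat (fst (R_minus 1))"
    using A.gram_plus[of "fst (R_minus 1)" 0 1 "\<lambda>_. v" "\<lambda>_. v"] by (simp add: R_minus_def)
  moreover have "B.gram [v] = plus_mat (snd (R_minus 1))"
    using B.gram_plus[of "snd (R_minus 1)" 0 1 "\<lambda>_. v" "\<lambda>_. v"] by (simp add: R_minus_def)
  ultimately show ?thesis
    by (intro exI[of _ "[v]"] exI[of _ "span (S - {v})"]) (simp add: R_gd_def plus_pair_def)
qed

end

section \<open>Singular blocks: a minimal kernel chain and its dual chain\<close>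

context form_pair
begin

lemma singular_block:
  assumes V: "subspace V" "finite S" "V = span S"
    and kc: "kernel_chain V m v" and min: "\<And>k u. k < m \<Longrightarrow> \<not> kernel_chain V k u"
  shows "\<exists>xs V'. splits V xs V' \<and> xs \<noteq> [] \<and> (A.gram xs, B.gram xs) = R_gd None (Suc m)"
proof -
  have vV: "v i \<in> V" if "i \<le> m" for i using kc that by (auto simp: kernel_chain_def)
  have B0: "B (v 0) t = 0" if "t \<in> V" for t using kc that by (auto simp: kernel_chain_def)
  have BS: "B (v (Suc i)) t = A (v i) t" if "i < m" "t \<in> V" for i t
    using kc that by (auto simp: kernel_chain_def)
  have Am: "A (v m) t = 0" if "t \<in> V" for t using kc that by (auto simp: kernel_chain_def)
  \<comment> \<open>If \<open>v 0\<close> vanished, dropping it would leave a shorter kernel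
    chain.\<close>
  have v0: "v 0 \<noteq> 0"
  proof
    assume z: "v 0 = 0"
    show False
    proof (cases m)
      case 0
      with z kc show False by (auto simp: kernel_chain_def)
    next
      case (Suc k)
      obtain i where i: "i \<le> m" "v i \<noteq> 0" using kc by (auto simp: kernel_chain_def)
      with z obtain i' where "i = Suc i'" by (cases i) auto
      with i Suc have "\<exists>i\<le>k. v (Suc i) \<noteq> 0" by auto
      then have "kernel_chain V k (\<lambda>i. v (Suc i))"
        using vV BS Am Suc BS[of 0] z unfolding kernel_chain_def by auto
      with min[of k] Suc show False by auto
    qed
  qed
  show ?thesis
  proof (cases "m = 0")
    case True
    then show ?thesis using common_radical_block[of V "v 0"] V v0 vV B0 Am by simp
  next
    case False
    then have m: "m \<ge> 1" by simp
    \<comment> \<open>Only the pairings of \<open>w 0\<close> with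
      \<open>v 0, ..., v (m - 1)\<close> are prescribed; \<open>v m\<close> is in the radical of
      \<open>A\<close>. The recursion carries the duality to all \<open>w i\<close>, each step
      shifting the index of \<open>v\<close> by one.\<close>
    have "\<exists>w. (\<forall>i. w i \<in> V) \<and> (\<forall>b\<in>v ` {1..<m}. A b (w 0) = 0) \<and>
       (\<forall>j\<ge>1. j < m \<longrightarrow> (\<forall>t\<in>V. A t (w j) = B t (w (j - 1)))) \<and> A (w 0) (v 0) = 1"
    proof (rule ccontr)
      assume no: "\<not> ?thesis"
      obtain y where y: "y 0 \<in> span (v ` {1..<m})" "\<And>j. j \<le> m \<Longrightarrow> y j \<in> V" "y m = 0"
        "\<And>t. t \<in> V \<Longrightarrow> A t (v 0) = A (y 0) t - B (y 1) t"
        "\<And>j t. 1 \<le> j \<Longrightarrow> j < m \<Longrightarrow> t \<in> V \<Longrightarrow> A (y j) t = B (y (Suc j)) t"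
        by (rule chain_alternative[of V S "v ` {1..<m}" m "\<lambda>t. A t (v 0)"])
          (use V m no vV in \<open>auto simp: A.form_simps\<close>)
      obtain e where e: "y 0 = (\<Sum>i\<in>{1..<m}. e i *s v i)"
        using in_span_family[OF _ y(1)] by auto
      define vx where "vx i = (if i \<le> m then v i else 0)" for i
      have vxS: "B (vx (Suc i)) t = A (vx i) t" if "t \<in> V" for i t
        using BS[of i t] Am[OF that] that by (cases "i = m") (auto simp: vx_def)
      have vxV: "vx i \<in> V" for i using vV V by (auto simp: vx_def subspace_0)
      \<comment> \<open>The alternative says that \<open>B (y 1)\<close> is
        \<open>A (v 0) + A (y 0)\<close>, with \<open>y 0\<close> a combination of
        \<open>v 1, ..., v (m - 1)\<close>. Subtracting the same combination of shifted copies of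
        the chain, continued by zero, removes the term \<open>A (y 0)\<close>. What remains is a
        kernel chain that starts with \<open>v 0\<close> and ends before \<open>m\<close>.\<close>
      define y' where "y' j = (if j = 0 then v 0 else y j - (\<Sum>i\<in>{1..<m}. e i *s vx (i + j)))" for j
      have ye: "A (y 0) t = (\<Sum>i\<in>{1..<m}. e i * A (vx i) t)" for t
        unfolding e by (auto simp: A.form_simps vx_def intro!: sum.cong)
      have step: "B (y' (Suc j)) t = A (y' j) t" if "t \<in> V" "j < m" for j t
      proof (cases "j = 0")
        case True
        have "A (y 0) t = B (y 1) t - A (v 0) t" using y(4)[OF that(1)] A.skew[of t "v 0"]
          by (simp add: eq_diff_eq diff_eq_eq add.commute)
        then show ?thesis using that True ye[of t] by (simp add: y'_def B.form_simps vxS)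
      next
        case False
        then show ?thesis using y(5)[of j t] that
          by (simp add: y'_def A.form_simps B.form_simps vxS)
      qed
      have y'm: "y' m = 0" using m y(3) by (auto simp: y'_def vx_def intro!: sum.neutral)
      have "A (y' (m - 1)) t = 0" if "t \<in> V" for t
        using step[OF that, of "m - 1"] m y'm by simp
      moreover have "y' i \<in> V" if "i \<le> m - 1" for i
        using that y(2)[of i] vV[of 0] vxV V
        by (auto simp: y'_def intro!: subspace_diff subspace_sum subspace_scale)
      ultimately have "kernel_chain V (m - 1) y'"
        unfolding kernel_chain_def using step v0 B0 m by (auto simp: y'_def[of 0])
      with min[of "m - 1"] m show False by auto
    qed
    then obtain w where wV: "\<And>i. w i \<in> V" and w0: "\<And>i. 1 \<le> i \<Longrightarrow> i < m \<Longrightarrow> A (v i) (w 0) = 0"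
      and wS: "\<And>j t. Suc j < m \<Longrightarrow> t \<in> V \<Longrightarrow> A t (w (Suc j)) = B t (w j)"
      and w1: "A (w 0) (v 0) = 1" by force
    have vw: "A (v j) (w i) = (if i = j then -1 else 0)" if "i < m" "j \<le> m" for i j
      using that
    proof (induction i arbitrary: j)
      case 0
      then show ?case using w1 A.skew[of "v 0" "w 0"] w0[of j] Am[OF wV, of 0] by (cases "j = m") auto
    next
      case (Suc i)
      have "A (v j) (w (Suc i)) = B (v j) (w i)" using Suc.prems wS vV by simp
      also have "\<dots> = (if Suc i = j then -1 else 0)"
      proof (cases j)
        case (Suc k)
        then show ?thesis using Suc.IH[of k] Suc.prems \<open>Suc i < m\<close> BS[of k "w i"] wV by simp
      qed (simp add: B0 wV)
      finally show ?case .
    qed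
    have wv: "A (w i) (v j) = (if j = i then 1 else 0)" if "i < m" "j \<le> m" for i j
      using vw[OF that] A.skew[of "w i" "v j"] by auto
    have Bwv: "B (w i) (v j) = (if j = Suc i then 1 else 0)" if "i < m" "j \<le> m" for i j
    proof (cases j)
      case 0
      then show ?thesis using B0[OF wV] B.skew[of "w i" "v 0"] by simp
    next
      case (Suc k)
      then show ?thesis using BS[of k "w i"] wV B.skew[of "w i" "v j"] vw[of i k] that by auto
    qed
    have vv: "A (v i) (v j) = 0" if "i \<le> m" "j \<le> m" for i j
    proof (rule A.hankel_isotropic[of "Suc m"])
      fix i j assume "Suc i < Suc m" "Suc j < Suc m"
      then show "A (v i) (v (Suc j)) = A (v (Suc i)) (v j)"
        using BS[of i "v (Suc j)"] BS[of j "v (Suc i)"] vV[of "Suc i"] vV[of "Suc j"]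
          B.skew[of "v (Suc i)" "v (Suc j)"] A.skew[of "v (Suc i)" "v j"] by simp
    qed (use that in auto)
    have Bvv: "B (v i) (v j) = 0" if "i \<le> m" "j \<le> m" for i j
      using that B0 BS vV vv by (cases i) auto
    have ww: "A (w i) (w j) = 0" if "i < m" "j < m" for i j
    proof (rule A.hankel_isotropic[of m])
      fix i j assume "Suc i < m" "Suc j < m"
      then show "A (w i) (w (Suc j)) = A (w (Suc i)) (w j)"
        using wS[of j "w i"] wS[of i "w j"] wV B.skew[of "w i" "w j"] A.skew[of "w (Suc i)" "w j"]
        by simp
    qed (use that in auto)
    have Bww': "B (w i) (w j) = 0" if "i < m" "Suc j < m" for i j
      using wS[of j "w i"] wV ww[of i "Suc j"] that by simp
    \<comment> \<open>The recursion does not reach the corner \<open>i = j = m - 1\<close>; there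
      the form vanishes because it alternates.\<close>
    have Bww: "B (w i) (w j) = 0" if "i < m" "j < m" for i j
    proof (cases "Suc j < m \<or> Suc i < m")
      case True
      then show ?thesis using Bww'[of i j] Bww'[of j i] that B.skew[of "w i" "w j"] by auto
    next
      case False
      then have "i = j" using that by simp
      then show ?thesis by simp
    qed
    define xs where "xs = map w [0..<m] @ map v [0..<Suc m]"
    have lc: "lincomb c xs = (\<Sum>i<m. c i *s w i) + (\<Sum>i<Suc m. c (m + i) *s v i)" for c
      unfolding xs_def lincomb_append lincomb_map by simp
    have Awl: "A (w k) (lincomb c xs) = c (m + k)" if "k < m" for c k
    proof -
      have "(\<Sum>i<Suc m. c (m + i) * A (w k) (v i)) = c (m + k)"
        by (rule sum_pick[of k]) (use wv that in auto)
      moreover have "(\<Sum>i<m. c i * A (w k) (w i)) = 0" using ww that by simp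
      ultimately show ?thesis unfolding lc A.form_simps by simp
    qed
    \<comment> \<open>\<open>A\<close> does not see \<open>v m\<close>, so the coefficient of
      \<open>v m\<close> has to be read off by \<open>B\<close> with the last
      \<open>w\<close>.\<close>
    have Bwl: "B (w (m - 1)) (lincomb c xs) = c (m + m)" for c
    proof -
      have "(\<Sum>i<Suc m. c (m + i) * B (w (m - 1)) (v i)) = c (m + m)"
        by (rule sum_pick[of m]) (use Bwv m in auto)
      moreover have "(\<Sum>i<m. c i * B (w (m - 1)) (w i)) = 0" using Bww m by simp
      ultimately show ?thesis unfolding lc B.form_simps by simp
    qed
    have Avl: "A (v k) (lincomb c xs) = - c k" if "k < m" for c k
    proof -
      have "(\<Sum>i<m. c i * A (v k) (w i)) = - c k"
        by (rule sum_pick[of k]) (use vw that in auto)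
      moreover have "(\<Sum>i<Suc m. c (m + i) * A (v k) (v i)) = 0" using vv that by simp
      ultimately show ?thesis unfolding lc A.form_simps by simp
    qed
    have xsV: "set xs \<subseteq> V" using vV wV by (auto simp: xs_def)
    have "\<exists>V'. splits V xs V'"
    proof (rule splits_orthogonal[OF V(1) xsV])
      fix t assume t: "t \<in> V"
      define c where "c i = (if i < m then - A (v i) t else if i < m + m then A (w (i - m)) t
        else B (w (m - 1)) t)" for i
      define t' where "t' = t - lincomb c xs"
      have t': "t' \<in> V" using t V(1) xsV by (auto simp: t'_def intro: subspace_diff lincomb_in_subspace)
      have 1: "A (w k) t' = 0" if "k < m" for k
        using that by (simp add: t'_def A.diff_r Awl) (simp add: c_def)
      have 2: "B (w (m - 1)) t' = 0"
        unfolding t'_def B.diff_r Bwl by (simp add: c_def)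
      have 3: "A (v k) t' = 0" if "k \<le> m" for k
      proof (cases "k = m")
        case False
        with that show ?thesis by (simp add: t'_def A.diff_r Avl) (simp add: c_def)
      qed (simp add: Am t')
      have 4: "B (v k) t' = 0" if "k \<le> m" for k
        using that B0 BS t' 3 by (cases k) auto
      have 5: "B (w k) t' = 0" if "k < m" for k
      proof (cases "Suc k < m")
        case True
        then show ?thesis
          using wS[OF True t'] 1[OF True] A.skew[of t' "w (Suc k)"] B.skew[of "w k" t'] by simp
      next
        case False
        with that have "k = m - 1" by simp
        with 2 show ?thesis by simp
      qed
      have "A s t' = 0 \<and> B s t' = 0" if "s \<in> set xs" for s
        using that 1 3 4 5 unfolding xs_def by fastforce
      then show "\<exists>c. \<forall>x\<in>set xs. A x (t - lincomb c xs) = 0 \<and> B x (t - lincomb c xs) = 0"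
        unfolding t'_def by blast
    next
      fix c i assume *: "\<And>x. x \<in> set xs \<Longrightarrow> A x (lincomb c xs) = 0 \<and> B x (lincomb c xs) = 0"
        and i: "i < length xs"
      have i': "i < m + Suc m" using i by (simp add: xs_def)
      have wxs: "w k \<in> set xs" if "k < m" for k using that by (auto simp: xs_def)
      have vxs: "v k \<in> set xs" if "k \<le> m" for k unfolding xs_def using that by fastforce
      show "c i = 0"
      proof (cases "i < m")
        case True
        then show ?thesis using Avl[OF True, of c] *[OF vxs[of i]] by simp
      next
        case False
        show ?thesis
        proof (cases "i = m + m")
          case True
          then show ?thesis using Bwl[of c] *[OF wxs[of "m - 1"]] m by simp
        next
          case False
          with \<open>\<not> i < m\<close> i' have "i - m < m" by simp
          then show ?thesis using Awl[of "i - m" c] *[OF wxs[of "i - m"]] \<open>\<not> i < m\<close> by simp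
        qed
      qed
    qed
    moreover have "A.gram xs = plus_mat (fst (R_minus (Suc m)))" unfolding xs_def
      by (rule A.gram_plus) (use vv ww wv in \<open>auto simp: R_minus_def\<close>)
    moreover have "B.gram xs = plus_mat (snd (R_minus (Suc m)))" unfolding xs_def
      by (rule B.gram_plus) (use Bvv Bww Bwv in \<open>auto simp: R_minus_def\<close>)
    ultimately show ?thesis
      by (auto simp: R_gd_def plus_pair_def xs_def)
  qed
qed

end

section \<open>Blocks at infinity: a degenerate first form\<close>

lemma splits_swap:
  assumes "form_pair scale A B"
  shows "form_pair.splits scale B A = form_pair.splits scale A B"
proof -
  interpret form_pair scale A B by fact
  interpret s: form_pair scale B A ..
  show ?thesis unfolding splits_def s.splits_def
    by (simp only: conj_commute[of "B u v = 0" "A u v = 0" for u v])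
qed

context form_pair
begin

text \<open>Without a kernel chain the vectors of a chain \<open>y\<close> are linearly independent,
  so there is a longest one. If it had no dual chain \<open>z\<close>, the alternative would prolong
  it. After exchange of the forms the block is regular, the pairing matrix of \<open>y\<close> and
  \<open>z\<close> being antitriangular.\<close>

lemma degenerate_block:
  assumes V: "subspace V" "finite S" "V = span S"
    and nokc: "\<And>m v. \<not> kernel_chain V m v"
    and rad: "y0 \<in> V" "y0 \<noteq> 0" "\<And>t. t \<in> V \<Longrightarrow> A y0 t = 0"
  shows "\<exists>d xs V'. 1 \<le> d \<and> splits V xs V' \<and> xs \<noteq> [] \<and> (A.gram xs, B.gram xs) = R_gd (Some var_x2) d"
proof -
  define ch where "ch d y \<longleftrightarrow> (\<forall>i<d. y i \<in> V) \<and> y 0 \<noteq> 0 \<and> (\<forall>t\<in>V. A (y 0) t = 0) \<and>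
    (\<forall>i t. Suc i < d \<longrightarrow> t \<in> V \<longrightarrow> A (y (Suc i)) t = B (y i) t)" for d and y :: "nat \<Rightarrow> 'v"
  have bound: "d \<le> card S" if "ch d y" for d y
  proof (rule ccontr)
    assume "\<not> d \<le> card S"
    moreover have "y i \<in> span S" if "i < d" for i
      using \<open>ch d y\<close> that V(3) by (simp add: ch_def)
    ultimately obtain c where c: "\<exists>i<d. c i \<noteq> 0" "(\<Sum>i<d. c i *s y i) = 0"
      using family_dependent[OF V(2), of d y] by (metis not_le)
    define k where "k = Max {i. i < d \<and> c i \<noteq> 0}"
    have fin: "finite {i. i < d \<and> c i \<noteq> 0}" by simp
    have k: "k < d" "c k \<noteq> 0" using Max_in[OF fin] c(1) unfolding k_def by auto
    have kmax: "c i = 0" if "k < i" "i < d" for i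
    proof (rule ccontr)
      assume "c i \<noteq> 0"
      then have "i \<le> k" unfolding k_def using that by (intro Max_ge[OF fin]) auto
      then show False using that by simp
    qed
    \<comment> \<open>The initial part of the product of the chain, read as a polynomial vector,
      with the reversed relation. Its first term is \<open>c k\<close> times \<open>y 0\<close> and
      its term \<open>k\<close> is the relation itself, hence zero; the terms below
      \<open>k\<close>, in reverse order, form a kernel chain.\<close>
    define u where "u j = (\<Sum>l\<le>j. c (k - j + l) *s y l)" for j
    have yV: "y i \<in> V" if "i < d" for i using \<open>ch d y\<close> that by (simp add: ch_def)
    have uV: "u j \<in> V" if "j \<le> k" for j
      using that k yV V by (auto simp: u_def intro!: subspace_sum subspace_scale)
    have u0: "u 0 \<noteq> 0" using k \<open>ch d y\<close> by (simp add: u_def ch_def)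
    have "(\<Sum>i<d. c i *s y i) = (\<Sum>i\<le>k. c i *s y i)"
      using k kmax by (intro sum.mono_neutral_right) auto
    then have uk: "u k = 0" using c(2) by (simp add: u_def)
    have A0: "A (u 0) t = 0" if "t \<in> V" for t
      using that \<open>ch d y\<close> by (simp add: u_def A.form_simps ch_def)
    have uS: "A (u (Suc j)) t = B (u j) t" if "t \<in> V" "j < k" for j t
    proof -
      have "A (u (Suc j)) t = (\<Sum>l\<le>Suc j. c (k - Suc j + l) * A (y l) t)"
        by (simp only: u_def A.form_simps)
      also have "\<dots> = (\<Sum>l\<le>j. c (k - Suc j + Suc l) * A (y (Suc l)) t)"
        using \<open>ch d y\<close> that by (subst sum.atMost_Suc_shift) (simp add: ch_def)
      also have "\<dots> = (\<Sum>l\<le>j. c (k - j + l) * B (y l) t)"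
      proof (intro sum.cong refl)
        fix l assume "l \<in> {..j}"
        then have "Suc l < d" "k - Suc j + Suc l = k - j + l" using that k by auto
        then show "c (k - Suc j + Suc l) * A (y (Suc l)) t = c (k - j + l) * B (y l) t"
          using \<open>ch d y\<close> that by (simp add: ch_def)
      qed
      finally show ?thesis by (simp add: u_def B.form_simps)
    qed
    have k0: "k \<noteq> 0" using u0 uk by metis
    have "kernel_chain V (k - 1) (\<lambda>i. u (k - 1 - i))"
      unfolding kernel_chain_def
    proof (intro conjI allI impI ballI)
      show "\<exists>i\<le>k - 1. u (k - 1 - i) \<noteq> 0" using u0 by (intro exI[of _ "k - 1"]) auto
      show "B (u (k - 1 - 0)) t = 0" if "t \<in> V" for t
        using uS[OF that, of "k - 1"] k0 uk by simp
      show "B (u (k - 1 - Suc i)) t = A (u (k - 1 - i)) t" if "i < k - 1" "t \<in> V" for i t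
        using uS[OF that(2), of "k - 1 - Suc i"] that(1) by (simp add: Suc_diff_Suc)
    qed (use uV A0 in auto)
    with nokc show False by blast
  qed
  have "ch 1 (\<lambda>_. y0)" using rad by (simp add: ch_def)
  then obtain d y where dy: "ch d y" and dmax: "\<And>d' y'. ch d' y' \<Longrightarrow> d' \<le> d"
    using Nat.ex_has_greatest_nat[of "\<lambda>d. \<exists>y. ch d y" 1 "card S"] bound by metis
  have d: "d \<ge> 1" using dmax[OF \<open>ch 1 _\<close>] .
  have yV: "y i \<in> V" if "i < d" for i using dy that by (simp add: ch_def)
  have y0: "A (y 0) t = 0" if "t \<in> V" for t using dy that by (simp add: ch_def)
  have yS: "A (y (Suc i)) t = B (y i) t" if "Suc i < d" "t \<in> V" for i t using dy that by (simp add: ch_def)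
  have "\<exists>w. (\<forall>i. w i \<in> V) \<and> (\<forall>b\<in>S. A b (w 0) = 0) \<and>
     (\<forall>j\<ge>1. j < d \<longrightarrow> (\<forall>t\<in>V. A t (w j) = B t (w (j - 1)))) \<and> B (y (d - 1)) (w 0) = 1"
  proof (rule ccontr)
    assume no: "\<not> ?thesis"
    have SV: "S \<subseteq> V" using V span_superset by auto
    obtain s where s: "s 0 \<in> span S" "\<And>j. j \<le> d \<Longrightarrow> s j \<in> V" "s d = 0"
        "\<And>t. t \<in> V \<Longrightarrow> B (y (d - 1)) t = A (s 0) t - B (s 1) t"
        "\<And>j t. 1 \<le> j \<Longrightarrow> j < d \<Longrightarrow> t \<in> V \<Longrightarrow> A (s j) t = B (s (Suc j)) t"
      by (rule chain_alternative[of V S S d "\<lambda>t. B (y (d - 1)) t"])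
        (use V SV d no in \<open>auto simp: B.form_simps\<close>)
    \<comment> \<open>The sequence \<open>s\<close> runs in the opposite direction, so it is added
      reversed; the new last vector is \<open>s 0\<close>, and \<open>s d = 0\<close> keeps
      \<open>y 0\<close> unchanged.\<close>
    define y' where "y' i = (if i = d then s 0 else y i + s (d - i))" for i
    have "ch (Suc d) y'"
      unfolding ch_def
    proof (intro conjI allI impI ballI)
      show "y' i \<in> V" if "i < Suc d" for i
        using that s(2)[of 0] s(2)[of "d - i"] yV[of i] V by (auto simp: y'_def intro: subspace_add)
      show "y' 0 \<noteq> 0" using d s(3) dy by (simp add: y'_def ch_def)
      show "A (y' 0) t = 0" if "t \<in> V" for t using d s(3) y0 that by (simp add: y'_def)
      show "A (y' (Suc i)) t = B (y' i) t" if "Suc i < Suc d" "t \<in> V" for i t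
      proof (cases "Suc i = d")
        case True
        then have "y' (Suc i) = s 0" "y' i = y (d - 1) + s 1" by (auto simp: y'_def)
        then show ?thesis using s(4)[OF that(2)] by (simp add: B.form_simps)
      next
        case False
        then have "Suc i < d" "Suc (d - Suc i) = d - i" "1 \<le> d - Suc i" using that by auto
        then show ?thesis using s(5)[of "d - Suc i" t] that yS[of i t]
          by (simp add: y'_def B.form_simps A.form_simps)
      qed
    qed
    with dmax show False by force
  qed
  then obtain z where zV: "\<And>i. z i \<in> V" and zS0: "\<And>b. b \<in> S \<Longrightarrow> A b (z 0) = 0"
    and zS: "\<And>j t. Suc j < d \<Longrightarrow> t \<in> V \<Longrightarrow> A t (z (Suc j)) = B t (z j)"
    and yz: "B (y (d - 1)) (z 0) = 1" by force
  have z0: "A t (z 0) = 0" if "t \<in> V" for t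
  proof -
    have "A (z 0) t = 0"
      by (rule A.vanish_on_span[of t S]) (use that V zS0 A.skew[of "z 0"] in auto)
    then show ?thesis using A.skew[of t "z 0"] by simp
  qed
  have y0': "A t (y 0) = 0" if "t \<in> V" for t using y0[OF that] A.skew[of t "y 0"] by simp
  have yS': "A t (y (Suc i)) = B t (y i)" if "Suc i < d" "t \<in> V" for i t
    using yS[OF that] A.skew[of t "y (Suc i)"] B.skew[of t "y i"] by simp
  have isotropic: "B (p i) (p j) = 0"
    if "\<And>j t. Suc j < d \<Longrightarrow> t \<in> V \<Longrightarrow> A t (p (Suc j)) = B t (p j)" "\<And>i. i < d \<Longrightarrow> p i \<in> V" "i < d" "j < d"
    for p i j
  proof (rule B.hankel_isotropic[of d])
    fix i j assume ij: "Suc i < d" "Suc j < d"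
    have "B (p i) (p (Suc j)) = - A (p (Suc j)) (p (Suc i))"
      using that(1)[of i "p (Suc j)"] that(2)[of "Suc j"] ij B.skew[of "p i" "p (Suc j)"] by simp
    also have "\<dots> = B (p (Suc i)) (p j)"
      using that(1)[of j "p (Suc i)"] that(2)[of "Suc i"] ij A.skew[of "p (Suc i)" "p (Suc j)"] by simp
    finally show "B (p i) (p (Suc j)) = B (p (Suc i)) (p j)" .
  qed (use that in auto)
  have hank: "B (y i) (z (Suc j)) = B (y (Suc i)) (z j)" if "Suc i < d" "Suc j < d" for i j
    using that yS[of i "z (Suc j)"] zS[of j "y (Suc i)"] yV zV by simp
  have hank_sym: "B (y i) (z j) = B (y j) (z i)" if "i < d" "j < d" for i j
    by (rule hankel_symmetric[of d "\<lambda>i j. B (y i) (z j)"]) (use hank that in auto)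
  have shift: "B (y i) (z j) = B (y (i + j)) (z 0)" if "i + j < d" for i j
    using that
  proof (induction j arbitrary: i)
    case (Suc j)
    then show ?case using hank[of i j] Suc.IH[of "Suc i"] by simp
  qed simp
  \<comment> \<open>The pairing is constant along antidiagonals. It has the normalised value 1 for
    \<open>i + j = d - 1\<close> and vanishes before, because \<open>z 0\<close> lies in the radical
    of \<open>A\<close>.\<close>
  have tri: "B (y i) (z j) = (if Suc (i + j) = d then 1 else 0)" if "i + j < d" for i j
  proof (cases "Suc (i + j) = d")
    case True
    then have "i + j = d - 1" by simp
    then show ?thesis using shift[OF that] yz True by simp
  next
    case False
    then show ?thesis using shift[OF that] yS[of "i + j" "z 0"] z0[of "y (Suc (i + j))"] yV zV that by simp
  qed
  interpret s: form_pair scale B A ..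
  \<comment> \<open>The companion matrix of \<open>x^d\<close> sends index \<open>j\<close> to
    \<open>j + 1\<close>, whereas \<open>A\<close> lowers the index along a chain; hence both chains
    are listed backwards.\<close>
  have Fp: "A v (p (d - 1 - j)) = B v (\<Sum>i<d. companion (monom 1 d) $$ (i,j) *s p (d - 1 - i))"
    if "\<And>j t. Suc j < d \<Longrightarrow> t \<in> V \<Longrightarrow> A t (p (Suc j)) = B t (p j)" "\<And>t. t \<in> V \<Longrightarrow> A t (p 0) = 0"
      "v \<in> V" "j < d" for p v j
  proof -
    have "(\<Sum>i<d. companion (monom 1 d) $$ (i,j) *s p (d - 1 - i)) =
        (if Suc j < d then p (d - 1 - Suc j) else 0)"
    proof (cases "Suc j < d")
      case True
      have "(\<Sum>i<d. companion (monom 1 d) $$ (i,j) *s p (d - 1 - i)) = p (d - 1 - Suc j)"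
        by (rule sum_pick[OF True]) (use True in \<open>auto simp: companion_def degree_monom_eq Let_def\<close>)
      with True show ?thesis by simp
    next
      case False
      then have "j = d - 1" using that by simp
      then show ?thesis using that(4) False
        by (auto simp: companion_def degree_monom_eq Let_def intro!: sum.neutral)
    qed
    then show ?thesis
      using that(1)[of "d - 1 - Suc j" v] that(2-4) by (auto simp: Suc_diff_Suc)
  qed
  have "\<exists>xs V'. s.splits V xs V' \<and> length xs = 2 * d \<and>
    B.gram xs = plus_mat (1\<^sub>m d) \<and> A.gram xs = plus_mat (companion (monom 1 d))"
  proof (rule s.regular_block[where x = "\<lambda>i. y (d - 1 - i)" and w = "\<lambda>i. z (d - 1 - i)"])
    fix c :: "nat \<Rightarrow> 'a" and j
    assume eq: "\<And>i. i < d \<Longrightarrow> (\<Sum>j<d. c j * B (y (d - 1 - i)) (z (d - 1 - j))) = 0" and "j < d"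
    from \<open>j < d\<close> show "c j = 0"
    \<comment> \<open>A triangular system: in the row of \<open>y j\<close> the terms beyond
      \<open>j\<close> vanish by \<open>tri\<close> and the earlier ones by induction.\<close>
    proof (induction j rule: less_induct)
      case (less j)
      have "0 = (\<Sum>k<d. c k * B (y j) (z (d - 1 - k)))"
        using eq[of "d - 1 - j"] less.prems by simp
      also have "\<dots> = c j"
      proof (rule sum_pick[OF less.prems])
        fix k assume "k < d"
        then show "c k * B (y j) (z (d - 1 - k)) = (if k = j then c j else 0)"
          using less.IH[of k] tri[of j "d - 1 - k"] less.prems by (cases "k < j") auto
      qed
      finally show ?case by simp
    qed
  next
    fix i j assume "i < d" "j < d"
    then show "B (y (d - 1 - i)) (z (d - 1 - j)) = B (y (d - 1 - j)) (z (d - 1 - i))"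
      by (intro hank_sym) auto
    show "B (y (d - 1 - i)) (y (d - 1 - j)) = 0"
      by (rule isotropic) (use yS' yV \<open>i < d\<close> \<open>j < d\<close> in auto)
    show "B (z (d - 1 - i)) (z (d - 1 - j)) = 0"
      by (rule isotropic) (use zS zV \<open>i < d\<close> \<open>j < d\<close> in auto)
  next
    fix v j assume "v \<in> V" "j < d"
    then show "A v (y (d - 1 - j)) = B v (\<Sum>i<d. companion (monom 1 d) $$ (i,j) *s y (d - 1 - i))"
      by (intro Fp) (use yS' y0' in auto)
    show "A v (z (d - 1 - j)) = B v (\<Sum>i<d. companion (monom 1 d) $$ (i,j) *s z (d - 1 - i))"
      by (rule Fp) (use zS z0 \<open>v \<in> V\<close> \<open>j < d\<close> in auto)
  qed (use V yV zV in \<open>auto simp: companion_def degree_monom_eq Let_def\<close>)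
  then obtain xs V' where "s.splits V xs V'" "length xs = 2 * d"
    "B.gram xs = plus_mat (1\<^sub>m d)" "A.gram xs = plus_mat (companion (monom 1 d))" by auto
  then show ?thesis using d splits_swap[OF form_pair_axioms]
    by (intro exI[of _ d] exI[of _ xs] exI[of _ V']) (auto simp: R_gd_def plus_pair_def R_inf_def)
qed

end

section \<open>Finite elementary divisors: polynomials in a self-adjoint operator\<close>

lemma irreducible_poly_bezout:
  fixes p f :: "'a::field poly"
  assumes "irreducible p" "\<not> p dvd f"
  obtains a b where "a * p + b * f = 1"
proof -
  \<comment> \<open>An element of least degree in the ideal of \<open>p\<close> and \<open>f\<close>
    divides both; as \<open>p\<close> is irreducible and does not divide \<open>f\<close>, it is a
    unit.\<close>
  let ?I = "\<lambda>g. g \<noteq> 0 \<and> (\<exists>a b. g = a * p + b * f)"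
  have "?I p" using assms(1) by (intro conjI exI[of _ 1] exI[of _ "0 :: 'a poly"]) auto
  then obtain d where d: "?I d" and min: "\<And>g. ?I g \<Longrightarrow> degree d \<le> degree g"
    using ex_has_least_nat[of ?I p degree] by blast
  obtain a b where ab: "d = a * p + b * f" using d by auto
  have dvd: "d dvd a' * p + b' * f" for a' b'
  proof (rule ccontr)
    let ?h = "a' * p + b' * f"
    assume "\<not> d dvd ?h"
    then have nz: "?h mod d \<noteq> 0" by (simp add: dvd_eq_mod_eq_0)
    have "?h mod d = ?h - (?h div d) * d" by (simp add: minus_div_mult_eq_mod)
    also have "\<dots> = (a' - (?h div d) * a) * p + (b' - (?h div d) * b) * f"
      unfolding ab by (simp add: algebra_simps)
    finally have "?I (?h mod d)" using nz by blast
    from min[OF this] show False using degree_mod_less[of d ?h] d nz by auto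
  qed
  have "d dvd p" "d dvd f" using dvd[of 1 0] dvd[of 0 1] by auto
  then obtain k where k: "p = d * k" by auto
  have "is_unit d"
  proof (rule ccontr)
    assume "\<not> is_unit d"
    then have "is_unit k" using irreducibleD[OF assms(1) k] by auto
    then have "p dvd d" using k by simp
    with \<open>d dvd f\<close> assms(2) show False using dvd_trans by blast
  qed
  then obtain e where "1 = d * e" by auto
  then have "(e * a) * p + (e * b) * f = 1" unfolding ab by (simp add: algebra_simps)
  then show thesis by (rule that)
qed

lemma irreducible_poly_degree:
  fixes p :: "'a::field poly"
  assumes "irreducible p"
  shows "degree p > 0"
  using assms by (auto simp: irreducible_def is_unit_iff_degree)

lemma irreducible_power_split:
  fixes p m :: "'a::field poly"
  assumes "irreducible p" "m \<noteq> 0"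
  obtains N q where "m = p ^ N * q" "\<not> p dvd q"
  using assms(2)
proof (induction "degree m" arbitrary: m thesis rule: less_induct)
  case less
  show ?case
  proof (cases "p dvd m")
    case True
    then obtain k where k: "m = p * k" by auto
    then have "k \<noteq> 0" using less.prems by auto
    moreover have "degree k < degree m"
      using k \<open>k \<noteq> 0\<close> irreducible_poly_degree[OF assms(1)] by (cases "p = 0") (auto simp: degree_mult_eq)
    ultimately obtain N q where "k = p ^ N * q" "\<not> p dvd q" using less.hyps by metis
    then show ?thesis using k by (intro less.prems(1)[of "Suc N" q]) (auto simp: mult.assoc)
  next
    case False
    then show ?thesis by (intro less.prems(1)[of 0 m]) auto
  qed
qed

text \<open>\<open>T\<close> will come from a pointwise choice and is known to be linear only on
  \<open>V\<close>; hence membership in \<open>V\<close> accompanies every law below.\<close>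

locale operator_on = linear_space scale
  for scale :: "'a::field \<Rightarrow> 'v::ab_group_add \<Rightarrow> 'v" (infixr "*s" 75) +
  fixes V :: "'v set" and T :: "'v \<Rightarrow> 'v"
  assumes V: "subspace V"
    and T_in: "x \<in> V \<Longrightarrow> T x \<in> V"
    and T_add: "x \<in> V \<Longrightarrow> y \<in> V \<Longrightarrow> T (x + y) = T x + T y"
    and T_scale: "x \<in> V \<Longrightarrow> T (c *s x) = c *s T x"
begin

lemma zero_in: "0 \<in> V" using V by (rule subspace_0)
lemma add_in: "x \<in> V \<Longrightarrow> y \<in> V \<Longrightarrow> x + y \<in> V" using V by (rule subspace_add)
lemma scale_in: "x \<in> V \<Longrightarrow> c *s x \<in> V" using V by (rule subspace_scale)

lemma T_zero: "T 0 = 0"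
  using T_scale[OF zero_in, of 0] by simp

lemma T_pow_in: "x \<in> V \<Longrightarrow> (T ^^ i) x \<in> V"
  by (induction i) (auto simp: T_in)

text \<open>The vector \<open>f(T) x\<close>, computed by Horner's rule.\<close>

definition pact :: "'a poly \<Rightarrow> 'v \<Rightarrow> 'v" where
  "pact f x = fold_coeffs (\<lambda>a z. a *s x + T z) f 0"

lemma pact_0 [simp]: "pact 0 x = 0"
  by (simp add: pact_def)

lemma pact_pCons: "pact (pCons a f) x = a *s x + T (pact f x)"
  by (cases "f = 0 \<and> a = 0") (auto simp: pact_def T_zero)

lemma pact_in: "x \<in> V \<Longrightarrow> pact f x \<in> V"
  by (induction f) (auto simp: pact_pCons zero_in intro: add_in scale_in T_in)

lemma pact_add: "x \<in> V \<Longrightarrow> pact (f + g) x = pact f x + pact g x"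
  by (induction f g rule: poly_induct2)
    (auto simp: pact_pCons T_add pact_in scale_left_distrib algebra_simps)

lemma pact_smult: "x \<in> V \<Longrightarrow> pact (smult c f) x = c *s pact f x"
  by (induction f) (auto simp: pact_pCons T_scale pact_in scale_right_distrib)

lemma pact_minus: "x \<in> V \<Longrightarrow> pact (- f) x = - pact f x"
  using pact_smult[of x "-1" f] by simp

lemma pact_diff: "x \<in> V \<Longrightarrow> pact (f - g) x = pact f x - pact g x"
  using pact_add[of x f "- g"] pact_minus by simp

lemma pact_vec_add: "x \<in> V \<Longrightarrow> y \<in> V \<Longrightarrow> pact f (x + y) = pact f x + pact f y"
  by (induction f) (auto simp: pact_pCons T_add pact_in scale_right_distrib)

lemma pact_vec_scale: "x \<in> V \<Longrightarrow> pact f (c *s x) = c *s pact f x"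
  by (induction f) (auto simp: pact_pCons T_scale pact_in scale_right_distrib mult.commute)

lemma pact_vec_zero [simp]: "pact f 0 = 0"
  using pact_vec_scale[OF zero_in, of f 0] by simp

lemma pact_T: "x \<in> V \<Longrightarrow> pact f (T x) = T (pact f x)"
  by (induction f) (auto simp: pact_pCons T_add T_scale pact_in T_in scale_in T_zero)

lemma pact_mult: "x \<in> V \<Longrightarrow> pact (f * g) x = pact f (pact g x)"
  by (induction f) (auto simp: pact_pCons pact_add pact_smult)

lemma pact_1 [simp]: "pact 1 x = x"
  by (simp add: one_pCons pact_pCons T_zero)

lemma pact_monom: "x \<in> V \<Longrightarrow> pact (monom c i) x = c *s (T ^^ i) x"
  by (induction i) (auto simp: monom_0 monom_Suc pact_pCons T_zero T_scale T_pow_in)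

lemma pact_sum: "x \<in> V \<Longrightarrow> pact (sum g K) x = (\<Sum>k\<in>K. pact (g k) x)"
  by (induction K rule: infinite_finite_induct) (auto simp: pact_add)

lemma pact_eq_sum:
  assumes "x \<in> V" "\<And>i. i \<ge> n \<Longrightarrow> coeff f i = 0"
  shows "pact f x = (\<Sum>i<n. coeff f i *s (T ^^ i) x)"
proof -
  have "f = (\<Sum>i<n. monom (coeff f i) i)"
    by (intro poly_eqI) (auto simp: coeff_sum assms(2) not_less)
  then have "pact f x = pact (\<Sum>i<n. monom (coeff f i) i) x" by metis
  also have "\<dots> = (\<Sum>i<n. coeff f i *s (T ^^ i) x)"
    using assms(1) by (simp add: pact_sum pact_monom)
  finally show ?thesis .
qed

lemma coeff_Poly_map: "coeff (Poly (map c [0..<n])) i = (if i < n then c i else 0)"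
  by (simp add: nth_default_def)

lemma pact_Poly: "x \<in> V \<Longrightarrow> pact (Poly (map c [0..<n])) x = (\<Sum>i<n. c i *s (T ^^ i) x)"
  by (subst pact_eq_sum[of x n]) (auto simp: coeff_Poly_map simp del: coeff_Poly_eq)

text \<open>The product of annihilators of the vectors in a finite spanning set; each comes from a
  linear relation between \<open>card S + 1\<close> iterates of its vector.\<close>

lemma pact_annihilator:
  assumes "finite S" "V = span S"
  obtains M where "M \<noteq> 0" "\<And>x. x \<in> V \<Longrightarrow> pact M x = 0"
proof -
  have single: "\<exists>m. m \<noteq> 0 \<and> pact m x = 0" if x: "x \<in> V" for x
  proof -
    obtain c where c: "\<exists>i<Suc (card S). c i \<noteq> 0" "(\<Sum>i<Suc (card S). c i *s (T ^^ i) x) = 0"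
      using family_dependent[OF assms(1), of "Suc (card S)" "\<lambda>i. (T ^^ i) x"] T_pow_in[OF x] assms(2)
      by auto
    have "Poly (map c [0..<Suc (card S)]) \<noteq> 0"
      using c(1) coeff_Poly_map[of c "Suc (card S)"] by (metis coeff_0)
    with c(2) pact_Poly[OF x] show ?thesis by metis
  qed
  have "\<exists>M. M \<noteq> 0 \<and> (\<forall>x\<in>R. pact M x = 0)" if "finite R" "R \<subseteq> V" for R
    using that
  proof (induction R rule: finite_induct)
    case empty
    then show ?case by (intro exI[of _ 1]) auto
  next
    case (insert x R)
    then obtain M m where "M \<noteq> 0" "\<forall>x\<in>R. pact M x = 0" "m \<noteq> 0" "pact m x = 0"
      using single[of x] by auto
    moreover have "pact (m * M) y = 0" if "y \<in> R" for y
      using that insert.prems calculation by (subst pact_mult) auto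
    moreover have "pact (M * m) x = 0" using insert.prems calculation by (subst pact_mult) auto
    ultimately show ?case by (intro exI[of _ "m * M"]) (auto simp: mult.commute)
  qed
  from this[of S] obtain M where M: "M \<noteq> 0" "\<And>x. x \<in> S \<Longrightarrow> pact M x = 0"
    using assms span_superset by blast
  have "pact M x = 0" if "x \<in> V" for x
  proof -
    have "x \<in> V \<and> pact M x = 0" using that[unfolded assms(2)]
    proof (induction x rule: span_induct_alt)
      case (step c y z)
      have "y \<in> V" using step(1) assms(2) by (simp add: span_base)
      with step show ?case by (auto simp: pact_vec_add pact_vec_scale scale_in add_in M)
    qed (simp add: zero_in)
    then show ?thesis by simp
  qed
  with M(1) that show thesis by blast
qed

end

locale self_adjoint = form_pair scale A B + operator_on scale V T
  for scale :: "'a::field \<Rightarrow> 'v::ab_group_add \<Rightarrow> 'v" (infixr "*s" 75) and A B V T +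
  assumes AT: "x \<in> V \<Longrightarrow> y \<in> V \<Longrightarrow> A (T x) y = B x y"
    and nondegenerate: "x \<in> V \<Longrightarrow> (\<And>t. t \<in> V \<Longrightarrow> A x t = 0) \<Longrightarrow> x = 0"
begin

lemma A_T: "x \<in> V \<Longrightarrow> y \<in> V \<Longrightarrow> A (T x) y = A x (T y)"
  using AT[of x y] AT[of y x] A.skew[of x "T y"] B.skew[of x y] by simp

lemma A_pact: "x \<in> V \<Longrightarrow> y \<in> V \<Longrightarrow> A (pact f x) y = A x (pact f y)"
proof (induction f arbitrary: y)
  case (pCons a f)
  have "A (pact (pCons a f) x) y = a * A x y + A (pact f x) (T y)"
    using pCons.prems by (simp add: pact_pCons A.form_simps A_T pact_in)
  also have "\<dots> = A x (pact (pCons a f) y)"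
    using pCons.prems pCons.IH[of "T y"] by (simp add: pact_pCons A.form_simps T_in pact_T)
  finally show ?case .
qed simp

lemma companion_column:
  assumes f: "lead_coeff f = 1" and x: "x \<in> V" "pact f x = 0" and j: "j < degree f"
  shows "(\<Sum>i<degree f. companion f $$ (i,j) *s (T ^^ i) x) = (T ^^ Suc j) x"
proof (cases "Suc j < degree f")
  case True
  show ?thesis
    by (rule sum_pick[OF True]) (use True in \<open>auto simp: companion_def Let_def\<close>)
next
  case False
  then have j': "Suc j = degree f" using j by simp
  have "0 = (\<Sum>i<Suc (degree f). coeff f i *s (T ^^ i) x)"
    using pact_eq_sum[OF x(1), of "Suc (degree f)" f] x(2) by (simp add: coeff_eq_0)
  also have "\<dots> = (\<Sum>i<degree f. coeff f i *s (T ^^ i) x) + (T ^^ Suc j) x"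
    using f j' by simp
  finally have "(T ^^ Suc j) x = - (\<Sum>i<degree f. coeff f i *s (T ^^ i) x)"
    by (simp only: eq_neg_iff_add_eq_0 add.commute)
  also have "\<dots> = (\<Sum>i<degree f. companion f $$ (i,j) *s (T ^^ i) x)"
    unfolding sum_negf[symmetric]
  proof (intro sum.cong refl)
    fix i assume "i \<in> {..<degree f}"
    moreover have "j = degree f - 1" using j' by simp
    ultimately show "- (coeff f i *s (T ^^ i) x) = companion f $$ (i,j) *s (T ^^ i) x"
      using j by (simp add: companion_def Let_def)
  qed
  finally show ?thesis by simp
qed

text \<open>All operators \<open>f(T)\<close> are self-adjoint. The nondegenerate pairing of the
  cyclic spaces of \<open>x\<close> and \<open>y\<close>, both annihilated by \<open>p^e\<close>,
  therefore reduces to one nonzero value of \<open>A\<close>, taken at \<open>p^(e-1)(T) x\<close>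
  and \<open>y\<close>.\<close>

lemma finite_block:
  assumes S: "finite S" "V = span S" and ne: "V \<noteq> {0}"
  shows "\<exists>p e xs V'. irreducible p \<and> lead_coeff p = 1 \<and> 1 \<le> e \<and> splits V xs V' \<and> xs \<noteq> [] \<and>
    A.gram xs = plus_mat (1\<^sub>m (degree (p ^ e))) \<and> B.gram xs = plus_mat (companion (p ^ e))"
proof -
  obtain M where M: "M \<noteq> 0" "\<And>x. x \<in> V \<Longrightarrow> pact M x = 0"
    using pact_annihilator[OF S] by metis
  let ?P = "\<lambda>m. lead_coeff m = 1 \<and> (\<exists>v\<in>V. v \<noteq> 0 \<and> pact m v = 0)"
  have monic: "?P (smult (inverse (lead_coeff m)) m)" if "m \<noteq> 0" "v \<in> V" "v \<noteq> 0" "pact m v = 0" for m v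
    using that by (auto simp: pact_smult intro!: bexI[of _ v])
  obtain v0 where "v0 \<in> V" "v0 \<noteq> 0" using ne zero_in by blast
  then have "?P (smult (inverse (lead_coeff M)) M)" using monic M by blast
  \<comment> \<open>Of minimal degree among the monic annihilators of nonzero vectors, \<open>p\<close> is irreducible.\<close>
  then obtain p where p: "?P p" and pmin: "\<And>m. ?P m \<Longrightarrow> degree p \<le> degree m"
    using ex_has_least_nat[of ?P _ degree] by blast
  have pmin': "degree p \<le> degree m" if "m \<noteq> 0" "v \<in> V" "v \<noteq> 0" "pact m v = 0" for m v
    using pmin[OF monic[OF that]] that(1) by simp
  obtain v where v: "v \<in> V" "v \<noteq> 0" "pact p v = 0" using p by auto
  have p0: "p \<noteq> 0" using p by auto
  have irr: "irreducible p"
  proof (rule irreducibleI)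
    show "\<not> is_unit p"
    proof
      assume "is_unit p"
      then obtain c where "p = [:c:]" "c dvd 1" using is_unit_poly_iff by blast
      moreover from this have "c \<noteq> 0" by auto
      ultimately have "p = [:c:]" "c \<noteq> 0" by auto
      with v show False by (simp add: pact_pCons T_zero)
    qed
    fix a b assume ab: "p = a * b"
    then have nz: "a \<noteq> 0" "b \<noteq> 0" using p0 by auto
    have deg: "degree p = degree a + degree b" using ab nz by (simp add: degree_mult_eq)
    have "degree a = 0 \<or> degree b = 0"
    proof (cases "pact b v = 0")
      case True
      then show ?thesis using pmin'[OF nz(2) v(1,2)] deg by simp
    next
      case False
      have "pact a (pact b v) = 0" using v ab pact_mult by metis
      then show ?thesis using pmin'[OF nz(1) pact_in[OF v(1)] False] deg by simp
    qed
    then show "is_unit a \<or> is_unit b" using nz by (auto simp: is_unit_iff_degree)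
  qed (use p0 in auto)
  \<comment> \<open>\<open>q\<close> stands for the part of an annihilating polynomial prime to
    \<open>p\<close>. By minimality of \<open>e\<close>, no such \<open>q\<close> lets
    \<open>p^(e-1) q\<close> annihilate the whole space.\<close>
  let ?E = "\<lambda>e. \<exists>q. \<not> p dvd q \<and> (\<forall>x\<in>V. pact (p ^ e * q) x = 0)"
  obtain N q' where "M = p ^ N * q'" "\<not> p dvd q'" using irreducible_power_split[OF irr M(1)] .
  then have "?E N" using M(2) by blast
  define e where "e = (LEAST e. ?E e)"
  have "?E e" unfolding e_def by (rule LeastI[of ?E]) fact
  then obtain q where q: "\<not> p dvd q" "\<And>x. x \<in> V \<Longrightarrow> pact (p ^ e * q) x = 0" by auto
  have emin: "\<not> ?E k" if "k < e" for k using that not_less_Least unfolding e_def by blast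
  obtain a b where bez: "a * p + b * q = 1" using irreducible_poly_bezout[OF irr q(1)] .
  have coprime_kernel: "x = 0" if "x \<in> V" "pact p x = 0" "pact q x = 0" for x
  proof -
    have "x = pact (a * p + b * q) x" using bez by simp
    also have "\<dots> = 0" using that by (simp add: pact_add pact_mult)
    finally show ?thesis .
  qed
  have "e \<noteq> 0"
  proof
    assume "e = 0"
    then show False using coprime_kernel[OF v(1)] q(2)[OF v(1)] v by simp
  qed
  then obtain k where k: "e = Suc k" by (cases e) auto
  obtain x0 where x0: "x0 \<in> V" "pact (p ^ k * q) x0 \<noteq> 0" using emin[of k] q(1) k by auto
  define u where "u = pact (p ^ k * q) x0"
  have u: "u \<in> V" "u \<noteq> 0" using x0 by (auto simp: u_def pact_in)
  have "pact p u = 0" using q(2)[OF x0(1)] x0 k by (simp add: u_def pact_mult[symmetric] mult.assoc)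
  then have "pact q u \<noteq> 0" using coprime_kernel u by blast
  \<comment> \<open>A second factor \<open>q\<close> does no harm because \<open>q(T)\<close> is
    injective on the kernel of \<open>p(T)\<close>. By self-adjointness it moves to the other
    argument, so that \<open>x\<close> and \<open>y\<close> are both annihilated by
    \<open>p^e\<close>.\<close>
  then obtain z where z: "z \<in> V" "A (pact q u) z \<noteq> 0"
    using nondegenerate[OF pact_in[OF u(1)]] by blast
  define x where "x = pact q x0"
  define y where "y = pact q z"
  define f where "f = p ^ e"
  have xV: "x \<in> V" and yV: "y \<in> V" using x0 z by (auto simp: x_def y_def pact_in)
  have fx: "pact f x = 0" and fy: "pact f y = 0"
    using q(2) x0 z by (auto simp: f_def x_def y_def pact_mult[symmetric])
  have xy: "A (pact (p ^ k) x) y \<noteq> 0"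
  proof -
    have "A (pact (p ^ k) x) y = A (pact q (pact (p ^ k) x)) z"
      using A_pact[OF pact_in[OF xV] z(1), of q "p ^ k"] by (simp add: y_def)
    also have "pact q (pact (p ^ k) x) = pact q u"
      using x0 by (simp add: x_def u_def pact_mult[symmetric])
    finally show ?thesis using z by simp
  qed
  have lf: "lead_coeff f = 1" using p by (simp add: f_def lead_coeff_power)
  have f0: "f \<noteq> 0" using lf by auto
  have df: "degree f = e * degree p" using p0 by (simp add: f_def degree_power_eq)
  define D where "D = degree f"
  have D: "D > 0" using df irreducible_poly_degree[OF irr] \<open>e \<noteq> 0\<close> by (simp add: D_def)
  have step: "A ((T ^^ i) s) ((T ^^ Suc j) t) = A ((T ^^ Suc i) s) ((T ^^ j) t)" if "s \<in> V" "t \<in> V" for s t i j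
    using A_T[OF T_pow_in[OF that(1)] T_pow_in[OF that(2)]] by simp
  have col: "B r ((T ^^ j) s) = A r (\<Sum>i<D. companion f $$ (i,j) *s (T ^^ i) s)"
    if "r \<in> V" "s \<in> V" "pact f s = 0" "j < D" for r s j
  proof -
    have "B r ((T ^^ j) s) = A r ((T ^^ Suc j) s)"
      using AT[OF T_pow_in[OF that(2)] that(1)] A.skew[of r "T ((T ^^ j) s)"] B.skew[of r "(T ^^ j) s"] by simp
    then show ?thesis using companion_column[OF lf that(2,3)] that(4) by (simp add: D_def)
  qed
  have "\<exists>xs V'. splits V xs V' \<and> length xs = 2 * D \<and>
    A.gram xs = plus_mat (1\<^sub>m D) \<and> B.gram xs = plus_mat (companion f)"
  proof (rule regular_block[where x = "\<lambda>i. (T ^^ i) x" and w = "\<lambda>i. (T ^^ i) y"])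
    fix c :: "nat \<Rightarrow> 'a" and j
    assume eq: "\<And>i. i < D \<Longrightarrow> (\<Sum>j<D. c j * A ((T ^^ i) x) ((T ^^ j) y)) = 0" and j: "j < D"
    define g where "g = Poly (map c [0..<D])"
    show "c j = 0"
    proof (rule ccontr)
      assume "c j \<noteq> 0"
      then have g0: "g \<noteq> 0" using coeff_Poly_map[of c D j] j unfolding g_def by (metis coeff_0)
      have dg: "degree g < D"
      proof -
        have "degree g \<le> D - 1" unfolding g_def
          by (rule degree_le) (auto simp: coeff_Poly_map simp del: coeff_Poly_eq)
        with D show ?thesis by simp
      qed
      obtain l g' where g': "g = p ^ l * g'" "\<not> p dvd g'" using irreducible_power_split[OF irr g0] .
      then have "degree g = l * degree p + degree g'"
        using g0 p0 by (auto simp: degree_mult_eq degree_power_eq)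
      then have "l * degree p + degree g' < e * degree p" using dg df by (simp only: D_def)
      then have "l * degree p < e * degree p" by (rule le_less_trans[OF le_add1])
      then have le: "l < e" by simp
      obtain a b where ab: "a * p + b * g' = 1" using irreducible_poly_bezout[OF irr g'(2)] .
      \<comment> \<open>\<open>b\<close> inverts \<open>g'\<close> modulo \<open>p\<close>, and the
        power of \<open>p\<close> fills the exponent up to \<open>k = e - 1\<close>, so
        \<open>h * g\<close> is \<open>p^k\<close> modulo \<open>f\<close>. If \<open>g(T) y\<close>
        is orthogonal to all iterates of \<open>x\<close>, the value in \<open>xy\<close> becomes
        zero.\<close>
      define h where "h = p ^ (k - l) * b"
      have "h * g = p ^ (k - l + l) * (b * g')" unfolding h_def g'(1) power_add by (simp add: mult_ac)
      also have "k - l + l = k" using le k by simp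
      also have "b * g' = 1 - a * p" using ab by (simp add: algebra_simps)
      also have "p ^ k * (1 - a * p) = p ^ k - a * f" by (simp add: f_def k algebra_simps)
      finally have hg: "h * g = p ^ k - a * f" .
      have ag: "A ((T ^^ i) x) (pact g y) = 0" if "i < D" for i
        using eq[OF that] by (simp add: g_def pact_Poly yV A.form_simps del: Poly.simps)
      have "h = (h div f) * f + h mod f" by simp
      then have "pact h x = pact (h mod f) x"
        using pact_add[OF xV, of "(h div f) * f" "h mod f"] pact_mult[OF xV, of "h div f" f] fx by simp
      also have "\<dots> = (\<Sum>i<D. coeff (h mod f) i *s (T ^^ i) x)"
      proof (rule pact_eq_sum[OF xV])
        fix i assume "D \<le> i"
        then show "coeff (h mod f) i = 0"
          using degree_mod_less[OF f0, of h] by (auto simp: D_def intro: coeff_eq_0)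
      qed
      finally have "A (pact h x) (pact g y) = 0" by (simp add: A.form_simps ag)
      moreover have "A (pact h x) (pact g y) = A (pact (h * g) x) y"
        using A_pact[OF pact_in[OF xV] yV, of g h] by (simp add: pact_mult[OF xV, symmetric] mult.commute)
      moreover have "pact (h * g) x = pact (p ^ k) x"
        unfolding hg by (simp add: pact_diff pact_mult xV fx)
      ultimately show False using xy by simp
    qed
  next
    fix i j assume ij: "i < D" "j < D"
    show "A ((T ^^ i) x) ((T ^^ j) x) = 0" "A ((T ^^ i) y) ((T ^^ j) y) = 0"
      by (rule A.hankel_isotropic[of D]; use ij step xV yV in blast)+
    show "A ((T ^^ i) x) ((T ^^ j) y) = A ((T ^^ j) x) ((T ^^ i) y)"
      by (rule hankel_symmetric[of D "\<lambda>i j. A ((T ^^ i) x) ((T ^^ j) y)"]) (use ij step xV yV in blast)+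
  next
    fix r j assume "r \<in> V" "j < D"
    then show "B r ((T ^^ j) x) = A r (\<Sum>i<D. companion f $$ (i,j) *s (T ^^ i) x)"
      "B r ((T ^^ j) y) = A r (\<Sum>i<D. companion f $$ (i,j) *s (T ^^ i) y)"
      using col xV yV fx fy by blast+
  qed (use V xV yV in \<open>auto simp: companion_def Let_def D_def T_pow_in\<close>)
  then obtain xs V' where "splits V xs V'" "length xs = 2 * D"
    "A.gram xs = plus_mat (1\<^sub>m D)" "B.gram xs = plus_mat (companion f)" by auto
  then show ?thesis using irr p \<open>e \<noteq> 0\<close> D
    by (intro exI[of _ p] exI[of _ e] exI[of _ xs] exI[of _ V']) (auto simp: f_def D_def)
qed

end

context form_pair
begin

lemma nondegenerate_block:
  assumes V: "subspace V" "finite S" "V = span S" and ne: "V \<noteq> {0}"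
    and nd: "\<And>x. x \<in> V \<Longrightarrow> (\<And>t. t \<in> V \<Longrightarrow> A x t = 0) \<Longrightarrow> x = 0"
  shows "\<exists>p e xs V'. irreducible p \<and> lead_coeff p = 1 \<and> 1 \<le> e \<and> splits V xs V' \<and> xs \<noteq> [] \<and>
    A.gram xs = plus_mat (1\<^sub>m (degree (p ^ e))) \<and> B.gram xs = plus_mat (companion (p ^ e))"
proof -
  have "\<exists>u. u \<in> V \<and> (\<forall>t\<in>V. A u t = B x t)" if x: "x \<in> V" for x
  proof -
    \<comment> \<open>The functional \<open>B x\<close> is represented through \<open>A\<close>: the
      common kernel of the functionals \<open>A b\<close>, with \<open>b\<close> in a spanning set,
      is the radical of \<open>A\<close>, which \<open>nd\<close> makes zero.\<close>
    have "\<exists>c. \<forall>t\<in>V. B x t = (\<Sum>b\<in>S. c b * A b t)"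
    proof (rule functional_in_span[where ad = "(+)" and sm = scale])
      fix t assume t: "t \<in> V" "\<And>b. b \<in> S \<Longrightarrow> A b t = 0"
      have "A t s = 0" if "s \<in> V" for s
        by (rule A.vanish_on_span[of s S]) (use that V t A.skew[of t] in auto)
      then have "t = 0" using nd t by blast
      then show "B x t = 0" by simp
    qed (use V in \<open>auto simp: A.form_simps B.form_simps intro: subspace_add subspace_scale\<close>)
    then obtain c where c: "\<And>t. t \<in> V \<Longrightarrow> B x t = (\<Sum>b\<in>S. c b * A b t)" by auto
    have "(\<Sum>b\<in>S. c b *s b) \<in> V" using V by (auto intro!: span_sum span_scale intro: span_base)
    with c show ?thesis by (intro exI[of _ "\<Sum>b\<in>S. c b *s b"]) (auto simp: A.form_simps)
  qed
  then obtain T where T: "\<And>x. x \<in> V \<Longrightarrow> T x \<in> V" "\<And>x t. x \<in> V \<Longrightarrow> t \<in> V \<Longrightarrow> A (T x) t = B x t"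
    by metis
  have uniq: "x = y" if "x \<in> V" "y \<in> V" "\<And>t. t \<in> V \<Longrightarrow> A x t = A y t" for x y
    using nd[of "x - y"] that V by (auto simp: A.form_simps subspace_diff)
  note span_V = V(2,3)
  interpret self_adjoint scale A B V T
  proof
    show "T (x + y) = T x + T y" if "x \<in> V" "y \<in> V" for x y
      by (rule uniq) (use that V T in \<open>auto simp: A.form_simps B.form_simps subspace_add\<close>)
    show "T (c *s x) = c *s T x" if "x \<in> V" for x c
      by (rule uniq) (use that V T in \<open>auto simp: A.form_simps B.form_simps subspace_scale\<close>)
  qed (use V T nd in auto)
  show ?thesis using finite_block[OF span_V ne] .
qed

end

section \<open>Homogeneous polynomials and the action of GL(2)\<close>

lemma map_poly_hom_add:
  assumes "\<phi> 0 = 0" "\<And>a b. \<phi> (a + b) = \<phi> a + \<phi> b"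
  shows "map_poly \<phi> (p + q) = map_poly \<phi> p + map_poly \<phi> q"
  by (intro poly_eqI) (simp add: coeff_map_poly assms)

lemma map_poly_hom_mult:
  fixes \<phi> :: "'a::comm_semiring_0 \<Rightarrow> 'b::comm_semiring_0"
  assumes "\<phi> 0 = 0" "\<And>a b. \<phi> (a + b) = \<phi> a + \<phi> b" "\<And>a b. \<phi> (a * b) = \<phi> a * \<phi> b"
  shows "map_poly \<phi> (p * q) = map_poly \<phi> p * map_poly \<phi> q"
proof (intro poly_eqI)
  fix n
  have "\<phi> (sum f K) = (\<Sum>k\<in>K. \<phi> (f k))" for f and K :: "nat set"
    by (induction K rule: infinite_finite_induct) (auto simp: assms)
  then show "coeff (map_poly \<phi> (p * q)) n = coeff (map_poly \<phi> p * map_poly \<phi> q) n"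
    by (simp add: coeff_map_poly coeff_mult assms)
qed

lemma gl_act_add: "gl_act Q (g + h) = gl_act Q g + gl_act Q h"
  by (simp add: gl_act_def eval2_def map_poly_hom_add)

lemma gl_act_mult: "gl_act Q (g * h) = gl_act Q g * gl_act Q h"
  by (simp add: gl_act_def eval2_def map_poly_hom_add map_poly_hom_mult)

lemma gl_act_const [simp]: "gl_act Q [:[:c:]:] = [:[:c:]:]"
  by (simp add: gl_act_def eval2_def map_poly_pCons)

lemma gl_act_0 [simp]: "gl_act Q 0 = 0"
  by (simp add: gl_act_def eval2_def)

lemma gl_act_1 [simp]: "gl_act Q 1 = 1"
  using gl_act_const[of Q 1] by (simp add: one_pCons)

lemma gl_act_x1: "gl_act Q [:0, 1:] = lin2 (Q $$ (0,0)) (Q $$ (0,1))"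
  by (simp add: gl_act_def eval2_def map_poly_pCons pCons_one)

lemma gl_act_x2: "gl_act Q var_x2 = lin2 (Q $$ (1,0)) (Q $$ (1,1))"
  by (simp add: gl_act_def eval2_def map_poly_pCons var_x2_def pCons_one)

lemma gl_act_sum: "gl_act Q (sum f K) = (\<Sum>k\<in>K. gl_act Q (f k))"
  by (induction K rule: infinite_finite_induct) (auto simp: gl_act_add)

lemma gl_act_power: "gl_act Q (g ^ n) = gl_act Q g ^ n"
  by (induction n) (auto simp: gl_act_mult)

lemma lin2_eq: "lin2 a b = [:[:a:]:] * [:0, 1:] + [:[:b:]:] * var_x2"
  by (simp add: lin2_def var_x2_def)

lemma gl_act_lin2:
  "gl_act Q (lin2 a b) = lin2 (a * Q $$ (0,0) + b * Q $$ (1,0)) (a * Q $$ (0,1) + b * Q $$ (1,1))"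
  unfolding lin2_eq[of a b]
  by (simp only: gl_act_add gl_act_mult gl_act_const gl_act_x1 gl_act_x2) (simp add: lin2_def)

lemma bivariate_hom_eqI:
  fixes \<phi> \<psi> :: "'a::comm_ring_1 poly poly \<Rightarrow> 'b::comm_ring_1"
  assumes "\<And>g h. \<phi> (g + h) = \<phi> g + \<phi> h" "\<And>g h. \<phi> (g * h) = \<phi> g * \<phi> h"
    and "\<And>g h. \<psi> (g + h) = \<psi> g + \<psi> h" "\<And>g h. \<psi> (g * h) = \<psi> g * \<psi> h"
    and "\<And>c. \<phi> [:[:c:]:] = \<psi> [:[:c:]:]" "\<phi> [:0, 1:] = \<psi> [:0, 1:]" "\<phi> [:[:0, 1:]:] = \<psi> [:[:0, 1:]:]"
  shows "\<phi> g = \<psi> g"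
proof -
  have inner: "\<phi> [:c:] = \<psi> [:c:]" for c
  proof (induction c)
    case 0
    then show ?case using assms(5)[of 0] by simp
  next
    case (pCons a c)
    have "[:pCons a c:] = [:[:a:]:] + [:[:0, 1:]:] * [:c:]" by simp
    then show ?case using pCons by (simp only: assms)
  qed
  show ?thesis
  proof (induction g)
    case 0
    then show ?case using assms(5)[of 0] by simp
  next
    case (pCons c g)
    have "pCons c g = [:c:] + [:0, 1:] * g" by simp
    then show ?case using pCons inner by (simp only: assms)
  qed
qed

text \<open>Substitution reverses the order of the factors, because the linear forms of
  \<open>R\<close> are themselves transformed by \<open>Q\<close>. It is enough to compare both
  sides on constants and on the two variables.\<close>

lemma gl_act_comp:
  assumes "Q \<in> carrier_mat 2 2" "R \<in> carrier_mat 2 2"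
  shows "gl_act Q (gl_act R h) = gl_act (R * Q) h"
proof (rule bivariate_hom_eqI[where \<phi> = "\<lambda>h. gl_act Q (gl_act R h)"])
  have *: "(R * Q) $$ (i,j) = R $$ (i,0) * Q $$ (0,j) + R $$ (i,1) * Q $$ (1,j)" if "i < 2" "j < 2" for i j
    using assms that by (simp add: scalar_prod_def numeral_2_eq_2)
  show "gl_act Q (gl_act R [:0, 1:]) = gl_act (R * Q) [:0, 1:]"
    by (simp add: gl_act_x1 gl_act_lin2 *)
  show "gl_act Q (gl_act R [:[:0, 1:]:]) = gl_act (R * Q) [:[:0, 1:]:]"
    by (simp add: gl_act_x2[unfolded var_x2_def] gl_act_lin2 *)
qed (auto simp: gl_act_add gl_act_mult)

lemma gl_act_one: "gl_act (1\<^sub>m 2) h = (h :: 'a::field poly poly)"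
proof (rule bivariate_hom_eqI)
  show "gl_act (1\<^sub>m 2) [:0, 1:] = ([:0, 1:] :: 'a poly poly)"
    by (simp add: gl_act_x1 lin2_def)
qed (auto simp: gl_act_add gl_act_mult gl_act_x2[unfolded var_x2_def] lin2_def)

lemma gl_act_inverse:
  assumes "Q \<in> carrier_mat 2 2" "R \<in> carrier_mat 2 2" "R * Q = 1\<^sub>m 2"
  shows "gl_act Q (gl_act R h) = h"
  using assms by (simp add: gl_act_comp gl_act_one)

section \<open>Forms of degree \<open>d\<close> and polynomials in one variable\<close>

definition homog :: "nat \<Rightarrow> 'a::field poly poly \<Rightarrow> bool" where
  "homog d g \<longleftrightarrow> (\<forall>i j. coeff (coeff g i) j \<noteq> 0 \<longrightarrow> i + j = d)"

text \<open>Together with \<open>dehom\<close>, which sets \<open>x2 = 1\<close>, this is a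
  bijection between forms of degree \<open>d\<close> and polynomials of degree at most
  \<open>d\<close>. Factorisation thus moves to one variable; powers of \<open>x2\<close> become 1
  and are treated apart.\<close>

definition homogenize :: "nat \<Rightarrow> 'a::field poly \<Rightarrow> 'a poly poly" where
  "homogenize d f = (\<Sum>i\<le>d. monom (monom (coeff f i) (d - i)) i)"

definition dehom :: "'a::field poly poly \<Rightarrow> 'a poly" where
  "dehom g = map_poly (\<lambda>c. poly c 1) g"

lemma homog_0 [simp]: "homog d 0"
  by (simp add: homog_def)

lemma homog_add: "homog d g \<Longrightarrow> homog d h \<Longrightarrow> homog d (g + h)"
  unfolding homog_def by (metis add.right_neutral coeff_add)

lemma homog_sum: "(\<And>k. k \<in> K \<Longrightarrow> homog d (f k)) \<Longrightarrow> homog d (sum f K)"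
  by (induction K rule: infinite_finite_induct) (auto intro: homog_add)

lemma homog_mult:
  assumes "homog a g" "homog b h"
  shows "homog (a + b) (g * h)"
  unfolding homog_def
proof (intro allI impI)
  fix i j assume "coeff (coeff (g * h) i) j \<noteq> 0"
  then have "(\<Sum>k\<le>i. \<Sum>l\<le>j. coeff (coeff g k) l * coeff (coeff h (i - k)) (j - l)) \<noteq> 0"
    by (simp add: coeff_mult coeff_sum)
  then obtain k where k: "k \<le> i" "(\<Sum>l\<le>j. coeff (coeff g k) l * coeff (coeff h (i - k)) (j - l)) \<noteq> 0"
    by (meson atMost_iff sum.neutral)
  then obtain l where "l \<le> j" "coeff (coeff g k) l * coeff (coeff h (i - k)) (j - l) \<noteq> 0"
    by (meson atMost_iff sum.neutral)
  with k assms have "k + l = a" "(i - k) + (j - l) = b" by (auto simp: homog_def)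
  with \<open>k \<le> i\<close> \<open>l \<le> j\<close> show "i + j = a + b" by linarith
qed

lemma homog_const: "homog 0 [:[:c:]:]"
  by (auto simp: homog_def coeff_pCons split: nat.splits)

lemma homog_1: "homog 0 1"
  using homog_const[of 1] by (simp add: one_pCons)

lemma homog_power: "homog a g \<Longrightarrow> homog (n * a) (g ^ n)"
  by (induction n) (auto simp: homog_1 intro: homog_mult)

lemma homog_lin2: "homog 1 (lin2 a b)"
  by (auto simp: homog_def lin2_def coeff_pCons split: nat.splits)

lemma homog_x2: "homog 1 var_x2"
  by (auto simp: homog_def var_x2_def coeff_pCons split: nat.splits)

lemma coeff_homogenize:
  "coeff (coeff (homogenize d f) i) j = (if i + j = d then coeff f i else 0)"
proof -
  have "coeff (coeff (homogenize d f) i) j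
      = (\<Sum>k\<le>d. if k = i then (if d - i = j then coeff f i else 0) else 0)"
    unfolding homogenize_def coeff_sum by (intro sum.cong) auto
  then show ?thesis by auto
qed

lemma homog_homogenize: "homog d (homogenize d f)"
  by (auto simp: homog_def coeff_homogenize)

lemma dehom_add: "dehom (g + h) = dehom g + dehom h"
  by (simp add: dehom_def map_poly_hom_add)

lemma dehom_mult: "dehom (g * h) = dehom g * dehom h"
  by (simp add: dehom_def map_poly_hom_mult)

lemma dehom_0 [simp]: "dehom 0 = 0" by (simp add: dehom_def)

lemma dehom_const [simp]: "dehom [:[:c:]:] = [:c:]"
  by (simp add: dehom_def map_poly_pCons)

lemma dehom_1 [simp]: "dehom 1 = 1"
  using dehom_const[of 1] by (simp add: one_pCons)

lemma dehom_power: "dehom (g ^ n) = dehom g ^ n"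
  by (induction n) (auto simp: dehom_mult)

lemma dehom_x1 [simp]: "dehom [:0, 1:] = [:0, 1:]"
  by (simp add: dehom_def map_poly_pCons one_pCons)

lemma dehom_x2 [simp]: "dehom var_x2 = 1"
  by (simp add: dehom_def map_poly_pCons var_x2_def one_pCons)

lemma dehom_sum: "dehom (sum f K) = (\<Sum>k\<in>K. dehom (f k))"
  by (induction K rule: infinite_finite_induct) (auto simp: dehom_add)

lemma coeff_dehom:
  assumes "homog d g"
  shows "coeff (dehom g) i = (if i \<le> d then coeff (coeff g i) (d - i) else 0)"
proof -
  have c: "coeff g i = (if i \<le> d then monom (coeff (coeff g i) (d - i)) (d - i) else 0)"
  proof (intro poly_eqI)
    fix j
    show "coeff (coeff g i) j = coeff (if i \<le> d then monom (coeff (coeff g i) (d - i)) (d - i) else 0) j"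
      using assms[unfolded homog_def, rule_format, of i j]
        assms[unfolded homog_def, rule_format, of i "d - i"]
      by (cases "coeff (coeff g i) j = 0") auto
  qed
  show ?thesis unfolding dehom_def
    by (subst coeff_map_poly, simp) (subst c, auto simp: poly_monom)
qed

lemma degree_dehom: "homog d g \<Longrightarrow> degree (dehom g) \<le> d"
  by (rule degree_le) (auto simp: coeff_dehom)

lemma homogenize_dehom:
  assumes "homog d g"
  shows "homogenize d (dehom g) = g"
proof (intro poly_eqI)
  fix i j
  show "coeff (coeff (homogenize d (dehom g)) i) j = coeff (coeff g i) j"
    using assms[unfolded homog_def, rule_format, of i j]
    by (auto simp: coeff_homogenize coeff_dehom[OF assms])
qed

lemma dehom_homogenize: "degree f \<le> d \<Longrightarrow> dehom (homogenize d f) = f"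
  by (intro poly_eqI) (simp add: coeff_dehom[OF homog_homogenize] coeff_homogenize coeff_eq_0)

lemma dehom_inj: "homog d g \<Longrightarrow> homog d h \<Longrightarrow> dehom g = dehom h \<Longrightarrow> g = h"
  by (metis homogenize_dehom)

lemma homogenize_mult:
  assumes "degree f \<le> a" "degree g \<le> b"
  shows "homogenize (a + b) (f * g) = homogenize a f * homogenize b g"
proof (rule dehom_inj)
  have "degree (f * g) \<le> a + b" using assms degree_mult_le[of f g] by linarith
  then show "dehom (homogenize (a + b) (f * g)) = dehom (homogenize a f * homogenize b g)"
    using assms by (simp add: dehom_homogenize dehom_mult)
qed (auto intro: homog_homogenize homog_mult)

lemma gl_act_homog:
  assumes "homog d g"
  shows "homog d (gl_act Q g)"
proof -
  have mon: "monom (monom c b) a = [:[:c:]:] * ([:0, 1:] ^ a * var_x2 ^ b)" for c :: 'a and a b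
  proof -
    have "var_x2 ^ b = [:monom (1 :: 'a) b:]" by (simp add: var_x2_def poly_const_pow monom_altdef)
    then show ?thesis by (simp add: monom_altdef)
  qed
  have "gl_act Q g = (\<Sum>i\<le>d. gl_act Q (monom (monom (coeff (dehom g) i) (d - i)) i))"
    by (subst homogenize_dehom[OF assms, symmetric]) (simp add: homogenize_def gl_act_sum)
  also have "homog d \<dots>"
  proof (rule homog_sum)
    fix i assume i: "i \<in> {..d}"
    let ?c = "coeff (dehom g) i"
    have "homog (0 + (i * 1 + (d - i) * 1)) (gl_act Q (monom (monom ?c (d - i)) i))"
      unfolding mon gl_act_mult gl_act_power gl_act_const gl_act_x1 gl_act_x2
      by (intro homog_mult homog_power homog_const homog_lin2)
    then show "homog d (gl_act Q (monom (monom ?c (d - i)) i))" using i by simp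
  qed
  finally show ?thesis .
qed

lemma homog_monic:
  assumes "homog d g" "lead_coeff g = 1"
  shows "degree g = d" "lead_coeff (dehom g) = 1" "degree (dehom g) = d"
proof -
  have "coeff (coeff g (degree g)) 0 \<noteq> 0" using assms(2) by simp
  then show d: "degree g = d" using assms(1) unfolding homog_def by fastforce
  have "coeff (dehom g) d = 1" using assms d by (simp add: coeff_dehom)
  moreover have "degree (dehom g) \<le> d" using degree_dehom assms(1) .
  ultimately show "degree (dehom g) = d"
    by (metis le_antisym le_degree zero_neq_one)
  then show "lead_coeff (dehom g) = 1" using \<open>coeff (dehom g) d = 1\<close> by simp
qed

lemma homogenize_monic:
  assumes "lead_coeff q = 1"
  shows "lead_coeff (homogenize (degree q) q) = 1"
proof -
  let ?g = "homogenize (degree q) q"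
  have c: "coeff ?g (degree q) = 1"
    by (intro poly_eqI) (use assms in \<open>auto simp: coeff_homogenize coeff_1\<close>)
  have "degree ?g \<le> degree q"
    by (rule degree_le) (auto intro!: poly_eqI simp: coeff_homogenize)
  moreover have "degree q \<le> degree ?g" using c by (intro le_degree) simp
  ultimately show ?thesis using c by simp
qed

lemma is_unit_bivariate: "is_unit (g :: 'a::field poly poly) \<longleftrightarrow> (\<exists>c. c \<noteq> 0 \<and> g = [:[:c:]:])"
proof
  assume "is_unit g"
  then obtain c where "g = [:c:]" "c dvd 1" using is_unit_poly_iff by blast
  moreover from this(2) obtain d where "c = [:d:]" "d dvd 1" using is_unit_poly_iff by blast
  ultimately show "\<exists>c. c \<noteq> 0 \<and> g = [:[:c:]:]" by auto
next
  assume "\<exists>c. c \<noteq> 0 \<and> g = [:[:c:]:]"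
  then show "is_unit g" by (auto simp: is_unit_const_poly_iff dvd_field_iff)
qed

text \<open>Homogenizing the factors of \<open>dehom g\<close> gives factors of \<open>g\<close>. No
  degree is lost, because with leading coefficient 1 in \<open>x1\<close> the form is not divisible
  by \<open>x2\<close>.\<close>

lemma irreducible_dehom:
  assumes g: "homog d g" "lead_coeff g = 1" "irreducible g"
  shows "irreducible (dehom g)"
proof (rule irreducibleI)
  note dg = homog_monic[OF g(1,2)]
  show nz: "dehom g \<noteq> 0" using dg(2) by auto
  show "\<not> is_unit (dehom g)"
  proof
    assume "is_unit (dehom g)"
    then have "d = 0" using dg nz by (simp add: is_unit_iff_degree)
    with dg(1) obtain c where "g = [:c:]" by (metis degree_eq_zeroE)
    with g(2,3) show False by (auto simp: irreducible_def pCons_one)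
  qed
  fix a b assume ab: "dehom g = a * b"
  then have nz: "a \<noteq> 0" "b \<noteq> 0" using nz by auto
  have deg: "degree a + degree b = d" using ab nz dg(3) by (simp add: degree_mult_eq)
  have "g = homogenize (degree a + degree b) (a * b)"
    using homogenize_dehom[OF g(1)] ab deg by simp
  then have "g = homogenize (degree a) a * homogenize (degree b) b"
    by (simp add: homogenize_mult)
  then have "is_unit (homogenize (degree a) a) \<or> is_unit (homogenize (degree b) b)"
    using irreducibleD[OF g(3)] by blast
  moreover have "is_unit f" if "is_unit (homogenize (degree f) f)" for f :: "'a poly"
  proof -
    from that obtain c where "c \<noteq> 0" "homogenize (degree f) f = [:[:c:]:]"
      using is_unit_bivariate by blast
    then have "f = [:c:]" using dehom_homogenize[of f "degree f"] by simp
    with \<open>c \<noteq> 0\<close> show ?thesis by (simp add: is_unit_const_poly_iff dvd_field_iff)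
  qed
  ultimately show "is_unit a \<or> is_unit b" by blast
qed

text \<open>The factors are not known to be homogeneous. Their leading coefficients in
  \<open>x1\<close> are constants, so setting \<open>x2 = 1\<close> preserves the degree in
  \<open>x1\<close>, and a factor that becomes a unit was already constant.\<close>

lemma irreducible_homogenize:
  assumes q: "irreducible q" "lead_coeff q = 1"
  shows "irreducible (homogenize (degree q) q)"
proof (rule irreducibleI)
  let ?g = "homogenize (degree q) q"
  have lg: "lead_coeff ?g = 1" by (rule homogenize_monic[OF q(2)])
  have dg: "dehom ?g = q" by (simp add: dehom_homogenize)
  show "?g \<noteq> 0" using lg by auto
  show "\<not> is_unit ?g"
  proof
    assume "is_unit ?g"
    then obtain c where "c \<noteq> 0" "?g = [:[:c:]:]" using is_unit_bivariate by blast
    then have "q = [:c:]" using dg by simp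
    then show False using irreducible_poly_degree[OF q(1)] by simp
  qed
  fix a b assume ab: "?g = a * b"
  have lc: "lead_coeff a * lead_coeff b = 1" using lg ab by (simp add: lead_coeff_mult)
  have unit: "is_unit s" if u: "is_unit (dehom s)" and l: "lead_coeff s dvd 1" for s :: "'a poly poly"
  proof -
    obtain c where c: "lead_coeff s = [:c:]" "c \<noteq> 0"
      using l is_unit_poly_iff[of "lead_coeff s"] by (auto simp: dvd_field_iff)
    then have "coeff (dehom s) (degree s) \<noteq> 0" by (simp add: dehom_def coeff_map_poly)
    then have "degree s \<le> degree (dehom s)" by (rule le_degree)
    moreover have "degree (dehom s) = 0"
      using u by (metis is_unit_polyE degree_pCons_0)
    ultimately have "s = [:lead_coeff s:]" by (metis degree_eq_zeroE le_zero_eq lead_coeff_pCons(2))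
    also have "\<dots> = [:[:c:]:]" by (simp only: c(1))
    finally show ?thesis using c(2) is_unit_bivariate[of s] by blast
  qed
  have "dehom a * dehom b = q" using ab dg dehom_mult by metis
  then have "is_unit (dehom a) \<or> is_unit (dehom b)" using irreducibleD[OF q(1)] by blast
  moreover have "lead_coeff a dvd 1" "lead_coeff b dvd 1" using lc by (metis dvdI mult.commute)+
  ultimately show "is_unit a \<or> is_unit b" using unit by blast
qed

section \<open>Unital irreducible forms and the action of GL(2) on them\<close>

lemma irreducible_x2: "irreducible (var_x2 :: 'a::field poly poly)"
  unfolding var_x2_def irreducible_const_poly_iff by (rule irreducible_linear_field_poly) simp

lemma PP_x2: "var_x2 \<in> PP"
  using irreducible_x2 homog_x2 by (auto simp: PP_def unital_def homogeneous2_def homog_def)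

lemma x2_not_monic: "lead_coeff var_x2 \<noteq> (1 :: 'a::field poly)"
  by (simp add: var_x2_def one_pCons)

lemma PP_homog:
  assumes "g \<in> PP"
  obtains d where "homog d g"
  using assms by (auto simp: PP_def homogeneous2_def homog_def)

lemma PP_monic: "g \<in> PP \<Longrightarrow> g \<noteq> var_x2 \<Longrightarrow> lead_coeff g = 1"
  by (auto simp: PP_def unital_def)

lemma homog_unique:
  assumes "homog d g" "homog e g" "g \<noteq> 0"
  shows "d = e"
proof -
  have "coeff (coeff g (degree g)) (degree (lead_coeff g)) \<noteq> 0" using assms(3) by simp
  with assms(1,2) show ?thesis unfolding homog_def by metis
qed

lemma PP_homogenize:
  assumes "irreducible q" "lead_coeff q = 1"
  shows "homogenize (degree q) q \<in> PP" "homogenize (degree q) q \<noteq> var_x2"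
    "dehom (homogenize (degree q) q) = q"
proof -
  note h = homogenize_monic[OF assms(2)]
  show "homogenize (degree q) q \<in> PP"
    using irreducible_homogenize[OF assms] h homog_homogenize[of "degree q" q]
    by (auto simp: PP_def unital_def homogeneous2_def homog_def)
  show "homogenize (degree q) q \<noteq> var_x2" using h x2_not_monic by metis
qed (simp add: dehom_homogenize)

lemma PP_dehom:
  assumes "g \<in> PP" "g \<noteq> var_x2"
  shows "irreducible (dehom g)" "lead_coeff (dehom g) = 1" "homog (degree (dehom g)) g"
    "homogenize (degree (dehom g)) (dehom g) = g"
proof -
  obtain d where d: "homog d g" using PP_homog[OF assms(1)] .
  note m = PP_monic[OF assms]
  show "irreducible (dehom g)" using irreducible_dehom[OF d m] assms(1) by (simp add: PP_def)
  show "lead_coeff (dehom g) = 1" using homog_monic[OF d m] by simp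
  show "homog (degree (dehom g)) g" using homog_monic[OF d m] d by simp
  then show "homogenize (degree (dehom g)) (dehom g) = g" by (rule homogenize_dehom)
qed

text \<open>The leading coefficients in \<open>x1\<close> are 1 or \<open>x2\<close>, and no nonzero
  scalar takes one to the other; equal ones force \<open>c = 1\<close>.\<close>

lemma PP_scalar_unique:
  assumes "g \<in> PP" "h \<in> PP" "c \<noteq> 0" "[:[:c:]:] * g = h"
  shows "g = h"
proof -
  have deg: "degree h = degree g" "lead_coeff h = [:c:] * lead_coeff g" using assms(3,4) by auto
  have u: "lead_coeff var_x2 = [:0, 1 :: 'a:]" by (simp add: var_x2_def)
  have c: "c = 1" if "lead_coeff g = lead_coeff h"
  proof -
    have "(1 - [:c:]) * lead_coeff g = 0" using deg(2) that by (simp add: left_diff_distrib)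
    then have "[:c:] = 1" using assms(1) by (auto simp: PP_def)
    then show ?thesis by (simp add: one_pCons)
  qed
  have ne: "[:c:] * 1 \<noteq> [:0, 1:]" "[:c:] * [:0, 1:] \<noteq> 1" using assms(3) by (auto simp: one_pCons)
  have "lead_coeff g = lead_coeff h"
    using PP_monic[OF assms(1)] PP_monic[OF assms(2)] deg(2) u ne by metis
  with c assms(4) show ?thesis by (auto simp: pCons_one)
qed

text \<open>The leading coefficient in \<open>x1\<close> of a form is \<open>c x2^k\<close>. For
  \<open>k = 0\<close> division by \<open>c\<close> makes the form unital; for \<open>k > 0\<close>
  it is divisible by \<open>x2\<close>, hence a scalar multiple of \<open>x2\<close>.\<close>

lemma irreducible_homog_PP:
  fixes h :: "'a::field poly poly"
  assumes h: "homog d h" "irreducible h"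
  shows "\<exists>g\<in>PP. \<exists>c. c \<noteq> 0 \<and> h = [:[:c:]:] * g"
proof -
  have h0: "h \<noteq> 0" using h(2) by auto
  define n where "n = degree h"
  obtain k where nk: "n + k = d" using h(1) h0
  proof -
    have "coeff (coeff h n) (degree (lead_coeff h)) \<noteq> 0" using h0 by (simp add: n_def)
    then have "n + degree (lead_coeff h) = d" using h(1) by (auto simp: homog_def)
    then show ?thesis using that by blast
  qed
  define c where "c = coeff (coeff h n) k"
  have lc: "lead_coeff h = monom c k"
  proof (intro poly_eqI)
    fix j
    show "coeff (lead_coeff h) j = coeff (monom c k) j"
      using h(1)[unfolded homog_def, rule_format, of n j] nk
      by (cases "coeff (lead_coeff h) j = 0") (auto simp: c_def n_def)
  qed
  have c0: "c \<noteq> 0" using lc h0 by (metis leading_coeff_0_iff monom_eq_0_iff)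
  show ?thesis
  proof (cases "k = 0")
    case True
    define g where "g = [:[:1 / c:]:] * h"
    have hg: "h = [:[:c:]:] * g" using c0 by (simp add: g_def pCons_one)
    have "lead_coeff g = 1" using lc True c0 by (simp add: g_def monom_0 pCons_one)
    moreover have "homog d g" using homog_mult[OF homog_const h(1), of "1 / c"] by (simp add: g_def)
    moreover have "irreducible g"
    proof -
      have "is_unit [:[:1 / c:]:]" using c0 is_unit_bivariate by fastforce
      then show ?thesis using h(2) unfolding g_def by (simp only: irreducible_mult_unit_left)
    qed
    ultimately have "g \<in> PP" by (auto simp: PP_def unital_def homogeneous2_def homog_def)
    with hg c0 show ?thesis by blast
  next
    case False
    define h' where "h' = homogenize (d - 1) (dehom h)"
    have deg: "degree (dehom h) \<le> d - 1"
    proof (rule degree_le, intro allI impI)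
      fix i assume "d - 1 < i"
      then have "n < i" using nk False by simp
      then have "coeff h i = 0" by (simp add: n_def coeff_eq_0)
      then show "coeff (dehom h) i = 0" by (simp add: dehom_def coeff_map_poly)
    qed
    have "h = var_x2 * h'"
    proof (rule dehom_inj[OF h(1)])
      have "homog (1 + (d - 1)) (var_x2 * h')" unfolding h'_def
        by (intro homog_mult homog_x2 homog_homogenize)
      then show "homog d (var_x2 * h')" using False nk by simp
      show "dehom h = dehom (var_x2 * h')" using deg by (simp add: dehom_mult h'_def dehom_homogenize)
    qed
    moreover have "\<not> is_unit (var_x2 :: 'a poly poly)" by (rule irreducible_not_unit[OF irreducible_x2])
    ultimately have "is_unit h'" using irreducibleD[OF h(2)] by blast
    then obtain c where "c \<noteq> 0" "h' = [:[:c:]:]" using is_unit_bivariate by blast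
    with \<open>h = var_x2 * h'\<close> show ?thesis using PP_x2 by (metis mult.commute)
  qed
qed

lemma gl_act_unit: "is_unit g \<Longrightarrow> is_unit (gl_act Q g)"
  by (metis dvd_def gl_act_1 gl_act_mult)

lemma invertible_mat2E:
  assumes "Q \<in> carrier_mat 2 2" "invertible_mat Q"
  obtains R where "R \<in> carrier_mat 2 2" "R * Q = 1\<^sub>m 2" "Q * R = 1\<^sub>m 2" "invertible_mat R"
proof -
  obtain R where R: "inverts_mat Q R" "inverts_mat R Q" using assms(2) by (auto simp: invertible_mat_def)
  have QR: "Q * R = 1\<^sub>m 2" using R(1) assms(1) by (simp add: inverts_mat_def)
  have dR: "R * Q = 1\<^sub>m (dim_row R)" using R(2) by (simp add: inverts_mat_def)
  have "dim_col (Q * R) = 2" "dim_col (R * Q) = dim_row R" using QR dR by simp_all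
  then have Rc: "R \<in> carrier_mat 2 2" using assms(1) by auto
  moreover have "invertible_mat R" using R Rc by (auto simp: invertible_mat_def)
  ultimately show thesis using that QR dR by auto
qed

lemma gl_act_irreducible:
  assumes Q: "Q \<in> carrier_mat 2 2" "invertible_mat Q" and g: "irreducible g"
  shows "irreducible (gl_act Q g)"
proof -
  obtain R where R: "R \<in> carrier_mat 2 2" "R * Q = 1\<^sub>m 2" "Q * R = 1\<^sub>m 2"
    using invertible_mat2E[OF Q] by metis
  have inv: "gl_act R (gl_act Q h) = h" "gl_act Q (gl_act R h) = h" for h :: "'a poly poly"
    using gl_act_inverse Q(1) R by blast+
  show ?thesis
  proof (rule irreducibleI)
    show "gl_act Q g \<noteq> 0" using g inv(1)[of g] by auto
    show "\<not> is_unit (gl_act Q g)"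
      using gl_act_unit[of "gl_act Q g" R] inv(1)[of g] g by (auto simp: irreducible_def)
    fix a b assume "gl_act Q g = a * b"
    then have "g = gl_act R a * gl_act R b" using inv(1) gl_act_mult by metis
    then have "is_unit (gl_act R a) \<or> is_unit (gl_act R b)" using irreducibleD[OF g] by blast
    then show "is_unit a \<or> is_unit b" using gl_act_unit[of _ Q] inv(2) by metis
  qed
qed

lemma gl_star_eqI:
  assumes "g' \<in> PP" "c \<noteq> 0" "gl_act Q g = [:[:c:]:] * g'"
  shows "gl_star Q g = g'"
  unfolding gl_star_def
proof (rule the_equality)
  fix h assume "h \<in> PP \<and> (\<exists>c. c \<noteq> 0 \<and> gl_act Q g = [:[:c:]:] * h)"
  then obtain b where "h \<in> PP" "b \<noteq> 0" "gl_act Q g = [:[:b:]:] * h" by auto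
  moreover from this assms have "[:[:c / b:]:] * g' = [:[:1 / b:]:] * ([:[:b:]:] * h)"
    by (metis (no_types, lifting) mult.assoc mult_pCons_left mult_zero_left add_0_right
        smult_pCons smult_0_right times_divide_eq_left mult_1 pCons_0_0)
  ultimately show "h = g'" using PP_scalar_unique[OF assms(1), of h "c / b"] assms(2)
    by (simp add: pCons_one)
qed (use assms in auto)

lemma gl_star:
  assumes Q: "Q \<in> carrier_mat 2 2" "invertible_mat Q" and g: "g \<in> PP"
  shows "gl_star Q g \<in> PP" "\<exists>c. c \<noteq> 0 \<and> gl_act Q g = [:[:c:]:] * gl_star Q g"
proof -
  obtain d where "homog d g" using PP_homog[OF g] .
  then have "homog d (gl_act Q g)" by (rule gl_act_homog)
  moreover have "irreducible (gl_act Q g)" using gl_act_irreducible[OF Q] g by (simp add: PP_def)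
  ultimately obtain g' c where "g' \<in> PP" "c \<noteq> 0" "gl_act Q g = [:[:c:]:] * g'"
    using irreducible_homog_PP by blast
  with gl_star_eqI[OF this] show "gl_star Q g \<in> PP" "\<exists>c. c \<noteq> 0 \<and> gl_act Q g = [:[:c:]:] * gl_star Q g"
    by auto
qed

lemma gl_star_inverse:
  assumes Q: "Q \<in> carrier_mat 2 2" "invertible_mat Q" and R: "R \<in> carrier_mat 2 2" "R * Q = 1\<^sub>m 2"
    and R': "invertible_mat R" and g: "g \<in> PP"
  shows "gl_star Q (gl_star R g) = g"
proof -
  obtain c where c: "c \<noteq> 0" "gl_act R g = [:[:c:]:] * gl_star R g" using gl_star[OF R(1) R' g] by blast
  have "g = gl_act Q (gl_act R g)" using gl_act_inverse Q(1) R by metis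
  also have "\<dots> = [:[:c:]:] * gl_act Q (gl_star R g)" unfolding c(2) gl_act_mult by simp
  finally have "[:[:1 / c:]:] * g = [:[:1 / c:]:] * ([:[:c:]:] * gl_act Q (gl_star R g))" by (rule arg_cong)
  then have "gl_act Q (gl_star R g) = [:[:1 / c:]:] * g" using c(1) by (simp add: pCons_one)
  then show ?thesis using gl_star_eqI[OF g, of "1 / c"] c(1) by simp
qed

lemma gl_star_homog:
  assumes Q: "Q \<in> carrier_mat 2 2" "invertible_mat Q" and g: "g \<in> PP" "homog d g"
  shows "homog d (gl_star Q g)"
proof -
  obtain c where c: "c \<noteq> 0" "gl_act Q g = [:[:c:]:] * gl_star Q g" using gl_star[OF Q g(1)] by blast
  have "homog (0 + d) ([:[:1 / c:]:] * gl_act Q g)"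
    by (intro homog_mult homog_const gl_act_homog g(2))
  also have "[:[:1 / c:]:] * gl_act Q g = gl_star Q g" using c by (simp add: pCons_one)
  finally show ?thesis by simp
qed

section \<open>Iterated splitting into blocks\<close>

context form_pair
begin

lemma splits_dim_less:
  assumes "splits V xs V'" "xs \<noteq> []" "finite S" "V \<subseteq> span S"
  shows "dim V' < dim V"
proof (rule dim_less[of V' V "xs ! 0" S])
  show "xs ! 0 \<notin> V'"
  proof
    assume *: "xs ! 0 \<in> V'"
    define c :: "nat \<Rightarrow> 'a" where "c i = (if i = 0 then 1 else 0)" for i
    have "lincomb c xs = xs ! 0"
      unfolding lincomb_def using assms(2) by (intro sum_pick[of 0]) (auto simp: c_def)
    then have "lincomb c xs \<in> V'" using * by simp
    moreover have "lincomb c xs \<in> V' \<longrightarrow> (\<forall>i<length xs. c i = 0)"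
      using assms(1) unfolding splits_def by blast
    ultimately have "c 0 = 0" using assms(2) by blast
    then show False by (simp add: c_def)
  qed
qed (use assms in \<open>auto simp: splits_def\<close>)

text \<open>The order of the cases matters: chains at infinity are bounded in length once kernel
  chains are excluded, and the operator \<open>T\<close> is obtained from nondegeneracy of
  \<open>A\<close>.\<close>

lemma block_exists:
  assumes V: "subspace V" "finite S" "V = span S" and ne: "V \<noteq> {0}"
  shows "\<exists>p xs V'. p \<in> PPt \<times> {1..} \<and> splits V xs V' \<and> xs \<noteq> [] \<and>
    (A.gram xs, B.gram xs) = R_gd (fst p) (snd p)"
proof (cases "\<exists>m v. kernel_chain V m v")
  case True
  define m where "m = (LEAST m. \<exists>v. kernel_chain V m v)"
  have "\<exists>v. kernel_chain V m v" unfolding m_def using True by (rule LeastI_ex)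
  then obtain v where v: "kernel_chain V m v" ..
  have "\<not> kernel_chain V k u" if "k < m" for k u
    using that not_less_Least unfolding m_def by blast
  from singular_block[OF V v this] show ?thesis
    by (auto intro!: exI[of _ "(None, Suc m)"] simp: PPt_def)
next
  case nokc: False
  show ?thesis
  proof (cases "\<exists>y\<in>V. y \<noteq> 0 \<and> (\<forall>t\<in>V. A y t = 0)")
    case True
    then obtain y where y: "y \<in> V" "y \<noteq> 0" "\<And>t. t \<in> V \<Longrightarrow> A y t = 0" by auto
    obtain d xs V' where "1 \<le> d" "splits V xs V'" "xs \<noteq> []" "(A.gram xs, B.gram xs) = R_gd (Some var_x2) d"
      using degenerate_block[OF V _ y] nokc by blast
    then show ?thesis using PP_x2
      by (intro exI[of _ "(Some var_x2, d)"] exI[of _ xs] exI[of _ V']) (auto simp: PPt_def)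
  next
    case False
    then have nd: "x = 0" if "x \<in> V" "\<And>t. t \<in> V \<Longrightarrow> A x t = 0" for x using that by blast
    obtain p e xs V' where p: "irreducible p" "lead_coeff p = 1" "1 \<le> e" "splits V xs V'" "xs \<noteq> []"
      "A.gram xs = plus_mat (1\<^sub>m (degree (p ^ e)))" "B.gram xs = plus_mat (companion (p ^ e))"
      using nondegenerate_block[OF V ne nd] by blast
    note h = PP_homogenize[OF p(1,2)]
    have "R_gd (Some (homogenize (degree p) p)) e = (A.gram xs, B.gram xs)"
      using h p by (simp add: R_gd_def plus_pair_def R_fin_def dehom_def)
    then show ?thesis using h(1) p
      by (intro exI[of _ "(Some (homogenize (degree p) p), e)"] exI[of _ xs] exI[of _ V'])
        (auto simp: PPt_def)
  qed
qed

lemma realizes_exists: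
  assumes "subspace V" "finite S" "V \<subseteq> span S"
  shows "\<exists>L. set L \<subseteq> PPt \<times> {1..} \<and> realizes V L"
  using assms(1,3)
proof (induction "dim V" arbitrary: V rule: less_induct)
  case less
  show ?case
  proof (cases "V = {0}")
    case True
    then show ?thesis by (intro exI[of _ "[]"]) auto
  next
    case False
    obtain T where T: "T \<subseteq> V" "independent T" "V \<subseteq> span T" by (rule maximal_independent_subset)
    have "finite T" using independent_span_bound[OF assms(2) T(2)] T(1) less.prems by blast
    moreover have "V = span T" using T less.prems(1) span_subspace by blast
    ultimately obtain p xs V' where p: "p \<in> PPt \<times> {1..}" "splits V xs V'" "xs \<noteq> []"
      "(A.gram xs, B.gram xs) = R_gd (fst p) (snd p)"
      using block_exists[OF less.prems(1) _ _ False] by blast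
    have "subspace V'" "V' \<subseteq> span S" using p(2) less.prems by (auto simp: splits_def)
    from less.hyps[OF splits_dim_less[OF p(2,3) assms(2) less.prems(2)] this]
    obtain L where "set L \<subseteq> PPt \<times> {1..}" "realizes V' L" by auto
    with p show ?thesis by (intro exI[of _ "p # L"]) auto
  qed
qed

text \<open>The order of the blocks matters because \<open>A_rho\<close> sums them in an order given by \<open>SOME\<close>.\<close>

lemma splits_exchange:
  assumes V: "subspace V" and 1: "splits V xs V1" and 2: "splits V1 ys V2"
  shows "\<exists>V1'. splits V ys V1' \<and> splits V1' xs V2"
proof -
  \<comment> \<open>The span of \<open>xs\<close> enlarged by \<open>V2\<close>. Both parts are
    orthogonal to \<open>ys\<close>: the first because \<open>ys\<close> lies in \<open>V1\<close>,
    the second by the inner splitting.\<close>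
  define W where "W = {lincomb c xs + t | c t. t \<in> V2}"
  have lc0: "lincomb (\<lambda>_. 0) xs = 0" by (simp add: lincomb_def)
  have V1: "subspace V1" "V1 \<subseteq> V" "set xs \<subseteq> V" "\<And>v. v \<in> V \<Longrightarrow> \<exists>c. v - lincomb c xs \<in> V1"
    "\<And>c i. lincomb c xs \<in> V1 \<Longrightarrow> i < length xs \<Longrightarrow> c i = 0"
    "\<And>x t. x \<in> set xs \<Longrightarrow> t \<in> V1 \<Longrightarrow> A x t = 0" "\<And>x t. x \<in> set xs \<Longrightarrow> t \<in> V1 \<Longrightarrow> B x t = 0"
    using 1 unfolding splits_def by blast+
  have V2: "subspace V2" "V2 \<subseteq> V1" "set ys \<subseteq> V1" "\<And>v. v \<in> V1 \<Longrightarrow> \<exists>c. v - lincomb c ys \<in> V2"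
    "\<And>c i. lincomb c ys \<in> V2 \<Longrightarrow> i < length ys \<Longrightarrow> c i = 0"
    "\<And>x t. x \<in> set ys \<Longrightarrow> t \<in> V2 \<Longrightarrow> A x t = 0" "\<And>x t. x \<in> set ys \<Longrightarrow> t \<in> V2 \<Longrightarrow> B x t = 0"
    using 2 unfolding splits_def by blast+
  have zero: "lincomb c xs = 0" if "lincomb c xs \<in> V1" for c
    using V1(5)[OF that] lincomb_cong[of xs c "\<lambda>_. 0"] lc0 by simp
  have xsW: "x \<in> W" if x: "x \<in> set xs" for x
  proof -
    obtain k where k: "k < length xs" "x = xs ! k" using x by (auto simp: in_set_conv_nth)
    have "lincomb (\<lambda>i. if i = k then 1 else 0) xs = x"
      unfolding lincomb_def using k by (intro sum_pick[of k]) auto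
    then have "x = lincomb (\<lambda>i. if i = k then 1 else 0) xs + 0" by simp
    then show ?thesis unfolding W_def using subspace_0[OF V2(1)] by blast
  qed
  have V2W: "V2 \<subseteq> W"
  proof
    fix t assume "t \<in> V2"
    moreover have "t = lincomb (\<lambda>_. 0) xs + t" using lc0 by simp
    ultimately show "t \<in> W" unfolding W_def by blast
  qed
  have W: "subspace W"
  proof (rule subspaceI)
    show "0 \<in> W" using V2W subspace_0[OF V2(1)] by blast
    fix x y assume "x \<in> W" "y \<in> W"
    then obtain c s d t where *: "x = lincomb c xs + s" "y = lincomb d xs + t" "s \<in> V2" "t \<in> V2"
      unfolding W_def by blast
    then have "x + y = lincomb (\<lambda>i. c i + d i) xs + (s + t)"
      by (simp add: lincomb_def scale_left_distrib sum.distrib algebra_simps)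
    then show "x + y \<in> W" unfolding W_def using * subspace_add[OF V2(1)] by blast
  next
    fix a x assume "x \<in> W"
    then obtain c s where *: "x = lincomb c xs + s" "s \<in> V2" unfolding W_def by blast
    then have "a *s x = lincomb (\<lambda>i. a * c i) xs + a *s s"
      by (simp add: lincomb_def scale_right_distrib scale_sum_right)
    then show "a *s x \<in> W" unfolding W_def using * subspace_scale[OF V2(1)] by blast
  qed
  have "splits V ys W"
    unfolding splits_def
  proof (intro conjI ballI allI impI)
    show "W \<subseteq> V"
    proof
      fix x assume "x \<in> W"
      then obtain c s where *: "x = lincomb c xs + s" "s \<in> V2" unfolding W_def by blast
      have "lincomb c xs \<in> V" by (rule lincomb_in_subspace[OF V V1(3)])
      then show "x \<in> V" using * V V1(2) V2(2) by (auto intro: subspace_add)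
    qed
    fix v assume "v \<in> V"
    then obtain c where "v - lincomb c xs \<in> V1" using V1(4) by blast
    then obtain d where d: "v - lincomb c xs - lincomb d ys \<in> V2" using V2(4) by blast
    have "v - lincomb d ys = lincomb c xs + (v - lincomb c xs - lincomb d ys)" by simp
    with d show "\<exists>c. v - lincomb c ys \<in> W" unfolding W_def by blast
  next
    fix d i assume "lincomb d ys \<in> W" and i: "i < length ys"
    then obtain c t where *: "lincomb d ys = lincomb c xs + t" "t \<in> V2" unfolding W_def by blast
    have "lincomb d ys \<in> V1" by (rule lincomb_in_subspace[OF V1(1) V2(3)])
    moreover have "lincomb c xs = lincomb d ys - t" using * by simp
    ultimately have "lincomb c xs \<in> V1" using *(2) V1(1) V2(2) by (auto intro: subspace_diff)
    then have "lincomb d ys = t" using zero * by simp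
    then show "d i = 0" using V2(5) *(2) i by simp
  next
    fix y t assume y: "y \<in> set ys" and "t \<in> W"
    then obtain c s where *: "t = lincomb c xs + s" "s \<in> V2" unfolding W_def by blast
    have "A y (xs ! i) = 0" "B y (xs ! i) = 0" if "i < length xs" for i
      using V1(6,7)[of "xs ! i" y] that y V2(3) A.skew[of y "xs ! i"] B.skew[of y "xs ! i"] by auto
    then show "A y t = 0" "B y t = 0"
      using * V2(6,7)[OF y] by (auto simp: A.form_simps B.form_simps lincomb_def)
  qed (use W V2(3) V1(2) in auto)
  moreover have "splits W xs V2"
    unfolding splits_def
  proof (intro conjI ballI allI impI)
    fix v assume "v \<in> W"
    then obtain c s where "v = lincomb c xs + s" "s \<in> V2" unfolding W_def by blast
    then show "\<exists>c. v - lincomb c xs \<in> V2" by (intro exI[of _ c]) simp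
  qed (use V2(1,2) V2W xsW V1(5-7) in auto)
  ultimately show ?thesis by blast
qed

lemma realizes_exchange:
  assumes "subspace V" "realizes V (a # b # L)"
  shows "realizes V (b # a # L)"
  using assms splits_exchange[OF assms(1)] by (simp, blast)

lemma realizes_front:
  "subspace V \<Longrightarrow> realizes V L \<Longrightarrow> a \<in> set L \<Longrightarrow> realizes V (a # remove1 a L)"
proof (induction L arbitrary: V)
  case (Cons b L)
  show ?case
  proof (cases "a = b")
    case False
    with Cons.prems have "a \<in> set L" by simp
    obtain xs V' where *: "splits V xs V'" "realizes V' L" "(A.gram xs, B.gram xs) = R_gd (fst b) (snd b)"
      using Cons.prems by auto
    have "subspace V'" using * by (simp add: splits_def)
    then have "realizes V' (a # remove1 a L)" using Cons.IH * \<open>a \<in> set L\<close> by blast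
    with * have "realizes V (b # a # remove1 a L)" unfolding realizes.simps(2)[of V b] by blast
    then have "realizes V (a # b # remove1 a L)" by (rule realizes_exchange[OF Cons.prems(1)])
    with False show ?thesis by simp
  qed (use Cons.prems in auto)
qed simp

lemma realizes_mset:
  "subspace V \<Longrightarrow> realizes V L \<Longrightarrow> mset L = mset L' \<Longrightarrow> realizes V L'"
proof (induction L' arbitrary: L V)
  case (Cons a L')
  have "a \<in> set L" using Cons.prems(3) by (metis list.set_intros(1) set_mset_mset)
  then obtain xs V' where *: "splits V xs V'" "realizes V' (remove1 a L)"
    "(A.gram xs, B.gram xs) = R_gd (fst a) (snd a)"
    using realizes_front[OF Cons.prems(1,2), of a] by auto
  have "subspace V'" using * by (simp add: splits_def)
  moreover have "mset (remove1 a L) = mset L'" using Cons.prems(3) by simp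
  ultimately have "realizes V' L'" using Cons.IH * by blast
  with * show ?case unfolding realizes.simps by blast
qed auto

text \<open>Concatenation of the lists of all blocks: successive complements are orthogonal for both
  forms, so both Gram matrices become block diagonal.\<close>

lemma realizes_basis:
  assumes "subspace V" "realizes V L"
  shows "\<exists>xs. set xs \<subseteq> V \<and> (\<forall>v\<in>V. \<exists>c. v = lincomb c xs) \<and>
    (\<forall>c. lincomb c xs = 0 \<longrightarrow> (\<forall>i<length xs. c i = 0)) \<and>
    (A.gram xs, B.gram xs) = dsum_list (map (\<lambda>(g,d). R_gd g d) L)"
  using assms
proof (induction L arbitrary: V)
  case Nil
  then show ?case
    by (intro exI[of _ "[]"]) (auto simp: dsum_list_def A.gram_def B.gram_def zero_mat_def)
next
  case (Cons a L)
  obtain xs V' where *: "splits V xs V'" "realizes V' L" "(A.gram xs, B.gram xs) = R_gd (fst a) (snd a)"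
    using Cons.prems by auto
  have V': "subspace V'" "V' \<subseteq> V" using * by (auto simp: splits_def)
  obtain ys where ys: "set ys \<subseteq> V'" "\<And>v. v \<in> V' \<Longrightarrow> \<exists>c. v = lincomb c ys"
    "\<And>c i. lincomb c ys = 0 \<Longrightarrow> i < length ys \<Longrightarrow> c i = 0"
    "(A.gram ys, B.gram ys) = dsum_list (map (\<lambda>(g,d). R_gd g d) L)"
    using Cons.IH[OF V'(1) *(2)] by blast
  show ?case
  proof (intro exI[of _ "xs @ ys"] conjI ballI allI impI)
    show "set (xs @ ys) \<subseteq> V" using *(1) ys(1) V'(2) by (auto simp: splits_def)
    fix v assume "v \<in> V"
    then obtain c where "v - lincomb c xs \<in> V'" using *(1) by (auto simp: splits_def)
    then obtain d where d: "v - lincomb c xs = lincomb d ys" using ys(2) by blast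
    define e where "e i = (if i < length xs then c i else d (i - length xs))" for i
    have "lincomb e (xs @ ys) = lincomb c xs + lincomb d ys"
      unfolding lincomb_append by (intro arg_cong2[of _ _ _ _ "(+)"] lincomb_cong) (auto simp: e_def)
    then show "\<exists>c. v = lincomb c (xs @ ys)" using d by (intro exI[of _ e]) (simp add: algebra_simps)
  next
    fix c i assume 0: "lincomb c (xs @ ys) = 0" and i: "i < length (xs @ ys)"
    let ?d = "\<lambda>i. c (length xs + i)"
    have eq: "lincomb c xs = - lincomb ?d ys"
      using 0 unfolding lincomb_append by (simp add: eq_neg_iff_add_eq_0)
    have "lincomb c xs \<in> V'" unfolding eq
      by (intro subspace_neg lincomb_in_subspace V' ys)
    then have c0: "\<And>i. i < length xs \<Longrightarrow> c i = 0" using *(1) unfolding splits_def by blast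
    then have "lincomb c xs = 0" by (simp add: lincomb_def)
    then have "lincomb ?d ys = 0" using eq by simp
    then show "c i = 0" using ys(3)[of ?d "i - length xs"] c0[of i] i by (cases "i < length xs") auto
  next
    have o: "A x y = 0" "B x y = 0" if "x \<in> set xs" "y \<in> set ys" for x y
      using *(1) ys(1) that unfolding splits_def by blast+
    have "dsum_list (map (\<lambda>(g,d). R_gd g d) (a # L)) = dsum_pair (A.gram xs, B.gram xs) (A.gram ys, B.gram ys)"
      unfolding ys(4) *(3) by (simp add: dsum_list_def split_def)
    also have "\<dots> = (A.gram (xs @ ys), B.gram (xs @ ys))"
      by (simp add: dsum_pair_def A.gram_append[OF o(1)] B.gram_append[OF o(2)])
        (simp add: A.gram_def B.gram_def)
    finally show "(A.gram (xs @ ys), B.gram (xs @ ys)) = dsum_list (map (\<lambda>(g,d). R_gd g d) (a # L))" by simp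
  qed
qed

end

text \<open>Vectors are encoded as polynomials through their coefficients. This type carries a
  scalar multiplication that is independent of \<open>n\<close>; the vectors of length
  \<open>n\<close> are the span of the first \<open>n\<close> monomials.\<close>

definition matrix_form :: "nat \<Rightarrow> 'a::field mat \<Rightarrow> 'a poly \<Rightarrow> 'a poly \<Rightarrow> 'a" where
  "matrix_form n M u v = (\<Sum>i<n. \<Sum>j<n. coeff u i * M $$ (i,j) * coeff v j)"

lemma count_list_mset_eq: "(\<And>x. count_list L x = count_list L' x) \<Longrightarrow> mset L = mset L'"
  by (intro multiset_eqI) (simp add: count_mset)

text \<open>Congruence alone reaches a canonical form. This stronger statement is what the orbit
  criterion requires, where it is applied to a pair already changed by a prescribed element of
  GL(2).\<close>

lemma skew_pair_canonical_form:
  fixes A1 A2 :: "'a::field mat"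
  assumes two: "(2::'a) \<noteq> 0" and A1: "A1 \<in> carrier_mat n n" and A2: "A2 \<in> carrier_mat n n"
    and skew: "transpose_mat A1 = - A1" "transpose_mat A2 = - A2"
  shows "\<exists>\<rho>\<in>Ft. \<exists>P. P \<in> carrier_mat n n \<and> invertible_mat P \<and> A_rho \<rho> = pair_act_left P (A1, A2)"
proof -
  have alt: "alternating_form smult (matrix_form n M)"
    if M: "M \<in> carrier_mat n n" "transpose_mat M = - M" for M :: "'a mat"
  proof
    fix x y z :: "'a poly" and c :: 'a
    show "matrix_form n M (x + y) z = matrix_form n M x z + matrix_form n M y z"
      by (simp add: matrix_form_def algebra_simps sum.distrib)
    show "matrix_form n M (smult c x) z = c * matrix_form n M x z"
      by (simp add: matrix_form_def algebra_simps sum_distrib_left)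
    have e: "M $$ (j,i) = - M $$ (i,j)" if "i < n" "j < n" for i j
    proof -
      have "M $$ (j,i) = transpose_mat M $$ (i,j)" using M(1) that by simp
      also have "\<dots> = - M $$ (i,j)" unfolding M(2) using M(1) that by simp
      finally show ?thesis .
    qed
    have "matrix_form n M x y = (\<Sum>j<n. \<Sum>i<n. coeff x i * M $$ (i,j) * coeff y j)"
      unfolding matrix_form_def by (rule sum.swap)
    also have "\<dots> = - matrix_form n M y x"
      unfolding matrix_form_def sum_negf[symmetric]
    proof (intro sum.cong refl)
      fix j i assume "j \<in> {..<n}" "i \<in> {..<n}"
      then show "coeff x i * M $$ (i,j) * coeff y j = - (coeff y j * M $$ (j,i) * coeff x i)"
        using e[of i j] by simp
    qed
    finally show "matrix_form n M x y = - matrix_form n M y x" .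
  qed (auto simp: smult_add_right smult_add_left two)
  interpret F: form_pair smult "matrix_form n A1" "matrix_form n A2"
    using alt[OF A1 skew(1)] alt[OF A2 skew(2)] by (simp add: form_pair_def alternating_form_def)
  define mon where "mon i = monom (1::'a) i" for i
  define V where "V = F.span (mon ` {..<n})"
  have expand: "v = (\<Sum>i<n. smult (coeff v i) (mon i))" if "v \<in> V" for v
  proof -
    have "\<forall>i\<ge>n. coeff v i = 0" using that unfolding V_def
      by (induction v rule: F.span_induct_alt) (auto simp: mon_def)
    then have "coeff v k = coeff (\<Sum>i<n. smult (coeff v i) (mon i)) k" for k
      unfolding coeff_sum by (cases "k < n") (auto simp: mon_def not_less intro!: sum_pick[symmetric] sum.neutral[symmetric])
    then show ?thesis by (intro poly_eqI)
  qed
  have V: "F.subspace V" by (simp add: V_def)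
  obtain L where L: "set L \<subseteq> PPt \<times> {1..}" "F.realizes V L"
    using F.realizes_exists[OF V, of "mon ` {..<n}"] by (auto simp: V_def)
  define \<rho> where "\<rho> = count_list L"
  define L' where "L' = (SOME L. \<forall>x. count_list L x = \<rho> x)"
  have L': "\<forall>x. count_list L' x = \<rho> x" unfolding L'_def by (rule someI[of _ L]) (simp add: \<rho>_def)
  have nz: "\<rho> x \<noteq> 0 \<longleftrightarrow> x \<in> set L" for x by (simp add: \<rho>_def count_list_0_iff)
  have "{x. \<rho> x \<noteq> 0} = set L" using nz by blast
  moreover have "g \<in> PPt \<and> 1 \<le> d" if "\<rho> (g, d) \<noteq> 0" for g d
    using that L(1) unfolding nz by auto
  ultimately have \<rho>: "\<rho> \<in> Ft" unfolding Ft_def by simp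
  \<comment> \<open>\<open>L\<close> and the list chosen by \<open>SOME\<close> inside
    \<open>A_rho\<close> have equal counts, hence are permutations of each other.\<close>
  have "F.realizes V L'"
    by (rule F.realizes_mset[OF V L(2)]) (rule count_list_mset_eq, simp add: L' \<rho>_def)
  from F.realizes_basis[OF V this] obtain xs where
    xs: "set xs \<subseteq> V" "\<forall>v\<in>V. \<exists>c. v = F.lincomb c xs"
      "\<forall>c. F.lincomb c xs = 0 \<longrightarrow> (\<forall>i<length xs. c i = 0)"
      "(F.A.gram xs, F.B.gram xs) = dsum_list (map (\<lambda>(g,d). R_gd g d) L')"
    by (elim exE conjE)
  have monV: "mon i \<in> V" if "i < n" for i using that by (auto simp: V_def intro: F.span_base)
  have mon_indep: "c i = 0" if "(\<Sum>i<n. smult (c i) (mon i)) = 0" "i < n" for c i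
  proof -
    have "0 = coeff (\<Sum>i<n. smult (c i) (mon i)) i" using that by simp
    also have "\<dots> = c i" using that(2) unfolding coeff_sum by (intro sum_pick[of i]) (auto simp: mon_def)
    finally show ?thesis by simp
  qed
  have "length xs = n"
  proof (rule ccontr)
    assume "length xs \<noteq> n"
    then consider "n < length xs" | "length xs < n" by linarith
    then show False
    proof cases
      case 1
      have "card (mon ` {..<n}) \<le> n" using card_image_le[of "{..<n}" mon] by simp
      with 1 have "card (mon ` {..<n}) < length xs" by simp
      then obtain c where "\<exists>i<length xs. c i \<noteq> 0" "(\<Sum>i<length xs. smult (c i) (xs ! i)) = 0"
        using F.family_dependent[of "mon ` {..<n}" "length xs" "\<lambda>i. xs ! i"] xs(1) nth_mem
        unfolding V_def by blast
      then show False using xs(3) unfolding F.lincomb_def by blast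
    next
      case 2
      have "mon i \<in> F.span (set xs)" if "i < n" for i
      proof -
        obtain c where "mon i = F.lincomb c xs" using xs(2) monV \<open>i < n\<close> by blast
        then show ?thesis unfolding F.lincomb_def
          by (auto intro!: F.span_sum F.span_scale intro: F.span_base)
      qed
      moreover have "card (set xs) < n" using card_length[of xs] 2 by simp
      ultimately obtain c where "\<exists>i<n. c i \<noteq> 0" "(\<Sum>i<n. smult (c i) (mon i)) = 0"
        using F.family_dependent[of "set xs" n mon] by blast
      with mon_indep show False by blast
    qed
  qed
  note len = this
  \<comment> \<open>Row \<open>i\<close> holds the coordinates of \<open>xs ! i\<close>, so
    \<open>P M P^T\<close> is the Gram matrix of the basis. The inverse \<open>Q\<close> below holds
    the coordinates of the monomials in this basis.\<close>
  define P where "P = mat n n (\<lambda>(i,j). coeff (xs ! i) j)"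
  have Pc: "P \<in> carrier_mat n n" by (simp add: P_def)
  have "\<forall>j. \<exists>c. j < n \<longrightarrow> mon j = F.lincomb c xs" using xs(2) monV by blast
  then obtain C where C: "\<And>j. j < n \<Longrightarrow> mon j = F.lincomb (C j) xs" by metis
  define Q where "Q = mat n n (\<lambda>(j,i). C j i)"
  have Qc: "Q \<in> carrier_mat n n" by (simp add: Q_def)
  have QP: "Q * P = 1\<^sub>m n"
  proof (rule eq_matI)
    fix j k assume jk: "j < dim_row (1\<^sub>m n)" "k < dim_col (1\<^sub>m n)"
    have "(Q * P) $$ (j,k) = (\<Sum>i<n. C j i * coeff (xs ! i) k)"
      using jk by (simp add: Q_def P_def scalar_prod_def lessThan_atLeast0)
    also have "\<dots> = coeff (F.lincomb (C j) xs) k" by (simp add: F.lincomb_def coeff_sum len)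
    also have "\<dots> = coeff (mon j) k" using C jk by simp
    finally show "(Q * P) $$ (j,k) = 1\<^sub>m n $$ (j,k)" using jk by (simp add: mon_def)
  qed (simp_all add: Q_def P_def)
  have PQ: "P * Q = 1\<^sub>m n" using mat_mult_left_right_inverse[OF Qc Pc QP] .
  have inv: "invertible_mat P" using Pc Qc QP PQ unfolding invertible_mat_def inverts_mat_def by auto
  have gram: "mat (length xs) (length xs) (\<lambda>(i,j). matrix_form n M (xs ! i) (xs ! j)) = P * M * transpose_mat P"
    if M: "M \<in> carrier_mat n n" for M
  proof (rule eq_matI)
    fix i j assume "i < dim_row (P * M * transpose_mat P)" "j < dim_col (P * M * transpose_mat P)"
    then have ij: "i < n" "j < n" using Pc by auto
    have "(P * M * transpose_mat P) $$ (i,j) = (\<Sum>k<n. (\<Sum>l<n. coeff (xs ! i) l * M $$ (l,k)) * coeff (xs ! j) k)"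
      using ij M by (simp add: P_def scalar_prod_def lessThan_atLeast0)
    also have "\<dots> = (\<Sum>k<n. \<Sum>l<n. coeff (xs ! i) l * M $$ (l,k) * coeff (xs ! j) k)"
      by (simp add: sum_distrib_right)
    also have "\<dots> = matrix_form n M (xs ! i) (xs ! j)"
      unfolding matrix_form_def by (rule sum.swap)
    finally show "mat (length xs) (length xs) (\<lambda>(i,j). matrix_form n M (xs ! i) (xs ! j)) $$ (i,j)
      = (P * M * transpose_mat P) $$ (i,j)" using ij len by simp
  qed (use Pc len in auto)
  have "A_rho \<rho> = pair_act_left P (A1, A2)"
    unfolding A_rho_def L'_def[symmetric] xs(4)[symmetric] pair_act_left_def F.A.gram_def F.B.gram_def
    using gram[OF A1] gram[OF A2] by simp
  with \<rho> Pc inv show ?thesis by blast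
qed

section \<open>Solution spaces of pencils\<close>

context linear_space
begin

text \<open>Independence is required of positions in a list, and the dimension is a relation, so
  that every assertion about it includes finiteness.\<close>

definition has_basis :: "'b set \<Rightarrow> 'b list \<Rightarrow> bool" where
  "has_basis S xs \<longleftrightarrow> set xs \<subseteq> S \<and> (\<forall>v\<in>S. \<exists>c. v = lincomb c xs) \<and>
     (\<forall>c. lincomb c xs = 0 \<longrightarrow> (\<forall>i<length xs. c i = 0))"

definition has_dim :: "'b set \<Rightarrow> nat \<Rightarrow> bool" where
  "has_dim S n \<longleftrightarrow> (\<exists>xs. has_basis S xs \<and> length xs = n)"

lemma has_dim_zero: "has_dim {0} 0"
  unfolding has_dim_def has_basis_def by (intro exI[of _ "[]"]) auto

lemma lincomb_in_span: "lincomb c xs \<in> span (set xs)"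
  by (rule lincomb_in_subspace) (auto intro: span_base)

lemma has_basis_length_le:
  assumes "has_basis S xs" "has_basis S ys"
  shows "length xs \<le> length ys"
proof (rule ccontr)
  assume "\<not> length xs \<le> length ys"
  then have "card (set ys) < length xs" using card_length[of ys] by linarith
  moreover have "xs ! i \<in> span (set ys)" if "i < length xs" for i
  proof -
    have "xs ! i \<in> S" using assms(1) that unfolding has_basis_def by (meson nth_mem subsetD)
    with assms(2) have "\<exists>c. xs ! i = lincomb c ys" unfolding has_basis_def by blast
    then show ?thesis using lincomb_in_span by metis
  qed
  ultimately obtain c where c: "\<exists>i<length xs. c i \<noteq> 0" "(\<Sum>i<length xs. c i *s (xs ! i)) = 0"
    using family_dependent[of "set ys" "length xs" "\<lambda>i. xs ! i"] by blast
  have "lincomb c xs = 0 \<longrightarrow> (\<forall>i<length xs. c i = 0)" using assms(1) unfolding has_basis_def by blast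
  with c show False by (auto simp: lincomb_def)
qed

lemma has_dim_unique: "has_dim S m \<Longrightarrow> has_dim S n \<Longrightarrow> m = n"
  unfolding has_dim_def by (auto intro: le_antisym has_basis_length_le)

lemma has_dim_sum:
  assumes S: "subspace S" "has_dim S m" and T: "subspace T" "has_dim T n"
    and int: "\<And>x. x \<in> S \<Longrightarrow> x \<in> T \<Longrightarrow> x = 0"
    and W: "W = {x + y |x y. x \<in> S \<and> y \<in> T}"
  shows "has_dim W (m + n)"
proof -
  obtain xs ys where xs: "has_basis S xs" "length xs = m" and ys: "has_basis T ys" "length ys = n"
    using S T unfolding has_dim_def by blast
  have xb: "set xs \<subseteq> S" "\<And>v. v \<in> S \<Longrightarrow> \<exists>c. v = lincomb c xs"
    "\<And>c i. lincomb c xs = 0 \<Longrightarrow> i < length xs \<Longrightarrow> c i = 0"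
    using xs(1) unfolding has_basis_def by blast+
  have yb: "set ys \<subseteq> T" "\<And>v. v \<in> T \<Longrightarrow> \<exists>c. v = lincomb c ys"
    "\<And>c i. lincomb c ys = 0 \<Longrightarrow> i < length ys \<Longrightarrow> c i = 0"
    using ys(1) unfolding has_basis_def by blast+
  have "has_basis W (xs @ ys)"
    unfolding has_basis_def
  proof (intro conjI ballI allI impI)
    have "x = x + 0" "x = 0 + x" for x :: 'b by simp_all
    then show "set (xs @ ys) \<subseteq> W"
      unfolding W using xb(1) yb(1) subspace_0[OF S(1)] subspace_0[OF T(1)] by (auto, blast+)
    fix v assume "v \<in> W"
    then obtain x y where xy: "v = x + y" "x \<in> S" "y \<in> T" unfolding W by blast
    obtain c d where cd: "x = lincomb c xs" "y = lincomb d ys" using xb(2) yb(2) xy by blast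
    define e where "e i = (if i < length xs then c i else d (i - length xs))" for i
    have "lincomb e (xs @ ys) = lincomb c xs + lincomb d ys"
      unfolding lincomb_append by (intro arg_cong2[of _ _ _ _ "(+)"] lincomb_cong) (auto simp: e_def)
    then show "\<exists>c. v = lincomb c (xs @ ys)" using xy cd by (intro exI[of _ e]) simp
  next
    fix c i assume 0: "lincomb c (xs @ ys) = 0" and i: "i < length (xs @ ys)"
    let ?d = "\<lambda>i. c (length xs + i)"
    have eq: "lincomb c xs = - lincomb ?d ys"
      using 0 unfolding lincomb_append by (simp add: eq_neg_iff_add_eq_0)
    have "lincomb c xs \<in> T" unfolding eq by (intro subspace_neg lincomb_in_subspace T(1) yb(1))
    moreover have "lincomb c xs \<in> S" by (intro lincomb_in_subspace S(1) xb(1))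
    ultimately have z: "lincomb c xs = 0" using int by blast
    then have "lincomb ?d ys = 0" using eq by simp
    then show "c i = 0" using yb(3)[of ?d "i - length xs"] xb(3)[OF z] i by (cases "i < length xs") auto
  qed
  then show ?thesis unfolding has_dim_def using xs(2) ys(2) by (intro exI[of _ "xs @ ys"]) simp
qed

end

locale linear_map = L1: linear_space s1 + L2: linear_space s2
  for s1 :: "'a::field \<Rightarrow> 'b::ab_group_add \<Rightarrow> 'b" and s2 :: "'a \<Rightarrow> 'c::ab_group_add \<Rightarrow> 'c" +
  fixes \<phi> :: "'b \<Rightarrow> 'c"
  assumes map_add: "\<phi> (x + y) = \<phi> x + \<phi> y" and map_scale: "\<phi> (s1 c x) = s2 c (\<phi> x)"
begin

lemma map_zero: "\<phi> 0 = 0"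
  using map_add[of 0 0] by simp

lemma map_diff: "\<phi> (x - y) = \<phi> x - \<phi> y"
  using map_add[of "x - y" y] by (simp add: eq_diff_eq)

lemma map_lincomb: "\<phi> (L1.lincomb c xs) = L2.lincomb c (map \<phi> xs)"
proof -
  have "\<phi> (sum f K) = (\<Sum>k\<in>K. \<phi> (f k))" for f and K :: "nat set"
    by (induction K rule: infinite_finite_induct) (auto simp: map_add map_zero)
  then show ?thesis by (simp add: L1.lincomb_def L2.lincomb_def map_scale)
qed

lemma image_subspace:
  assumes "L1.subspace S"
  shows "L2.subspace (\<phi> ` S)"
proof (rule L2.subspaceI)
  show "0 \<in> \<phi> ` S" using L1.subspace_0[OF assms] map_zero by (metis imageI)
next
  fix x y assume "x \<in> \<phi> ` S" "y \<in> \<phi> ` S"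
  then obtain a b where "a \<in> S" "b \<in> S" "x = \<phi> a" "y = \<phi> b" by blast
  then show "x + y \<in> \<phi> ` S" using L1.subspace_add[OF assms] by (auto simp: map_add[symmetric])
next
  fix c x assume "x \<in> \<phi> ` S"
  then obtain a where "a \<in> S" "x = \<phi> a" by blast
  then show "s2 c x \<in> \<phi> ` S" using L1.subspace_scale[OF assms] by (auto simp: map_scale[symmetric])
qed

lemma has_dim_image:
  assumes S: "L1.subspace S" "L1.has_dim S n" and inj: "\<And>x. x \<in> S \<Longrightarrow> \<phi> x = 0 \<Longrightarrow> x = 0"
  shows "L2.has_dim (\<phi> ` S) n"
proof -
  obtain xs where xs: "L1.has_basis S xs" "length xs = n" using S unfolding L1.has_dim_def by blast
  have "L2.has_basis (\<phi> ` S) (map \<phi> xs)"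
    unfolding L2.has_basis_def
  proof (intro conjI ballI allI impI)
    show "set (map \<phi> xs) \<subseteq> \<phi> ` S" using xs(1) by (auto simp: L1.has_basis_def)
    fix v assume "v \<in> \<phi> ` S"
    then obtain x where "v = \<phi> x" "x \<in> S" by blast
    moreover from this obtain c where "x = L1.lincomb c xs" using xs(1) unfolding L1.has_basis_def by blast
    ultimately show "\<exists>c. v = L2.lincomb c (map \<phi> xs)" using map_lincomb by blast
  next
    fix c i assume "L2.lincomb c (map \<phi> xs) = 0" and i: "i < length (map \<phi> xs)"
    then have 0: "\<phi> (L1.lincomb c xs) = 0" by (simp add: map_lincomb)
    have "L1.lincomb c xs \<in> S"
      by (rule L1.lincomb_in_subspace[OF S(1)]) (use xs(1) in \<open>simp add: L1.has_basis_def\<close>)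
    with 0 inj have "L1.lincomb c xs = 0" by blast
    then show "c i = 0" using xs(1) i unfolding L1.has_basis_def by auto
  qed
  with xs(2) show ?thesis unfolding L2.has_dim_def by (intro exI[of _ "map \<phi> xs"]) simp
qed

lemma has_dim_pullback:
  assumes S: "L1.subspace S" and n: "L2.has_dim (\<phi> ` S) n" and inj: "\<And>x. x \<in> S \<Longrightarrow> \<phi> x = 0 \<Longrightarrow> x = 0"
  shows "L1.has_dim S n"
proof -
  obtain ys where ys: "L2.has_basis (\<phi> ` S) ys" "length ys = n" using n unfolding L2.has_dim_def by blast
  have sub: "set ys \<subseteq> \<phi> ` S" using ys(1) by (simp add: L2.has_basis_def)
  define xs where "xs = map (inv_into S \<phi>) ys"
  have map_xs: "map \<phi> xs = ys" using sub by (auto simp: xs_def f_inv_into_f intro!: map_idI)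
  have xsS: "set xs \<subseteq> S" using sub by (auto simp: xs_def inv_into_into)
  have "L1.has_basis S xs"
    unfolding L1.has_basis_def
  proof (intro conjI ballI allI impI)
    fix v assume v: "v \<in> S"
    then obtain c where c: "\<phi> v = L2.lincomb c ys" using ys(1) unfolding L2.has_basis_def by blast
    have "v - L1.lincomb c xs \<in> S" by (intro L1.subspace_diff S v L1.lincomb_in_subspace xsS)
    moreover have "\<phi> (v - L1.lincomb c xs) = 0" using c by (simp add: map_diff map_lincomb map_xs)
    ultimately have "v - L1.lincomb c xs = 0" by (rule inj)
    then show "\<exists>c. v = L1.lincomb c xs" by (intro exI[of _ c]) simp
  next
    fix c i assume "L1.lincomb c xs = 0" and i: "i < length xs"
    then have "L2.lincomb c ys = 0" using map_lincomb[of c xs] map_zero map_xs by simp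
    then show "c i = 0" using ys(1) i unfolding L2.has_basis_def by (auto simp: xs_def)
  qed (rule xsS)
  then show ?thesis unfolding L1.has_dim_def using ys(2) by (intro exI[of _ xs]) (simp add: xs_def)
qed

end

text \<open>Vectors are functions on \<open>nat\<close> that vanish beyond the number of columns, so
  one type serves all sizes. The operations \<open>scale2\<close>, \<open>scale1\<close> and
  \<open>smult\<close> belong to vectors of forms, to vectors of polynomials at
  \<open>x2 = 1\<close>, and to single components.\<close>

definition scale2 :: "'a::field \<Rightarrow> (nat \<Rightarrow> 'a poly poly) \<Rightarrow> nat \<Rightarrow> 'a poly poly" where
  "scale2 c u = (\<lambda>j. [:[:c:]:] * u j)"

definition scale1 :: "'a::field \<Rightarrow> (nat \<Rightarrow> 'a poly) \<Rightarrow> nat \<Rightarrow> 'a poly" where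
  "scale1 c u = (\<lambda>j. smult c (u j))"

interpretation W2: linear_space "scale2 :: 'a::field \<Rightarrow> _"
  by unfold_locales
    (auto simp: scale2_def fun_eq_iff smult_add_right smult_add_left[symmetric] pCons_one simp flip: smult_add_left)

interpretation W1: linear_space "scale1 :: 'a::field \<Rightarrow> _"
  by unfold_locales (auto simp: scale1_def fun_eq_iff smult_add_right smult_add_left)

interpretation W0: linear_space "smult :: 'a::field \<Rightarrow> _"
  by unfold_locales (auto simp: smult_add_right smult_add_left)

text \<open>The entries of \<open>x1 A1 - x2 A2\<close>.  With this sign the pencil of \<open>R_fin f\<close> has determinant \<open>f\<close>, made
  homogeneous.\<close>

definition pencil :: "'a::field mpair \<Rightarrow> nat \<Rightarrow> nat \<Rightarrow> 'a poly poly" where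
  "pencil A i j = lin2 (fst A $$ (i,j)) (- snd A $$ (i,j))"

text \<open>The row set \<open>I\<close> and the entries \<open>M\<close> are arbitrary so that a
  rectangular part of a block matrix is again an instance. The constants \<open>w\<close>, one for
  each row, are part of the unknowns.\<close>

definition solutions :: "nat \<Rightarrow> nat set \<Rightarrow> (nat \<Rightarrow> nat \<Rightarrow> 'a::field poly poly) \<Rightarrow> 'a poly poly \<Rightarrow> nat
    \<Rightarrow> (nat \<Rightarrow> 'a poly poly) set" where
  "solutions c I M f e = {u. (\<forall>j\<ge>c. u j = 0) \<and> (\<forall>j. homog e (u j)) \<and>
     (\<forall>i\<in>I. \<exists>w. (\<Sum>j<c. M i j * u j) = [:[:w:]:] * f)}"

abbreviation pair_solutions :: "'a::field mpair \<Rightarrow> 'a poly poly \<Rightarrow> nat \<Rightarrow> (nat \<Rightarrow> 'a poly poly) set" where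
  "pair_solutions A \<equiv> solutions (dim_col (fst A)) {..<dim_row (fst A)} (pencil A)"

definition sol_dim :: "'a::field mpair \<Rightarrow> 'a poly poly \<Rightarrow> nat \<Rightarrow> nat \<Rightarrow> bool" where
  "sol_dim A f e n \<longleftrightarrow> W2.has_dim (pair_solutions A f e) n"

lemma homog_scalar: "homog e g \<Longrightarrow> homog e ([:[:c:]:] * g)"
  using homog_mult[OF homog_const, of e g c] by simp

lemma solutions_subspace: "W2.subspace (solutions c I M f e)"
proof (rule W2.subspaceI)
  show "0 \<in> solutions c I M f e" by (auto simp: solutions_def intro!: exI[of _ 0])
next
  fix u v assume uv: "u \<in> solutions c I M f e" "v \<in> solutions c I M f e"
  have "\<exists>w. (\<Sum>j<c. M i j * (u + v) j) = [:[:w:]:] * f" if "i \<in> I" for i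
  proof -
    obtain w w' where "(\<Sum>j<c. M i j * u j) = [:[:w:]:] * f" "(\<Sum>j<c. M i j * v j) = [:[:w':]:] * f"
      using uv \<open>i \<in> I\<close> unfolding solutions_def by blast
    then show ?thesis
      by (intro exI[of _ "w + w'"]) (simp add: distrib_left sum.distrib smult_add_left[symmetric])
  qed
  then show "u + v \<in> solutions c I M f e" using uv by (auto simp: solutions_def intro: homog_add)
next
  fix a u assume u: "u \<in> solutions c I M f e"
  have "\<exists>w. (\<Sum>j<c. M i j * scale2 a u j) = [:[:w:]:] * f" if "i \<in> I" for i
  proof -
    obtain w where w: "(\<Sum>j<c. M i j * u j) = [:[:w:]:] * f"
      using u \<open>i \<in> I\<close> unfolding solutions_def by blast
    have "(\<Sum>j<c. M i j * scale2 a u j) = [:[:a:]:] * (\<Sum>j<c. M i j * u j)"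
      unfolding scale2_def sum_distrib_left by (intro sum.cong) (auto simp: mult_ac)
    then show ?thesis unfolding w by (intro exI[of _ "a * w"]) simp
  qed
  moreover have "homog e (scale2 a u j)" for j
    using u homog_scalar[of e "u j" a] by (simp add: solutions_def scale2_def)
  moreover have "\<forall>j\<ge>c. scale2 a u j = 0" using u by (simp add: solutions_def scale2_def)
  ultimately show "scale2 a u \<in> solutions c I M f e" by (simp add: solutions_def)
qed

text \<open>The scalar absorbs the sign in the lower left part of \<open>R^+\<close>, and the change
  of index absorbs the shift of the rows of a block.\<close>

lemma solutions_mono_rows:
  assumes "\<And>i. i \<in> I \<Longrightarrow> \<exists>i'\<in>I'. \<exists>s. \<forall>j<c. M i j = [:[:s:]:] * M' i' j"
  shows "solutions c I' M' f e \<subseteq> solutions c I M f e"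
proof
  fix u assume u: "u \<in> solutions c I' M' f e"
  have "\<exists>w. (\<Sum>j<c. M i j * u j) = [:[:w:]:] * f" if "i \<in> I" for i
  proof -
    obtain i' s where i': "i' \<in> I'" "\<forall>j<c. M i j = [:[:s:]:] * M' i' j" using assms \<open>i \<in> I\<close> by blast
    then obtain w where w: "(\<Sum>j<c. M' i' j * u j) = [:[:w:]:] * f" using u unfolding solutions_def by blast
    have "(\<Sum>j<c. M i j * u j) = [:[:s:]:] * (\<Sum>j<c. M' i' j * u j)"
      unfolding sum_distrib_left using i'(2) by (intro sum.cong) (auto simp: mult_ac)
    then show ?thesis unfolding w by (intro exI[of _ "s * w"]) simp
  qed
  then show "u \<in> solutions c I M f e" using u by (auto simp: solutions_def)
qed

text \<open>Every row meets only one of the two groups of columns, so a solution is a pair of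
  independent solutions, the second one shifted by \<open>c1\<close>.\<close>

lemma solutions_split:
  assumes I: "I = I1 \<union> I2"
    and z1: "\<And>i j. i \<in> I1 \<Longrightarrow> c1 \<le> j \<Longrightarrow> j < c1 + c2 \<Longrightarrow> M i j = 0"
    and z2: "\<And>i j. i \<in> I2 \<Longrightarrow> j < c1 \<Longrightarrow> M i j = 0"
    and d1: "W2.has_dim (solutions c1 I1 M f e) a"
    and d2: "W2.has_dim (solutions c2 I2 (\<lambda>i j. M i (c1 + j)) f e) b"
  shows "W2.has_dim (solutions (c1 + c2) I M f e) (a + b)"
proof -
  define shift :: "(nat \<Rightarrow> 'a poly poly) \<Rightarrow> nat \<Rightarrow> 'a poly poly"
    where "shift v = (\<lambda>j. if j < c1 then 0 else v (j - c1))" for v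
  let ?S = "solutions c1 I1 M f e" and ?T = "solutions c2 I2 (\<lambda>i j. M i (c1 + j)) f e"
  interpret linear_map scale2 scale2 shift
    by unfold_locales (auto simp: shift_def scale2_def fun_eq_iff)
  have split: "(\<Sum>j<c1 + c2. g j) = (\<Sum>j<c1. g j) + (\<Sum>j<c2. g (c1 + j))" for g :: "nat \<Rightarrow> 'a poly poly"
    by (simp add: lessThan_atLeast0 sum.atLeastLessThan_concat[symmetric, of 0 c1 "c1 + c2"]
       sum.atLeastLessThan_shift_0[of _ c1] o_def)
  have "solutions (c1 + c2) I M f e = {x + y |x y. x \<in> ?S \<and> y \<in> shift ` ?T}"
  proof (intro equalityI subsetI)
    fix u assume u: "u \<in> solutions (c1 + c2) I M f e"
    define x where "x j = (if j < c1 then u j else 0)" for j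
    define y where "y j = u (c1 + j)" for j
    have row: "\<exists>w. (\<Sum>j<c1. M i j * u j) + (\<Sum>j<c2. M i (c1 + j) * u (c1 + j)) = [:[:w:]:] * f"
      if "i \<in> I" for i
      using u that unfolding solutions_def split by blast
    have "x \<in> ?S" unfolding solutions_def
    proof (intro CollectI conjI ballI)
      fix i assume "i \<in> I1"
      then show "\<exists>w. (\<Sum>j<c1. M i j * x j) = [:[:w:]:] * f"
        using row[of i] z1[of i] I by (simp add: x_def)
    qed (use u in \<open>auto simp: x_def solutions_def\<close>)
    moreover have "y \<in> ?T" unfolding solutions_def
    proof (intro CollectI conjI ballI)
      fix i assume "i \<in> I2"
      then show "\<exists>w. (\<Sum>j<c2. M i (c1 + j) * y j) = [:[:w:]:] * f"
        using row[of i] z2[of i] I by (simp add: y_def)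
    qed (use u in \<open>auto simp: y_def solutions_def\<close>)
    moreover have "u = x + shift y" by (auto simp: fun_eq_iff x_def y_def shift_def)
    ultimately show "u \<in> {x + y |x y. x \<in> ?S \<and> y \<in> shift ` ?T}" by blast
  next
    fix u assume "u \<in> {x + y |x y. x \<in> ?S \<and> y \<in> shift ` ?T}"
    then obtain x y where xy: "u = x + shift y" "x \<in> ?S" "y \<in> ?T" by blast
    have ux: "u j = x j" if "j < c1" for j using xy that by (simp add: shift_def)
    have uy: "u (c1 + j) = y j" for j using xy by (auto simp: shift_def solutions_def)
    show "u \<in> solutions (c1 + c2) I M f e" unfolding solutions_def
    proof (intro CollectI conjI ballI allI impI)
      fix i assume "i \<in> I"
      then consider "i \<in> I1" | "i \<in> I2" using I by blast
      then show "\<exists>w. (\<Sum>j<c1 + c2. M i j * u j) = [:[:w:]:] * f"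
      proof cases
        case 1
        then have "(\<Sum>j<c1 + c2. M i j * u j) = (\<Sum>j<c1. M i j * x j)"
          unfolding split using z1[OF 1] by (simp add: ux)
        then show ?thesis using xy(2) 1 unfolding solutions_def by auto
      next
        case 2
        then have "(\<Sum>j<c1 + c2. M i j * u j) = (\<Sum>j<c2. M i (c1 + j) * y j)"
          unfolding split using z2[OF 2] by (simp add: uy)
        then show ?thesis using xy(3) 2 unfolding solutions_def by auto
      qed
    next
      fix j assume "c1 + c2 \<le> j"
      then show "u j = 0" using uy[of "j - c1"] xy(3) by (auto simp: solutions_def)
    next
      fix j show "homog e (u j)"
        using ux[of j] uy[of "j - c1"] xy(2,3) by (cases "j < c1") (auto simp: solutions_def)
    qed
  qed
  moreover have "W2.subspace (shift ` ?T)"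
    by (rule image_subspace[OF solutions_subspace])
  moreover have "W2.has_dim (shift ` ?T) b"
  proof (rule has_dim_image[OF solutions_subspace d2])
    fix v assume "shift v = 0"
    then have "shift v (c1 + j) = 0" for j by simp
    then show "v = 0" by (auto simp: shift_def fun_eq_iff)
  qed
  moreover have "x = 0" if "x \<in> ?S" "x \<in> shift ` ?T" for x
  proof
    fix j show "x j = 0 j" using that by (cases "j < c1") (auto simp: solutions_def shift_def)
  qed
  ultimately show ?thesis using W2.has_dim_sum[OF solutions_subspace d1] by blast
qed

lemma solutions_rows_eq:
  assumes "\<And>i. i \<in> I \<Longrightarrow> \<exists>i'\<in>I'. \<exists>s. \<forall>j<c. M i j = [:[:s:]:] * M' i' j"
    and "\<And>i. i \<in> I' \<Longrightarrow> \<exists>i'\<in>I. \<exists>s. \<forall>j<c. M' i j = [:[:s:]:] * M i' j"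
  shows "solutions c I M f e = solutions c I' M' f e"
  using solutions_mono_rows[of I I' c M M' f e, OF assms(1)]
    solutions_mono_rows[of I' I c M' M f e, OF assms(2)] by blast

lemma lin2_0 [simp]: "lin2 0 0 = 0"
  by (simp add: lin2_def)

lemma lin2_add: "lin2 (a + b) (c + d) = lin2 a c + lin2 b d"
  by (simp add: lin2_def)

lemma sol_dim_dsum:
  assumes A: "sq_pair A n" and B: "sq_pair B m" and "sol_dim A f e a" "sol_dim B f e b"
  shows "sol_dim (dsum_pair A B) f e (a + b)"
proof -
  let ?D = "dsum_pair A B"
  have dims: "dim_row (fst ?D) = n + m" "dim_col (fst ?D) = n + m"
    "dim_row (fst A) = n" "dim_col (fst A) = n" "dim_row (fst B) = m" "dim_col (fst B) = m"
    "dim_row (snd A) = n" "dim_col (snd A) = n" "dim_row (snd B) = m" "dim_col (snd B) = m"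
    using A B by (auto simp: sq_pair_def dsum_pair_def)
  have p: "pencil ?D i j = (if i < n then if j < n then pencil A i j else 0
      else if j < n then 0 else pencil B (i - n) (j - n))" if "i < n + m" "j < n + m" for i j
    using that dims by (auto simp: pencil_def dsum_pair_def)
  have "solutions n {..<n} (pencil ?D) f e = pair_solutions A f e" unfolding dims
  proof (rule solutions_rows_eq)
    fix i assume "i \<in> {..<n}"
    then show "\<exists>i'\<in>{..<n}. \<exists>s. \<forall>j<n. pencil ?D i j = [:[:s:]:] * pencil A i' j"
      by (intro bexI[of _ i] exI[of _ 1]) (auto simp: p pCons_one)
    from \<open>i \<in> {..<n}\<close> show "\<exists>i'\<in>{..<n}. \<exists>s. \<forall>j<n. pencil A i j = [:[:s:]:] * pencil ?D i' j"
      by (intro bexI[of _ i] exI[of _ 1]) (auto simp: p pCons_one)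
  qed
  moreover have "solutions m {n..<n + m} (\<lambda>i j. pencil ?D i (n + j)) f e = pair_solutions B f e" unfolding dims
  proof (rule solutions_rows_eq)
    fix i assume "i \<in> {n..<n + m}"
    then show "\<exists>i'\<in>{..<m}. \<exists>s. \<forall>j<m. pencil ?D i (n + j) = [:[:s:]:] * pencil B i' j"
      by (intro bexI[of _ "i - n"] exI[of _ 1]) (auto simp: p pCons_one)
  next
    fix i assume "i \<in> {..<m}"
    then show "\<exists>i'\<in>{n..<n + m}. \<exists>s. \<forall>j<m. pencil B i j = [:[:s:]:] * pencil ?D i' (n + j)"
      by (intro bexI[of _ "n + i"] exI[of _ 1]) (auto simp: p pCons_one)
  qed
  ultimately have d: "W2.has_dim (solutions n {..<n} (pencil ?D) f e) a"
    "W2.has_dim (solutions m {n..<n + m} (\<lambda>i j. pencil ?D i (n + j)) f e) b"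
    using assms(3,4) unfolding sol_dim_def by simp_all
  show ?thesis unfolding sol_dim_def dims(1,2)
    by (rule solutions_split[OF _ _ _ d]) (auto simp: p)
qed

text \<open>In \<open>R^+\<close> the first \<open>r\<close> columns meet only the lower rows, which
  hold minus the transpose of \<open>R\<close>, and the remaining columns only the upper rows, which
  hold \<open>R\<close>.\<close>

lemma sol_dim_plus:
  assumes R: "fst R \<in> carrier_mat r s" "snd R \<in> carrier_mat r s"
    and "sol_dim (transpose_mat (fst R), transpose_mat (snd R)) f e a" "sol_dim R f e b"
  shows "sol_dim (plus_pair R) f e (a + b)"
proof -
  let ?D = "plus_pair R" and ?T = "(transpose_mat (fst R), transpose_mat (snd R))"
  have dims: "dim_row (fst ?D) = r + s" "dim_col (fst ?D) = r + s"
    "dim_row (fst R) = r" "dim_col (fst R) = s" "dim_row (fst ?T) = s" "dim_col (fst ?T) = r"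
    using R by (auto simp: plus_mat_def plus_pair_def)
  have p: "pencil ?D i j = (if i < r then if j < r then 0 else pencil R i (j - r)
      else if j < r then [:[:-1:]:] * pencil ?T (i - r) j else 0)" if "i < r + s" "j < r + s" for i j
    using that R by (auto simp: pencil_def plus_mat_def plus_pair_def lin2_def)
  have "solutions r {r..<r + s} (pencil ?D) f e = pair_solutions ?T f e" unfolding dims
  proof (rule solutions_rows_eq)
    fix i assume "i \<in> {r..<r + s}"
    then show "\<exists>i'\<in>{..<s}. \<exists>c. \<forall>j<r. pencil ?D i j = [:[:c:]:] * pencil ?T i' j"
      by (intro bexI[of _ "i - r"] exI[of _ "-1"]) (auto simp: p)
  next
    fix i assume "i \<in> {..<s}"
    then show "\<exists>i'\<in>{r..<r + s}. \<exists>c. \<forall>j<r. pencil ?T i j = [:[:c:]:] * pencil ?D i' j"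
      by (intro bexI[of _ "r + i"] exI[of _ "-1"]) (auto simp: p pCons_one)
  qed
  moreover have "solutions s {..<r} (\<lambda>i j. pencil ?D i (r + j)) f e = pair_solutions R f e" unfolding dims
  proof (rule solutions_rows_eq)
    fix i assume i: "i \<in> {..<r}"
    then show "\<exists>i'\<in>{..<r}. \<exists>c. \<forall>j<s. pencil ?D i (r + j) = [:[:c:]:] * pencil R i' j"
      by (intro bexI[of _ i] exI[of _ 1]) (auto simp: p pCons_one)
    from i show "\<exists>i'\<in>{..<r}. \<exists>c. \<forall>j<s. pencil R i j = [:[:c:]:] * pencil ?D i' (r + j)"
      by (intro bexI[of _ i] exI[of _ 1]) (auto simp: p pCons_one)
  qed
  ultimately have d: "W2.has_dim (solutions r {r..<r + s} (pencil ?D) f e) a"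
    "W2.has_dim (solutions s {..<r} (\<lambda>i j. pencil ?D i (r + j)) f e) b"
    using assms(3,4) unfolding sol_dim_def by simp_all
  show ?thesis unfolding sol_dim_def dims(1,2)
    by (rule solutions_split[OF _ _ _ d]) (auto simp: p)
qed

text \<open>By \<open>BK\<close>, multiplication by \<open>K\<close> takes solutions for
  \<open>A\<close> to solutions for \<open>B\<close>: a combination, with constant coefficients, of
  constant multiples of \<open>f\<close> is again one. The primed matrices give the inverse map. The
  intertwining form covers congruence as well as the passage from a companion matrix to its
  transpose.\<close>

lemma sol_dim_equivalent:
  assumes A: "fst A \<in> carrier_mat n n" "snd A \<in> carrier_mat n n"
    and B: "fst B \<in> carrier_mat n n" "snd B \<in> carrier_mat n n"
    and K: "K \<in> carrier_mat n n" "L \<in> carrier_mat n n" "K' \<in> carrier_mat n n" "L' \<in> carrier_mat n n"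
    and inv: "K * K' = 1\<^sub>m n" "K' * K = 1\<^sub>m n"
    and BK: "fst B * K = L * fst A" "snd B * K = L * snd A"
    and AK: "fst A * K' = L' * fst B" "snd A * K' = L' * snd B"
    and dim: "sol_dim A f e d"
  shows "sol_dim B f e d"
proof -
  define \<psi> :: "'a mat \<Rightarrow> (nat \<Rightarrow> 'a poly poly) \<Rightarrow> nat \<Rightarrow> 'a poly poly"
    where "\<psi> K u = (\<lambda>j. if j < n then \<Sum>k<n. [:[:K $$ (j,k):]:] * u k else 0)" for K u
  have lin: "linear_map scale2 scale2 (\<psi> K)" for K
    by unfold_locales (auto simp: \<psi>_def scale2_def fun_eq_iff distrib_left distrib_right sum.distrib sum_distrib_left mult_ac
        simp del: mult_pCons_left mult_pCons_right)
  have const_sum: "[:[:sum g S:]:] = (\<Sum>k\<in>S. [:[:g k:]:])" for g :: "nat \<Rightarrow> 'a" and S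
  proof -
    have "[:[:a + b:]:] = [:[:a:]:] + [:[:b:]:]" for a b :: 'a by simp
    then show ?thesis
      by (induction S rule: infinite_finite_induct) (auto simp del: add_pCons)
  qed
  have mat: "(M * N) $$ (i,j) = (\<Sum>k<n. M $$ (i,k) * N $$ (k,j))"
    if "M \<in> carrier_mat n n" "N \<in> carrier_mat n n" "i < n" "j < n" for M N :: "'a mat" and i j
    using that by (simp add: scalar_prod_def lessThan_atLeast0)
  have comp: "\<psi> K (\<psi> K' u) = u" if "K \<in> carrier_mat n n" "K' \<in> carrier_mat n n" "K * K' = 1\<^sub>m n"
    "\<forall>j\<ge>n. u j = 0" for K K' u
  proof
    fix j
    show "\<psi> K (\<psi> K' u) j = u j"
    proof (cases "j < n")
      case True
      have "\<psi> K (\<psi> K' u) j = (\<Sum>k<n. \<Sum>l<n. [:[:K $$ (j,k):]:] * ([:[:K' $$ (k,l):]:] * u l))"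
        using True by (simp add: \<psi>_def sum_distrib_left del: mult_pCons_left)
      also have "\<dots> = (\<Sum>l<n. \<Sum>k<n. [:[:K $$ (j,k):]:] * ([:[:K' $$ (k,l):]:] * u l))"
        by (rule sum.swap)
      also have "\<dots> = (\<Sum>l<n. [:[:(K * K') $$ (j,l):]:] * u l)"
      proof (intro sum.cong refl)
        fix l assume "l \<in> {..<n}"
        then have "(K * K') $$ (j,l) = (\<Sum>k<n. K $$ (j,k) * K' $$ (k,l))" 
          by (intro mat that(1,2) True) simp
        then show "(\<Sum>k<n. [:[:K $$ (j,k):]:] * ([:[:K' $$ (k,l):]:] * u l)) = [:[:(K * K') $$ (j,l):]:] * u l"
          unfolding const_sum sum_distrib_right by (simp add: const_sum sum_distrib_right)
      qed
      also have "\<dots> = u j" unfolding that(3) using True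
        by (intro sum_pick[of j]) (auto simp: pCons_one)
      finally show ?thesis .
    qed (simp add: \<psi>_def that(4))
  qed
  have lin2_sum: "lin2 (sum g S) (- sum h S) = (\<Sum>k\<in>S. lin2 (g k) (- h k))" for g h :: "nat \<Rightarrow> 'a" and S
  proof -
    have "lin2 (sum g S) (sum h' S) = (\<Sum>k\<in>S. lin2 (g k) (h' k))" for h' :: "nat \<Rightarrow> 'a"
      by (induction S rule: infinite_finite_induct) (auto simp: lin2_add)
    from this[of "\<lambda>k. - h k"] show ?thesis by (simp add: sum_negf)
  qed
  have maps: "\<psi> K u \<in> pair_solutions B f e"
    if u: "u \<in> pair_solutions A f e" and A: "fst A \<in> carrier_mat n n" "snd A \<in> carrier_mat n n"
      and B: "fst B \<in> carrier_mat n n" "snd B \<in> carrier_mat n n"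
      and K: "K \<in> carrier_mat n n" "L \<in> carrier_mat n n"
      and BK: "fst B * K = L * fst A" "snd B * K = L * snd A" for A B K L and u :: "nat \<Rightarrow> 'a poly poly"
  proof -
    have dims: "dim_row (fst A) = n" "dim_col (fst A) = n" "dim_row (fst B) = n" "dim_col (fst B) = n"
      using A B by auto
    have key: "(\<Sum>k<n. pencil B i k * [:[:K $$ (k,j):]:]) = (\<Sum>k<n. [:[:L $$ (i,k):]:] * pencil A k j)"
      if "i < n" "j < n" for i j
    proof -
      have "(\<Sum>k<n. pencil B i k * [:[:K $$ (k,j):]:]) = lin2 ((fst B * K) $$ (i,j)) (- (snd B * K) $$ (i,j))"
        unfolding mat[OF B(1) K(1) that] mat[OF B(2) K(1) that] lin2_sum
        by (intro sum.cong) (auto simp: pencil_def lin2_def mult.commute)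
      also have "\<dots> = (\<Sum>k<n. [:[:L $$ (i,k):]:] * pencil A k j)"
        unfolding BK mat[OF K(2) A(1) that] mat[OF K(2) A(2) that] lin2_sum
        by (intro sum.cong) (auto simp: pencil_def lin2_def)
      finally show ?thesis .
    qed
    have "\<forall>i\<in>{..<n}. \<exists>w. (\<Sum>j<n. pencil A i j * u j) = [:[:w:]:] * f"
      using u unfolding solutions_def dims by blast
    from bchoice[OF this] obtain w
      where "\<forall>i\<in>{..<n}. (\<Sum>j<n. pencil A i j * u j) = [:[:w i:]:] * f" ..
    then have w: "(\<Sum>j<n. pencil A i j * u j) = [:[:w i:]:] * f" if "i < n" for i
      using that by blast
    have "(\<Sum>j<n. pencil B i j * \<psi> K u j) = [:[:\<Sum>k<n. L $$ (i,k) * w k:]:] * f" if "i < n" for i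
    proof -
      have "(\<Sum>j<n. pencil B i j * \<psi> K u j) = (\<Sum>j<n. \<Sum>k<n. pencil B i j * [:[:K $$ (j,k):]:] * u k)"
        by (simp add: \<psi>_def sum_distrib_left mult.assoc del: mult_pCons_left mult_pCons_right)
      also have "\<dots> = (\<Sum>k<n. (\<Sum>j<n. pencil B i j * [:[:K $$ (j,k):]:]) * u k)"
        unfolding sum_distrib_right by (rule sum.swap)
      also have "\<dots> = (\<Sum>k<n. (\<Sum>j<n. [:[:L $$ (i,j):]:] * pencil A j k) * u k)"
        using key that by (intro sum.cong) auto
      also have "\<dots> = (\<Sum>j<n. \<Sum>k<n. [:[:L $$ (i,j):]:] * pencil A j k * u k)"
        unfolding sum_distrib_right by (rule sum.swap)
      also have "\<dots> = (\<Sum>j<n. [:[:L $$ (i,j):]:] * ([:[:w j:]:] * f))"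
        by (intro sum.cong refl, subst w[symmetric])
          (auto simp: sum_distrib_left mult.assoc simp del: mult_pCons_left mult_pCons_right)
      also have "\<dots> = [:[:\<Sum>k<n. L $$ (i,k) * w k:]:] * f"
        unfolding const_sum sum_distrib_right by (intro sum.cong) auto
      finally show ?thesis .
    qed
    moreover have "homog e (\<psi> K u j)" for j
      using u by (auto simp: \<psi>_def solutions_def simp del: mult_pCons_left intro!: homog_sum homog_scalar)
    ultimately show ?thesis unfolding solutions_def dims by (auto simp: \<psi>_def simp del: mult_pCons_left)
  qed
  interpret linear_map scale2 scale2 "\<psi> K" by (rule lin)
  have dA: "dim_col (fst A) = n" and dB: "dim_col (fst B) = n" using A B by auto
  have "\<psi> K ` pair_solutions A f e = pair_solutions B f e"
  proof (intro equalityI subsetI)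
    fix v assume "v \<in> \<psi> K ` pair_solutions A f e"
    then show "v \<in> pair_solutions B f e" using maps[OF _ A B K(1,2) BK] by blast
  next
    fix v assume v: "v \<in> pair_solutions B f e"
    have "\<psi> K' v \<in> pair_solutions A f e" by (rule maps[OF v B A K(3,4) AK])
    moreover have "\<psi> K (\<psi> K' v) = v"
      by (rule comp[OF K(1,3) inv(1)]) (use v dB in \<open>auto simp: solutions_def\<close>)
    ultimately show "v \<in> \<psi> K ` pair_solutions A f e" by (metis imageI)
  qed
  moreover have "u = 0" if u: "u \<in> pair_solutions A f e" and "\<psi> K u = 0" for u
  proof -
    have "u = \<psi> K' (\<psi> K u)"
      by (rule comp[OF K(3,1) inv(2), symmetric]) (use u dA in \<open>auto simp: solutions_def\<close>)
    also have "\<dots> = 0" unfolding \<open>\<psi> K u = 0\<close> by (auto simp: \<psi>_def fun_eq_iff)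
    finally show ?thesis .
  qed
  ultimately show ?thesis
    using has_dim_image[OF solutions_subspace dim[unfolded sol_dim_def]] unfolding sol_dim_def by metis
qed

lemma sol_dim_congruent:
  assumes A: "sq_pair A n" and P: "P \<in> carrier_mat n n" "invertible_mat P"
    and dim: "sol_dim A f e d"
  shows "sol_dim (pair_act_left P A) f e d"
proof -
  obtain P' where P': "P' \<in> carrier_mat n n" "P * P' = 1\<^sub>m n" "P' * P = 1\<^sub>m n"
  proof -
    obtain P' where R: "P * P' = 1\<^sub>m (dim_row P)" "P' * P = 1\<^sub>m (dim_row P')"
      using P(2) by (auto simp: invertible_mat_def inverts_mat_def)
    have "dim_col (P * P') = n" "dim_col (P' * P) = dim_row P'" using R P(1) by simp_all
    then have "P' \<in> carrier_mat n n" using P(1) by auto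
    with R P(1) that show thesis by auto
  qed
  have A': "fst A \<in> carrier_mat n n" "snd A \<in> carrier_mat n n" using A by (auto simp: sq_pair_def)
  let ?T = "transpose_mat P" and ?T' = "transpose_mat P'"
  have T: "?T \<in> carrier_mat n n" "?T' \<in> carrier_mat n n" using P P' by auto
  have TT: "?T * ?T' = 1\<^sub>m n" "?T' * ?T = 1\<^sub>m n"
    using P P' by (simp_all add: transpose_mult[symmetric, of _ n n _ n])
  have 1: "P * X * ?T * ?T' = P * X" if "X \<in> carrier_mat n n" for X
  proof -
    have "P * X * ?T * ?T' = P * X * (?T * ?T')" by (rule assoc_mult_mat) (use P T that in auto)
    then show ?thesis using TT P that by (simp add: right_mult_one_mat[of _ n n])
  qed
  have 2: "P' * (P * X * ?T) = X * ?T" if "X \<in> carrier_mat n n" for X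
  proof -
    have "P' * (P * X * ?T) = P' * (P * (X * ?T))" using P that by (simp add: assoc_mult_mat[of _ n n _ n _ n])
    also have "\<dots> = P' * P * (X * ?T)" 
      by (rule assoc_mult_mat[symmetric, of _ n n _ n _ n]) (use P P' that in auto)
    finally show ?thesis using P' that P by (simp add: left_mult_one_mat[of _ n n])
  qed
  \<comment> \<open>Solutions are multiplied by the inverse transpose of \<open>P\<close>, rows by
    \<open>P\<close>.\<close>
  show ?thesis
    by (rule sol_dim_equivalent[OF A' _ _ T(2) P(1) T(1) P'(1) TT(2,1) _ _ _ _ dim])
      (use A' P T 1 2 in \<open>auto simp: pair_act_left_def\<close>)
qed

text \<open>The signs come from the minus sign in \<open>pencil\<close>.\<close>

definition twist :: "'a::field mat \<Rightarrow> 'a mat" where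
  "twist Q = mat 2 2 (\<lambda>(i,j). if i = j then Q $$ (i,j) else - Q $$ (i,j))"

lemma twist_carrier [simp]: "twist Q \<in> carrier_mat 2 2"
  by (simp add: twist_def)

lemma index_mult_2:
  assumes "Q \<in> carrier_mat 2 2" "R \<in> carrier_mat 2 2" "i < 2" "j < 2"
  shows "(Q * R) $$ (i,j) = Q $$ (i,0) * R $$ (0,j) + Q $$ (i,1) * R $$ (1,j)"
  using assms by (simp add: scalar_prod_def numeral_2_eq_2)

lemma twist_mult:
  assumes "Q \<in> carrier_mat 2 2" "R \<in> carrier_mat 2 2"
  shows "twist Q * twist R = twist (Q * R)"
proof (rule eq_matI)
  fix i j assume "i < dim_row (twist (Q * R))" "j < dim_col (twist (Q * R))"
  then have ij: "i < 2" "j < 2" by (auto simp: twist_def)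
  then consider "i = 0" "j = 0" | "i = 0" "j = 1" | "i = 1" "j = 0" | "i = 1" "j = 1" by linarith
  then show "(twist Q * twist R) $$ (i,j) = twist (Q * R) $$ (i,j)"
    unfolding index_mult_2[OF twist_carrier twist_carrier ij]
    by cases (simp_all add: twist_def index_mult_2[OF assms] del: index_mult_mat)
qed (auto simp: twist_def)

lemma twist_one: "twist (1\<^sub>m 2) = 1\<^sub>m 2"
  by (rule eq_matI) (auto simp: twist_def)

lemma twist_twist: "Q \<in> carrier_mat 2 2 \<Longrightarrow> twist (twist Q) = Q"
  by (rule eq_matI) (auto simp: twist_def)

lemma twist_invertible:
  assumes "Q \<in> carrier_mat 2 2" "invertible_mat Q"
  shows "invertible_mat (twist Q)"
proof -
  obtain R where R: "R \<in> carrier_mat 2 2" "R * Q = 1\<^sub>m 2" "Q * R = 1\<^sub>m 2"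
    using invertible_mat2E[OF assms] by metis
  then have "twist Q * twist R = 1\<^sub>m 2" "twist R * twist Q = 1\<^sub>m 2"
    using twist_mult assms(1) R twist_one by metis+
  moreover have "dim_row (twist R) = 2" "dim_row (twist Q) = 2" "dim_col (twist Q) = 2"
    by (auto simp: twist_def)
  ultimately show ?thesis unfolding invertible_mat_def inverts_mat_def by auto
qed

lemma pencil_twist:
  assumes "fst A \<in> carrier_mat r s" "snd A \<in> carrier_mat r s" "i < r" "j < s"
  shows "pencil (pair_act_right A Q) i j = gl_act (twist Q) (pencil A i j)"
  using assms unfolding pencil_def gl_act_lin2
  by (simp add: pair_act_right_def twist_def algebra_simps)

text \<open>The substitution is applied to the entries of a solution. It is linear over the field,
  bijective, preserves degrees and fixes constants, so it carries one solution space onto the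
  other.\<close>

lemma sol_dim_twist:
  assumes A: "fst A \<in> carrier_mat r s" "snd A \<in> carrier_mat r s"
    and Q: "Q \<in> carrier_mat 2 2" "invertible_mat Q"
    and dim: "sol_dim A f e d"
  shows "sol_dim (pair_act_right A Q) (gl_act (twist Q) f) e d"
proof -
  obtain R where R: "R \<in> carrier_mat 2 2" "R * Q = 1\<^sub>m 2" "Q * R = 1\<^sub>m 2"
    using invertible_mat2E[OF Q] by metis
  then have QR: "twist Q * twist R = 1\<^sub>m 2" "twist R * twist Q = 1\<^sub>m 2"
    using twist_mult Q(1) twist_one by metis+
  have inv: "gl_act (twist R) (gl_act (twist Q) h) = h" "gl_act (twist Q) (gl_act (twist R) h) = h" for h :: "'a poly poly"
    by (rule gl_act_inverse; simp add: QR)+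
  let ?B = "pair_act_right A Q" and ?f = "gl_act (twist Q) f"
  have dims: "dim_row (fst A) = r" "dim_col (fst A) = s" "dim_row (fst ?B) = r" "dim_col (fst ?B) = s"
    using A by (auto simp: pair_act_right_def)
  interpret linear_map scale2 scale2 "\<lambda>u j. gl_act (twist Q) (u j)"
    by unfold_locales (auto simp: fun_eq_iff scale2_def gl_act_add gl_act_mult simp del: mult_pCons_left)
  have row: "gl_act (twist Q) (\<Sum>j<s. pencil A i j * u j) = (\<Sum>j<s. pencil ?B i j * gl_act (twist Q) (u j))"
    if "i < r" for i u
    using pencil_twist[OF A that] by (simp add: gl_act_sum gl_act_mult)
  have "(\<lambda>u j. gl_act (twist Q) (u j)) ` pair_solutions A f e = pair_solutions ?B ?f e"
    unfolding dims
  proof (intro equalityI subsetI)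
    fix v assume "v \<in> (\<lambda>u j. gl_act (twist Q) (u j)) ` solutions s {..<r} (pencil A) f e"
    then obtain u where u: "u \<in> solutions s {..<r} (pencil A) f e" and v: "v = (\<lambda>j. gl_act (twist Q) (u j))"
      by blast
    have "\<exists>w. (\<Sum>j<s. pencil ?B i j * v j) = [:[:w:]:] * ?f" if i: "i \<in> {..<r}" for i
    proof -
      obtain w where w: "(\<Sum>j<s. pencil A i j * u j) = [:[:w:]:] * f"
        using u i unfolding solutions_def by blast
      have "(\<Sum>j<s. pencil ?B i j * v j) = gl_act (twist Q) ([:[:w:]:] * f)"
        using row[of i u] i unfolding v w by simp
      then show ?thesis unfolding gl_act_mult gl_act_const by blast
    qed
    moreover have "homog e (v j)" for j
      unfolding v using u by (auto simp: solutions_def intro: gl_act_homog)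
    moreover have "\<forall>j\<ge>s. v j = 0" using u by (simp add: v solutions_def)
    ultimately show "v \<in> solutions s {..<r} (pencil ?B) ?f e" unfolding solutions_def by blast
  next
    fix v assume v: "v \<in> solutions s {..<r} (pencil ?B) ?f e"
    define u where "u j = gl_act (twist R) (v j)" for j
    have vu: "v j = gl_act (twist Q) (u j)" for j by (simp add: u_def inv)
    have "\<exists>w. (\<Sum>j<s. pencil A i j * u j) = [:[:w:]:] * f" if i: "i \<in> {..<r}" for i
    proof -
      obtain w where w: "(\<Sum>j<s. pencil ?B i j * v j) = [:[:w:]:] * ?f"
        using v i unfolding solutions_def by blast
      have "gl_act (twist Q) (\<Sum>j<s. pencil A i j * u j) = gl_act (twist Q) ([:[:w:]:] * f)"
        using row[of i u] i w unfolding vu gl_act_mult gl_act_const by simp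
      then show ?thesis using inv(1) by metis
    qed
    moreover have "homog e (u j)" for j unfolding u_def using v by (auto simp: solutions_def intro: gl_act_homog)
    moreover have "\<forall>j\<ge>s. u j = 0" using v by (simp add: u_def solutions_def)
    ultimately have "u \<in> solutions s {..<r} (pencil A) f e" unfolding solutions_def by blast
    moreover have "v = (\<lambda>j. gl_act (twist Q) (u j))" using vu by blast
    ultimately show "v \<in> (\<lambda>u j. gl_act (twist Q) (u j)) ` solutions s {..<r} (pencil A) f e" by blast
  qed
  moreover have "u = 0" if "(\<lambda>j. gl_act (twist Q) (u j)) = 0" for u
  proof
    fix j
    have "gl_act (twist Q) (u j) = 0" using that by (metis zero_fun_apply)
    then show "u j = 0 j" using inv(1)[of "u j"] by simp
  qed
  ultimately show ?thesis
    using has_dim_image[OF solutions_subspace dim[unfolded sol_dim_def]] unfolding sol_dim_def by metis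
qed

lemma sol_dim_scalar:
  assumes "c \<noteq> 0"
  shows "sol_dim A ([:[:c:]:] * f) e = sol_dim A f e"
proof -
  have "(\<exists>w. g = [:[:w:]:] * ([:[:c:]:] * f)) \<longleftrightarrow> (\<exists>w. g = [:[:w:]:] * f)" for g
  proof
    assume "\<exists>w. g = [:[:w:]:] * ([:[:c:]:] * f)"
    then obtain w where "g = [:[:w:]:] * ([:[:c:]:] * f)" ..
    then show "\<exists>w. g = [:[:w:]:] * f" by (intro exI[of _ "w * c"]) simp
  next
    assume "\<exists>w. g = [:[:w:]:] * f"
    then obtain w where "g = [:[:w:]:] * f" ..
    then show "\<exists>w. g = [:[:w:]:] * ([:[:c:]:] * f)" using assms by (intro exI[of _ "w / c"]) simp
  qed
  then show ?thesis unfolding sol_dim_def solutions_def by (simp only:)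
qed

section \<open>Solution spaces after setting \<open>x2 = 1\<close>\<close>

definition polys_below :: "nat \<Rightarrow> 'a::field poly set" where
  "polys_below N = {g. \<forall>k\<ge>N. coeff g k = 0}"

lemma polys_below_iff: "g \<in> polys_below N \<longleftrightarrow> g = 0 \<or> degree g < N"
proof
  assume g: "g \<in> polys_below N"
  show "g = 0 \<or> degree g < N"
  proof (rule ccontr)
    assume "\<not> ?thesis"
    then have "lead_coeff g \<noteq> 0" "N \<le> degree g" by auto
    with g show False by (auto simp: polys_below_def)
  qed
qed (auto simp: polys_below_def coeff_eq_0)

lemma polys_below_Suc: "g \<in> polys_below (Suc e) \<longleftrightarrow> degree g \<le> e"
  unfolding polys_below_iff by auto

lemma polys_below_0 [simp]: "0 \<in> polys_below N"
  by (simp add: polys_below_def)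

lemma polys_below_subspace: "W0.subspace (polys_below N)"
  by (rule W0.subspaceI) (auto simp: polys_below_def)

lemma polys_below_dim: "W0.has_dim (polys_below N :: 'a::field poly set) N"
proof -
  have c: "coeff (W0.lincomb c (map (monom 1) [0..<N])) k = (if k < N then c k else 0)" for c :: "nat \<Rightarrow> 'a" and k
  proof (cases "k < N")
    case True
    then have "coeff (W0.lincomb c (map (monom 1) [0..<N])) k = c k"
      unfolding W0.lincomb_map coeff_sum by (intro sum_pick[of k]) auto
    with True show ?thesis by simp
  qed (auto simp: W0.lincomb_map coeff_sum intro!: sum.neutral)
  have "W0.has_basis (polys_below N :: 'a poly set) (map (monom 1) [0..<N])"
    unfolding W0.has_basis_def
  proof (intro conjI ballI allI impI)
    fix v :: "'a poly" assume "v \<in> polys_below N"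
    then have "v = W0.lincomb (coeff v) (map (monom 1) [0..<N])"
      by (intro poly_eqI) (simp add: c polys_below_def)
    then show "\<exists>c. v = W0.lincomb c (map (monom 1) [0..<N])" by blast
  next
    fix a i assume "W0.lincomb a (map (monom (1::'a)) [0..<N]) = 0" "i < length (map (monom (1::'a)) [0..<N])"
    then show "a i = 0" using c[of a i] by simp
  qed (auto simp: polys_below_def)
  then show ?thesis unfolding W0.has_dim_def by (intro exI[of _ "map (monom 1) [0..<N]"]) simp
qed

text \<open>The solution space at \<open>x2 = 1\<close>.\<close>

definition affine_solutions :: "'a::field mpair \<Rightarrow> 'a poly \<Rightarrow> nat \<Rightarrow> (nat \<Rightarrow> 'a poly) set" where
  "affine_solutions A f e = {u. (\<forall>j\<ge>dim_col (fst A). u j = 0) \<and> (\<forall>j. u j \<in> polys_below (Suc e)) \<and>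
     (\<forall>i<dim_row (fst A). \<exists>w. (\<Sum>j<dim_col (fst A). [:- snd A $$ (i,j), fst A $$ (i,j):] * u j) = smult w f)}"

lemma affine_solutions_subspace: "W1.subspace (affine_solutions A f e)"
proof (rule W1.subspaceI)
  show "0 \<in> affine_solutions A f e" by (auto simp: affine_solutions_def intro!: exI[of _ 0])
next
  fix u v assume uv: "u \<in> affine_solutions A f e" "v \<in> affine_solutions A f e"
  let ?s = "\<lambda>i u. \<Sum>j<dim_col (fst A). [:- snd A $$ (i,j), fst A $$ (i,j):] * u j"
  have "\<exists>w. ?s i (u + v) = smult w f" if i: "i < dim_row (fst A)" for i
  proof -
    obtain w w' where "?s i u = smult w f" "?s i v = smult w' f"
      using uv i unfolding affine_solutions_def by blast
    then show ?thesis
      by (intro exI[of _ "w + w'"]) (simp add: distrib_left sum.distrib smult_add_left del: mult_pCons_left)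
  qed
  then show "u + v \<in> affine_solutions A f e"
    using uv by (auto simp: affine_solutions_def simp del: mult_pCons_left
        intro: W0.subspace_add[OF polys_below_subspace])
next
  fix a u assume u: "u \<in> affine_solutions A f e"
  let ?s = "\<lambda>i u. \<Sum>j<dim_col (fst A). [:- snd A $$ (i,j), fst A $$ (i,j):] * u j"
  have "\<exists>w. ?s i (scale1 a u) = smult w f" if i: "i < dim_row (fst A)" for i
  proof -
    obtain w where "?s i u = smult w f" using u i unfolding affine_solutions_def by blast
    moreover have "?s i (scale1 a u) = smult a (?s i u)"
      by (simp add: scale1_def W0.scale_sum_right del: mult_pCons_left)
    ultimately show ?thesis by (intro exI[of _ "a * w"]) simp
  qed
  moreover have "scale1 a u j \<in> polys_below (Suc e)" for j
    using u by (auto simp: affine_solutions_def scale1_def intro: W0.subspace_scale[OF polys_below_subspace])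
  moreover have "\<forall>j\<ge>dim_col (fst A). scale1 a u j = 0" using u by (simp add: affine_solutions_def scale1_def)
  ultimately show "scale1 a u \<in> affine_solutions A f e" by (simp add: affine_solutions_def)
qed

lemma dehom_lin2: "dehom (lin2 a b) = [:b, a:]"
  unfolding lin2_eq dehom_add dehom_mult dehom_const dehom_x1 dehom_x2 by simp

text \<open>Both sides of the defining equations are forms of degree \<open>e + 1\<close>, the left
  one because the pencil is linear; forms of the same degree agree once they agree at
  \<open>x2 = 1\<close>.\<close>

lemma sol_dim_affine:
  assumes f: "homog (Suc e) f" and dim: "W1.has_dim (affine_solutions A (dehom f) e) n"
  shows "sol_dim A f e n"
proof -
  interpret linear_map scale2 scale1 "\<lambda>u j. dehom (u j)"
    by unfold_locales (auto simp: fun_eq_iff scale2_def scale1_def dehom_add dehom_mult simp del: mult_pCons_left, simp)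
  let ?c = "dim_col (fst A)"
  have row: "dehom (\<Sum>j<?c. pencil A i j * u j)
      = (\<Sum>j<?c. [:- snd A $$ (i,j), fst A $$ (i,j):] * dehom (u j))" for i u
    by (simp add: dehom_sum dehom_mult pencil_def dehom_lin2 del: mult_pCons_left)
  have "(\<lambda>u j. dehom (u j)) ` pair_solutions A f e = affine_solutions A (dehom f) e"
  proof (intro equalityI subsetI)
    fix v assume "v \<in> (\<lambda>u j. dehom (u j)) ` pair_solutions A f e"
    then obtain u where u: "u \<in> pair_solutions A f e" and v: "v = (\<lambda>j. dehom (u j))" by blast
    have "\<exists>w. (\<Sum>j<?c. [:- snd A $$ (i,j), fst A $$ (i,j):] * v j) = smult w (dehom f)"
      if i: "i < dim_row (fst A)" for i
    proof -
      obtain w where w: "(\<Sum>j<?c. pencil A i j * u j) = [:[:w:]:] * f"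
        using u i unfolding solutions_def by blast
      have "dehom ([:[:w:]:] * f) = smult w (dehom f)" unfolding dehom_mult by simp
      then show ?thesis using row[of i u] unfolding v w by metis
    qed
    moreover have "v j \<in> polys_below (Suc e)" for j
      unfolding v polys_below_Suc using u by (auto simp: solutions_def intro: degree_dehom)
    moreover have "\<forall>j\<ge>?c. v j = 0" using u by (simp add: v solutions_def)
    ultimately show "v \<in> affine_solutions A (dehom f) e" unfolding affine_solutions_def by blast
  next
    fix v assume v: "v \<in> affine_solutions A (dehom f) e"
    define u where "u j = homogenize e (v j)" for j
    have uh: "homog e (u j)" for j by (simp add: u_def homog_homogenize)
    have vu: "v j = dehom (u j)" for j
      using v by (simp add: u_def dehom_homogenize affine_solutions_def polys_below_Suc)
    have "\<exists>w. (\<Sum>j<?c. pencil A i j * u j) = [:[:w:]:] * f" if i: "i < dim_row (fst A)" for i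
    proof -
      obtain w where "(\<Sum>j<?c. [:- snd A $$ (i,j), fst A $$ (i,j):] * v j) = smult w (dehom f)"
        using v i unfolding affine_solutions_def by blast
      then have "dehom (\<Sum>j<?c. pencil A i j * u j) = dehom ([:[:w:]:] * f)"
        unfolding row dehom_mult dehom_const vu by simp
      moreover have "homog (Suc e) (\<Sum>j<?c. pencil A i j * u j)"
        using homog_mult[OF homog_lin2 uh] by (intro homog_sum) (simp add: pencil_def)
      ultimately show ?thesis using dehom_inj homog_scalar[OF f] by blast
    qed
    moreover have "\<forall>j\<ge>?c. u j = 0"
      using v by (simp add: u_def affine_solutions_def homogenize_def)
    ultimately have "u \<in> pair_solutions A f e" using uh unfolding solutions_def by blast
    moreover have "v = (\<lambda>j. dehom (u j))" using vu by blast
    ultimately show "v \<in> (\<lambda>u j. dehom (u j)) ` pair_solutions A f e" by blast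
  qed
  moreover have "u = 0" if "u \<in> pair_solutions A f e" "(\<lambda>j. dehom (u j)) = 0" for u
  proof
    fix j
    have "dehom (u j) = 0" using that by (metis zero_fun_apply)
    then show "u j = 0 j" using that(1) dehom_inj[of e "u j" 0] by (simp add: solutions_def)
  qed
  ultimately show ?thesis using has_dim_pullback[OF solutions_subspace] dim unfolding sol_dim_def by metis
qed

text \<open>Companion and shift pencils have rows built from \<open>x t (i + 1) - t i\<close>;
  weighting row \<open>i\<close> with \<open>x^i\<close> makes these terms cancel.\<close>

lemma telescope:
  fixes t :: "nat \<Rightarrow> 'a::field poly"
  shows "(\<Sum>i<n. monom 1 i * (pCons 0 (t (Suc i)) - t i)) = monom 1 n * t n - t 0"
  by (induction n) (auto simp: monom_Suc algebra_simps)

lemma monom_sum_zero: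
  fixes w :: "nat \<Rightarrow> 'a::field"
  assumes "f * (\<Sum>i<n. monom (w i) i) = 0" "i < n"
  shows "smult (w i) f = 0"
proof -
  have "coeff (\<Sum>i<n. monom (w i) i) i = w i"
    unfolding coeff_sum using assms(2) by (intro sum_pick[of i]) auto
  then have "f = 0 \<or> w i = 0" using assms(1) by auto
  then show ?thesis by auto
qed

text \<open>The possible last components of a solution \<open>u\<close> for \<open>R_fin h\<close>: adding the rows of the pencil with
  weights \<open>x^i\<close> gives \<open>h u\<^sub>d\<^sub>-\<^sub>1 = f \<omega>\<close>, and the last component determines \<open>u\<close>.\<close>

definition quotient_space :: "'a::field poly \<Rightarrow> 'a poly \<Rightarrow> nat \<Rightarrow> 'a poly set" where
  "quotient_space h f e = {r \<in> polys_below (Suc e). \<exists>\<omega>\<in>polys_below (degree h). h * r = f * \<omega>}"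

lemma monom_mult_smult: "monom 1 i * smult c r = monom c i * (r :: 'a::field poly)"
  by (metis mult.right_neutral mult_smult_left mult_smult_right smult_monom)

lemma cutoff_shift: "(p :: 'a::field poly) = poly_cutoff i p + monom 1 i * poly_shift i p"
  by (intro poly_eqI) (auto simp: coeff_poly_cutoff coeff_poly_shift coeff_monom_mult mult_1)

lemma poly_shift_Suc: "poly_shift i p = [:coeff p i:] + pCons 0 (poly_shift (Suc i) p)"
  by (intro poly_eqI) (auto simp: coeff_poly_shift coeff_pCons split: nat.splits)

text \<open>Taking the last component is injective: if it is zero, the weighted sum of the rows
  makes every right-hand side vanish. It is onto \<open>quotient_space\<close>, because
  \<open>r\<close> and \<open>\<omega>\<close> give back the other components by dropping low
  coefficients.\<close>

lemma finite_block_solutions: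
  fixes h f :: "'a::field poly"
  assumes h: "lead_coeff h = 1" "degree h > 0" and f: "degree f \<le> Suc e"
    and dim: "W0.has_dim (quotient_space h f e) n"
  shows "W1.has_dim (affine_solutions (R_fin h) f e) n"
proof -
  define N where "N = degree h"
  have N: "N > 0" using h by (simp add: N_def)
  have dims: "dim_row (fst (R_fin h)) = N" "dim_col (fst (R_fin h)) = N"
    by (auto simp: R_fin_def N_def)
  interpret linear_map scale1 smult "\<lambda>u. u (N - 1)"
    by unfold_locales (auto simp: scale1_def)
  \<comment> \<open>The components moved up by one with 0 in front, so that row 0 looks like the
    others and \<open>t u N\<close> is the last component.\<close>
  define t where "t u i = (if i = 0 then 0 else u (i - 1))" for u :: "nat \<Rightarrow> 'a poly" and i
  have row: "(\<Sum>j<N. [:- snd (R_fin h) $$ (i,j), fst (R_fin h) $$ (i,j):] * u j)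
      = pCons 0 (t u (Suc i)) - t u i + smult (coeff h i) (u (N - 1))" if i: "i < N" for i and u :: "nat \<Rightarrow> 'a poly"
  proof -
    have "(\<Sum>j<N. [:- snd (R_fin h) $$ (i,j), fst (R_fin h) $$ (i,j):] * u j)
        = (\<Sum>j<N. (if j = i then pCons 0 (u i) else 0) - (if Suc j = i then u j else 0)
            + (if j = N - 1 then smult (coeff h i) (u (N - 1)) else 0))"
      using i by (intro sum.cong) (auto simp: R_fin_def companion_def N_def[symmetric] Let_def)
    also have "\<dots> = pCons 0 (u i) - (\<Sum>j<N. if Suc j = i then u j else 0) + smult (coeff h i) (u (N - 1))"
      using i N by (simp add: sum.distrib sum_subtractf)
    also have "(\<Sum>j<N. if Suc j = i then u j else 0) = t u i"
    proof (cases i)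
      case (Suc k)
      then show ?thesis using i unfolding t_def by (intro sum_pick[of k, THEN trans]) auto
    qed (simp add: t_def)
    finally show ?thesis by (simp add: t_def)
  qed
  have h_sum: "(\<Sum>i<N. monom (coeff h i) i) + monom 1 N = h"
  proof -
    have "h = (\<Sum>i\<le>N. monom (coeff h i) i)" unfolding N_def by (rule poly_as_sum_of_monoms[symmetric])
    then show ?thesis using h(1) by (simp add: N_def lessThan_Suc_atMost[symmetric])
  qed
  have total: "h * u (N - 1) = f * (\<Sum>i<N. monom (w i) i)"
    if w: "\<And>i. i < N \<Longrightarrow> pCons 0 (t u (Suc i)) - t u i + smult (coeff h i) (u (N - 1)) = smult (w i) f"
    for u w
  proof -
    have "(\<Sum>i<N. monom 1 i * smult (w i) f)
        = (\<Sum>i<N. monom 1 i * (pCons 0 (t u (Suc i)) - t u i) + monom (coeff h i) i * u (N - 1))"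
      by (intro sum.cong refl) (simp only: w[symmetric] lessThan_iff distrib_left monom_mult_smult)
    also have "\<dots> = monom 1 N * t u N - t u 0 + (\<Sum>i<N. monom (coeff h i) i) * u (N - 1)"
      by (simp add: sum.distrib telescope sum_distrib_right)
    also have "\<dots> = ((\<Sum>i<N. monom (coeff h i) i) + monom 1 N) * u (N - 1)"
      using N by (simp add: t_def algebra_simps)
    finally have "h * u (N - 1) = (\<Sum>i<N. monom 1 i * smult (w i) f)" unfolding h_sum by simp
    also have "\<dots> = f * (\<Sum>i<N. monom (w i) i)"
      unfolding sum_distrib_left by (intro sum.cong refl) (simp only: monom_mult_smult mult.commute)
    finally show ?thesis .
  qed
  have rows: "\<exists>w. \<forall>i<N. pCons 0 (t u (Suc i)) - t u i + smult (coeff h i) (u (N - 1)) = smult (w i) f"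
    if u: "u \<in> affine_solutions (R_fin h) f e" for u
  proof -
    have "\<forall>i. \<exists>w. i < N \<longrightarrow> pCons 0 (t u (Suc i)) - t u i + smult (coeff h i) (u (N - 1)) = smult w f"
      using u row unfolding affine_solutions_def dims by fastforce
    then show ?thesis by metis
  qed
  have "(\<lambda>u. u (N - 1)) ` affine_solutions (R_fin h) f e = quotient_space h f e"
  proof (intro equalityI subsetI)
    fix r assume "r \<in> (\<lambda>u. u (N - 1)) ` affine_solutions (R_fin h) f e"
    then obtain u where u: "u \<in> affine_solutions (R_fin h) f e" "r = u (N - 1)" by blast
    obtain w where "\<forall>i<N. pCons 0 (t u (Suc i)) - t u i + smult (coeff h i) (u (N - 1)) = smult (w i) f"
      using rows[OF u(1)] ..
    then have "h * r = f * (\<Sum>i<N. monom (w i) i)" using total[of u w] u(2) by blast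
    moreover have "(\<Sum>i<N. monom (w i) i) \<in> polys_below N"
      by (auto simp: polys_below_def coeff_sum)
    moreover have "r \<in> polys_below (Suc e)" using u by (simp add: affine_solutions_def)
    ultimately show "r \<in> quotient_space h f e" unfolding quotient_space_def N_def by blast
  next
    fix r assume "r \<in> quotient_space h f e"
    then obtain \<omega> where r: "r \<in> polys_below (Suc e)" "\<omega> \<in> polys_below N" "h * r = f * \<omega>"
      unfolding quotient_space_def N_def by blast
    \<comment> \<open>The rows solved from the bottom as in Horner's scheme: \<open>s N = r\<close>
      because \<open>h\<close> is monic, and \<open>s 0 = 0\<close> is the equation
      \<open>h r = f \<omega>\<close>.\<close>
    define s where "s i = r * poly_shift i h - f * poly_shift i \<omega>" for i
    have s0: "s 0 = 0" using r(3) by (simp add: s_def mult.commute)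
    have sh: "poly_shift N h = 1"
    proof (intro poly_eqI)
      fix k show "coeff (poly_shift N h) k = coeff 1 k"
        using h(1) by (cases k) (auto simp: coeff_poly_shift N_def coeff_eq_0)
    qed
    have so: "poly_shift N \<omega> = 0" using r(2) by (intro poly_eqI) (simp add: coeff_poly_shift polys_below_def)
    have sN: "s N = r" by (simp add: s_def sh so)
    have srec: "pCons 0 (s (Suc i)) - s i + smult (coeff h i) r = smult (coeff \<omega> i) f" for i
      unfolding s_def poly_shift_Suc[of i h] poly_shift_Suc[of i \<omega>] by (simp add: algebra_simps)
    have sdeg: "s (Suc i) \<in> polys_below (Suc e)" for i
    proof -
      \<comment> \<open>The definition hides the degree bound. By \<open>h r = f \<omega>\<close>
        the high parts cancel, and \<open>x^(i+1) s (i+1)\<close> is a combination of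
        \<open>f\<close> and \<open>r\<close> with coefficients of degree at most
        \<open>i\<close>.\<close>
      have "monom 1 (Suc i) * s (Suc i)
          = r * (monom 1 (Suc i) * poly_shift (Suc i) h) - f * (monom 1 (Suc i) * poly_shift (Suc i) \<omega>)"
        by (simp add: s_def algebra_simps)
      also have "monom 1 (Suc i) * poly_shift (Suc i) h = h - poly_cutoff (Suc i) h"
        using cutoff_shift[of h "Suc i"] by (simp add: algebra_simps)
      also have "monom 1 (Suc i) * poly_shift (Suc i) \<omega> = \<omega> - poly_cutoff (Suc i) \<omega>"
        using cutoff_shift[of \<omega> "Suc i"] by (simp add: algebra_simps)
      finally have eq: "monom 1 (Suc i) * s (Suc i) = f * poly_cutoff (Suc i) \<omega> - r * poly_cutoff (Suc i) h"
        using r(3) by (simp add: algebra_simps)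
      have cut: "degree (poly_cutoff (Suc i) p) \<le> i" for p :: "'a poly"
        by (rule degree_le) (auto simp: coeff_poly_cutoff)
      have "degree (f * poly_cutoff (Suc i) \<omega>) \<le> Suc e + i"
        using degree_mult_le[of f "poly_cutoff (Suc i) \<omega>"] f cut[of \<omega>] by linarith
      moreover have "degree (r * poly_cutoff (Suc i) h) \<le> Suc e + i"
        using degree_mult_le[of r "poly_cutoff (Suc i) h"] r(1) cut[of h] unfolding polys_below_Suc by linarith
      ultimately have d: "degree (monom 1 (Suc i) * s (Suc i)) \<le> Suc e + i" unfolding eq by (rule degree_diff_le)
      have "coeff (s (Suc i)) k = 0" if "k \<ge> Suc e" for k
      proof -
        have "coeff (s (Suc i)) k = coeff (monom 1 (Suc i) * s (Suc i)) (k + Suc i)"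
          unfolding coeff_monom_mult by simp
        also have "\<dots> = 0" using d that by (intro coeff_eq_0) linarith
        finally show ?thesis .
      qed
      then show ?thesis by (simp add: polys_below_def)
    qed
    define u where "u j = (if j < N then s (Suc j) else 0)" for j
    have uN: "u (N - 1) = r" using N sN by (simp add: u_def)
    have tu: "t u i = s i" if "i \<le> N" for i using that s0 by (auto simp: t_def u_def)
    have "u \<in> affine_solutions (R_fin h) f e"
      unfolding affine_solutions_def dims
    proof (intro CollectI conjI allI impI)
      fix i assume "i < N"
      then show "\<exists>w. (\<Sum>j<N. [:- snd (R_fin h) $$ (i,j), fst (R_fin h) $$ (i,j):] * u j) = smult w f"
        unfolding row[OF \<open>i < N\<close>] uN using srec[of i] tu[of i] tu[of "Suc i"]
        by (intro exI[of _ "coeff \<omega> i"]) simp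
    qed (use sdeg in \<open>auto simp: u_def\<close>)
    then show "r \<in> (\<lambda>u. u (N - 1)) ` affine_solutions (R_fin h) f e" using uN by blast
  qed
  moreover have "u = 0" if u: "u \<in> affine_solutions (R_fin h) f e" and z: "u (N - 1) = 0" for u
  proof -
    obtain w where w: "\<forall>i<N. pCons 0 (t u (Suc i)) - t u i + smult (coeff h i) (u (N - 1)) = smult (w i) f"
      using rows[OF u] ..
    then have "f * (\<Sum>i<N. monom (w i) i) = h * u (N - 1)" using total[of u w] by simp
    then have zero: "f * (\<Sum>i<N. monom (w i) i) = 0" unfolding z by simp
    have step: "pCons 0 (t u (Suc i)) = t u i" if "i < N" for i
    proof -
      have "pCons 0 (t u (Suc i)) - t u i = smult (w i) f" using w that unfolding z by simp
      also have "\<dots> = 0" by (rule monom_sum_zero[OF zero that])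
      finally show ?thesis by simp
    qed
    have "t u (Suc i) = 0" if "i < N" for i
      using that
    proof (induction i)
      case 0
      then show ?case using step[of 0] by (simp add: t_def)
    next
      case (Suc i)
      then show ?case using step[of "Suc i"] by simp
    qed
    then have "u j = 0" if "j < N" for j using that by (simp add: t_def)
    moreover have "u j = 0" if "j \<ge> N" for j using u that unfolding affine_solutions_def dims by blast
    ultimately show ?thesis by (metis not_le zero_fun_apply ext)
  qed
  ultimately show ?thesis using has_dim_pullback[OF affine_solutions_subspace] dim by metis
qed

section \<open>Solution spaces of the blocks \<open>R_minus\<close>\<close>

lemma R_minus_row:
  assumes "i < m"
  shows "(\<Sum>j<Suc m. [:- snd (R_minus (Suc m)) $$ (i,j), fst (R_minus (Suc m)) $$ (i,j):] * u j)
    = pCons 0 (u i) - (u (Suc i) :: 'a::field poly)"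
proof -
  have "(\<Sum>j<Suc m. [:- snd (R_minus (Suc m)) $$ (i,j), fst (R_minus (Suc m)) $$ (i,j):] * u j)
      = (\<Sum>j<Suc m. (if j = i then pCons 0 (u i) else 0) - (if j = Suc i then u (Suc i) else 0))"
    using assms by (intro sum.cong refl) (auto simp: R_minus_def)
  also have "\<dots> = pCons 0 (u i) - u (Suc i)"
    using assms unfolding sum_subtractf by (simp add: sum.delta del: sum.lessThan_Suc)
  finally show ?thesis .
qed

lemma R_minus_transpose_row:
  assumes "i < Suc m"
  shows "(\<Sum>j<m. [:- snd (R_minus (Suc m)) $$ (j,i), fst (R_minus (Suc m)) $$ (j,i):] * u j)
    = (if i < m then pCons 0 (u i) else 0) - (if i = 0 then 0 else (u (i - 1) :: 'a::field poly))"
proof -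
  have "(\<Sum>j<m. [:- snd (R_minus (Suc m)) $$ (j,i), fst (R_minus (Suc m)) $$ (j,i):] * u j)
      = (\<Sum>j<m. (if j = i then pCons 0 (u i) else 0) - (if Suc j = i then u j else 0))"
    using assms by (intro sum.cong refl) (auto simp: R_minus_def)
  also have "\<dots> = (if i < m then pCons 0 (u i) else 0) - (\<Sum>j<m. if Suc j = i then u j else 0)"
    unfolding sum_subtractf by (simp add: sum.delta)
  also have "(\<Sum>j<m. if Suc j = i then u j else 0) = (if i = 0 then 0 else u (i - 1))"
  proof (cases i)
    case (Suc k)
    then show ?thesis using assms by (intro sum_pick[of k, THEN trans]) auto
  qed simp
  finally show ?thesis .
qed

lemma R_minus_dims: "dim_row (fst (R_minus (Suc m))) = m" "dim_col (fst (R_minus (Suc m))) = Suc m"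
  "dim_row (snd (R_minus (Suc m))) = m" "dim_col (snd (R_minus (Suc m))) = Suc m"
  by (auto simp: R_minus_def)

text \<open>There is one more equation than there are unknowns. The weighted sum of all rows
  telescopes to zero, as both ends of the chain are zero. Hence all right-hand sides vanish and the
  rows kill the components one by one.\<close>

lemma R_minus_transpose_solutions:
  fixes f :: "'a::field poly"
  shows "W1.has_dim (affine_solutions (transpose_mat (fst (R_minus (Suc m))), transpose_mat (snd (R_minus (Suc m)))) f e) 0"
proof -
  let ?T = "(transpose_mat (fst (R_minus (Suc m))), transpose_mat (snd (R_minus (Suc m)))) :: 'a mpair"
  have dims: "dim_row (fst ?T) = Suc m" "dim_col (fst ?T) = m" by (simp_all add: R_minus_dims)
  have "u = 0" if u: "u \<in> affine_solutions ?T f e" for u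
  proof -
    have u0: "u j = 0" if "j \<ge> m" for j using u that by (simp add: affine_solutions_def R_minus_dims)
    define t where "t i = (if i = 0 then 0 else u (i - 1))" for i
    have "\<exists>w. pCons 0 (t (Suc i)) - t i = smult w f" if i: "i < Suc m" for i
    proof -
      obtain w where "(\<Sum>j<m. [:- snd ?T $$ (i,j), fst ?T $$ (i,j):] * u j) = smult w f"
        using u i unfolding affine_solutions_def dims by blast
      moreover have "(\<Sum>j<m. [:- snd ?T $$ (i,j), fst ?T $$ (i,j):] * u j)
          = (\<Sum>j<m. [:- snd (R_minus (Suc m)) $$ (j,i), fst (R_minus (Suc m)) $$ (j,i):] * u j)"
        using i by (intro sum.cong) (auto simp: R_minus_dims)
      ultimately have "(if i < m then pCons 0 (u i) else 0) - (if i = 0 then 0 else u (i - 1)) = smult w f"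
        unfolding R_minus_transpose_row[OF i] by simp
      then show ?thesis using u0[of i] i by (intro exI[of _ w]) (auto simp: t_def split: if_splits)
    qed
    then have "\<forall>i. \<exists>w. i < Suc m \<longrightarrow> pCons 0 (t (Suc i)) - t i = smult w f" by blast
    from choice[OF this] obtain w where w: "\<forall>i. i < Suc m \<longrightarrow> pCons 0 (t (Suc i)) - t i = smult (w i) f" ..
    have "(\<Sum>i<Suc m. monom 1 i * (pCons 0 (t (Suc i)) - t i)) = 0"
      unfolding telescope using u0[of m] by (simp add: t_def)
    moreover have "(\<Sum>i<Suc m. monom 1 i * (pCons 0 (t (Suc i)) - t i)) = f * (\<Sum>i<Suc m. monom (w i) i)"
      unfolding sum_distrib_left
      by (intro sum.cong refl) (use w in \<open>simp only: lessThan_iff monom_mult_smult mult.commute\<close>)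
    ultimately have zero: "f * (\<Sum>i<Suc m. monom (w i) i) = 0" by simp
    have step: "pCons 0 (t (Suc i)) = t i" if "i < Suc m" for i
    proof -
      have "pCons 0 (t (Suc i)) - t i = smult (w i) f" using w that by blast
      also have "\<dots> = 0" by (rule monom_sum_zero[OF zero that])
      finally show ?thesis by simp
    qed
    have "t i = 0" if "i \<le> Suc m" for i
      using that
    proof (induction i)
      case (Suc i)
      then show ?case using step[of i] by simp
    qed (simp add: t_def)
    from this[of "Suc _"] have "u j = 0" for j using u0[of j] by (cases "j < m") (auto simp: t_def)
    then show ?thesis by (simp add: fun_eq_iff)
  qed
  moreover have "0 \<in> affine_solutions ?T f e" by (rule W1.subspace_0[OF affine_solutions_subspace])
  ultimately have "affine_solutions ?T f e = {0}" by blast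
  then show ?thesis using W1.has_dim_zero by simp
qed

lemma R_minus_solutions_iff:
  "u \<in> affine_solutions (R_minus (Suc m)) f e \<longleftrightarrow> (\<forall>j\<ge>Suc m. u j = 0) \<and>
    (\<forall>j. u j \<in> polys_below (Suc e)) \<and> (\<forall>i<m. \<exists>w. pCons 0 (u i) - u (Suc i) = smult w f)"
  unfolding affine_solutions_def R_minus_dims using R_minus_row[of _ m u] by (simp del: sum.lessThan_Suc mult_pCons_left)

text \<open>A solution is \<open>u i = x^i u 0\<close>. The degree bound on \<open>u m\<close>
  leaves \<open>e + 1 - m\<close> coefficients for \<open>u 0\<close>, and none once the subtraction
  is truncated.\<close>

lemma R_minus_solutions_zero:
  "W1.has_dim (affine_solutions (R_minus (Suc m)) 0 e :: (nat \<Rightarrow> 'a::field poly) set) (Suc e - m)"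
proof -
  interpret linear_map scale1 "smult :: 'a \<Rightarrow> _" "\<lambda>u. u 0"
    by unfold_locales (auto simp: scale1_def)
  let ?S = "affine_solutions (R_minus (Suc m)) 0 e :: (nat \<Rightarrow> 'a poly) set"
  have pow: "u i = monom 1 i * u 0" if u: "u \<in> ?S" and "i \<le> m" for u i
    using that(2)
  proof (induction i)
    case (Suc i)
    have "pCons 0 (u i) = u (Suc i)" using u Suc.prems unfolding R_minus_solutions_iff by simp
    then show ?case using Suc by (simp add: monom_Suc)
  qed simp
  have "(\<lambda>u. u 0) ` ?S = polys_below (Suc e - m)"
  proof (intro equalityI subsetI)
    fix g assume "g \<in> (\<lambda>u. u 0) ` ?S"
    then obtain u where u: "u \<in> ?S" "g = u 0" by blast
    show "g \<in> polys_below (Suc e - m)" unfolding polys_below_def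
    proof (intro CollectI allI impI)
      fix k assume k: "Suc e - m \<le> k"
      have "coeff g k = coeff (monom 1 m * g) (k + m)" unfolding coeff_monom_mult by simp
      also have "\<dots> = coeff (u m) (k + m)" using pow[OF u(1), of m] u(2) by simp
      also have "\<dots> = 0" using u(1) k unfolding R_minus_solutions_iff polys_below_def by auto
      finally show "coeff g k = 0" .
    qed
  next
    fix g :: "'a poly" assume g: "g \<in> polys_below (Suc e - m)"
    define u where "u j = (if j \<le> m then monom 1 j * g else 0)" for j
    have "u \<in> ?S"
      unfolding R_minus_solutions_iff
      using g by (auto simp: u_def monom_Suc polys_below_def coeff_monom_mult)
    moreover have "u 0 = g" by (simp add: u_def)
    ultimately show "g \<in> (\<lambda>u. u 0) ` ?S" by blast
  qed
  moreover have "u = 0" if "u \<in> ?S" "u 0 = 0" for u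
  proof
    fix j show "u j = 0 j" using pow[OF that(1), of j] that unfolding R_minus_solutions_iff by (cases "j \<le> m") auto
  qed
  ultimately show ?thesis
    using has_dim_pullback[OF affine_solutions_subspace] polys_below_dim by metis
qed

text \<open>The free constant of each row makes \<open>u (i + 1)\<close> the remainder of
  \<open>x u i\<close> modulo \<open>f\<close>. The first component is therefore arbitrary and
  determines the rest, whatever \<open>m\<close> is.\<close>

lemma R_minus_solutions_monic:
  fixes f :: "'a::field poly"
  assumes f: "degree f = Suc e" "lead_coeff f = 1"
  shows "W1.has_dim (affine_solutions (R_minus (Suc m)) f e) (Suc e)"
proof -
  interpret linear_map scale1 "smult :: 'a \<Rightarrow> _" "\<lambda>u. u 0"
    by unfold_locales (auto simp: scale1_def)
  let ?S = "affine_solutions (R_minus (Suc m)) f e"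
  have "(\<lambda>u. u 0) ` ?S = polys_below (Suc e)"
  proof (intro equalityI subsetI)
    fix g assume "g \<in> (\<lambda>u. u 0) ` ?S"
    then obtain u where "u \<in> ?S" "g = u 0" by blast
    then show "g \<in> polys_below (Suc e)" unfolding R_minus_solutions_iff by simp
  next
    fix g :: "'a poly" assume g: "g \<in> polys_below (Suc e)"
    define U where "U = rec_nat g (\<lambda>_ v. pCons 0 v - smult (coeff v e) f)"
    have U: "U 0 = g" "U (Suc i) = pCons 0 (U i) - smult (coeff (U i) e) f" for i by (auto simp: U_def)
    have Ub: "U i \<in> polys_below (Suc e)" for i
    proof (induction i)
      case (Suc i)
      have "coeff (U (Suc i)) k = 0" if k: "k \<ge> Suc e" for k
      proof (cases "k = Suc e")
        case True
        then show ?thesis using f by (simp add: U(2))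
      next
        case False
        then obtain l where "k = Suc l" "l \<ge> Suc e" using k by (cases k) auto
        then show ?thesis using Suc f by (simp add: U(2) polys_below_def coeff_eq_0)
      qed
      then show ?case by (simp add: polys_below_def)
    qed (simp add: U(1) g)
    define u where "u j = (if j \<le> m then U j else 0)" for j
    have "\<exists>w. pCons 0 (u i) - u (Suc i) = smult w f" if "i < m" for i
      using that by (intro exI[of _ "coeff (U i) e"]) (simp add: u_def U(2))
    then have "u \<in> ?S" unfolding R_minus_solutions_iff using Ub by (auto simp: u_def)
    moreover have "u 0 = g" by (simp add: u_def U(1))
    ultimately show "g \<in> (\<lambda>u. u 0) ` ?S" by blast
  qed
  moreover have "u = 0" if u: "u \<in> ?S" "u 0 = 0" for u
  proof -
    have "u i = 0" if "i \<le> m" for i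
      using that
    proof (induction i)
      case (Suc i)
      then obtain w where "pCons 0 (u i) - u (Suc i) = smult w f"
        using u(1) unfolding R_minus_solutions_iff by (meson Suc_le_lessD)
      then have w: "u (Suc i) = smult (- w) f" using Suc by (simp add: minus_equation_iff)
      have "coeff (u (Suc i)) (Suc e) = 0" using u(1) unfolding R_minus_solutions_iff polys_below_def by blast
      then have "w = 0" using f by (simp add: w)
      then show ?case using w by simp
    qed (rule u(2))
    moreover have "u i = 0" if "\<not> i \<le> m" for i using u(1) that unfolding R_minus_solutions_iff by simp
    ultimately have "u i = 0" for i by blast
    then show ?thesis by (simp add: fun_eq_iff)
  qed
  ultimately show ?thesis
    using has_dim_pullback[OF affine_solutions_subspace] polys_below_dim by metis
qed

text \<open>The case of a power of \<open>x2\<close>, which becomes 1 at \<open>x2 = 1\<close>.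
  Remainders modulo \<open>f\<close> are replaced by quotients by \<open>x\<close>: the last
  component is arbitrary, and each other component is the quotient of the next one.\<close>

lemma R_minus_solutions_one:
  "W1.has_dim (affine_solutions (R_minus (Suc m)) 1 e :: (nat \<Rightarrow> 'a::field poly) set) (Suc e)"
proof -
  interpret linear_map scale1 "smult :: 'a \<Rightarrow> _" "\<lambda>u. u m"
    by unfold_locales (auto simp: scale1_def)
  let ?S = "affine_solutions (R_minus (Suc m)) 1 e :: (nat \<Rightarrow> 'a poly) set"
  have "(\<lambda>u. u m) ` ?S = polys_below (Suc e)"
  proof (intro equalityI subsetI)
    fix g assume "g \<in> (\<lambda>u. u m) ` ?S"
    then obtain u where "u \<in> ?S" "g = u m" by blast
    then show "g \<in> polys_below (Suc e)" unfolding R_minus_solutions_iff by simp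
  next
    fix g :: "'a poly" assume g: "g \<in> polys_below (Suc e)"
    define u where "u j = (if j \<le> m then poly_shift (m - j) g else 0)" for j
    have "\<exists>w. pCons 0 (u i) - u (Suc i) = smult w 1" if "i < m" for i
    proof -
      have "m - i = Suc (m - Suc i)" using that by simp
      then show ?thesis using that poly_shift_Suc[of "m - Suc i" g]
        by (intro exI[of _ "- coeff g (m - Suc i)"]) (simp add: u_def one_pCons)
    qed
    then have "u \<in> ?S" unfolding R_minus_solutions_iff
      using g by (auto simp: u_def polys_below_def coeff_poly_shift)
    moreover have "u m = g" by (auto simp: u_def poly_eq_iff coeff_poly_shift)
    ultimately show "g \<in> (\<lambda>u. u m) ` ?S" by blast
  qed
  moreover have "u = 0" if u: "u \<in> ?S" "u m = 0" for u
  proof -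
    have "u (m - k) = 0" if "k \<le> m" for k
      using that
    proof (induction k)
      case (Suc k)
      then have i: "m - Suc k < m" "Suc (m - Suc k) = m - k" by auto
      then obtain w where "pCons 0 (u (m - Suc k)) - u (m - k) = smult w 1"
        using u(1) unfolding R_minus_solutions_iff by metis
      then have "pCons 0 (u (m - Suc k)) = [:w:]" using Suc by (simp add: one_pCons)
      then show ?case by simp
    qed (simp add: u(2))
    then have "u i = 0" if "i \<le> m" for i using that by (metis diff_diff_cancel diff_le_self)
    moreover have "u i = 0" if "\<not> i \<le> m" for i using u(1) that unfolding R_minus_solutions_iff by simp
    ultimately have "u i = 0" for i by blast
    then show ?thesis by (simp add: fun_eq_iff)
  qed
  ultimately show ?thesis
    using has_dim_pullback[OF affine_solutions_subspace] polys_below_dim by metis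
qed

lemma sol_dim_R_minus:
  assumes f: "homog (Suc e) f" and dim: "W1.has_dim (affine_solutions (R_minus (Suc m)) (dehom f) e) n"
  shows "sol_dim (plus_pair (R_minus (Suc m))) f e n"
proof -
  have "sol_dim (plus_pair (R_minus (Suc m))) f e (0 + n)"
  proof (rule sol_dim_plus[of _ m "Suc m"])
    show "sol_dim (transpose_mat (fst (R_minus (Suc m))), transpose_mat (snd (R_minus (Suc m)))) f e 0"
      by (rule sol_dim_affine[OF f R_minus_transpose_solutions])
    show "sol_dim (R_minus (Suc m)) f e n" by (rule sol_dim_affine[OF f dim])
  qed (auto simp: R_minus_def)
  then show ?thesis by simp
qed

text \<open>The Hankel matrix \<open>Y\<close> of the coefficients of \<open>h\<close> intertwines the companion matrix of \<open>h\<close> with its transpose;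
  reversing its rows makes it unitriangular, hence it is invertible.\<close>

lemma sol_dim_companion_transpose:
  fixes h :: "'a::field poly"
  assumes h: "lead_coeff h = 1" "degree h > 0" and dim: "sol_dim (R_fin h) f e n"
  shows "sol_dim (transpose_mat (fst (R_fin h)), transpose_mat (snd (R_fin h))) f e n"
proof -
  define N where "N = degree h"
  have N: "N > 0" using h by (simp add: N_def)
  define F where "F = companion h"
  have Fc: "F \<in> carrier_mat N N" by (simp add: F_def companion_def N_def Let_def)
  define Y where "Y = mat N N (\<lambda>(i,j). coeff h (Suc (i + j)))"
  have Yc: "Y \<in> carrier_mat N N" by (simp add: Y_def)
  have Yt: "transpose_mat Y = Y" by (rule eq_matI) (auto simp: Y_def add.commute)
  have FY: "(F * Y) $$ (i,k) = (if i = 0 \<and> k = 0 then - coeff h 0 else if i = 0 \<or> k = 0 then 0 else coeff h (i + k))"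
    if i: "i < N" and k: "k < N" for i k
  proof -
    have "(F * Y) $$ (i,k) = (\<Sum>j<N. F $$ (i,j) * Y $$ (j,k))"
      using Fc Yc i k by (simp add: scalar_prod_def lessThan_atLeast0)
    also have "\<dots> = (\<Sum>j<N. (if j = N - 1 then - coeff h i * coeff h (N + k) else 0)
        + (if Suc j = i then coeff h (i + k) else 0))"
      using i k N by (intro sum.cong) (auto simp: F_def companion_def N_def[symmetric] Let_def Y_def)
    also have "\<dots> = - coeff h i * coeff h (N + k) + (\<Sum>j<N. if Suc j = i then coeff h (i + k) else 0)"
      using N by (simp add: sum.distrib)
    also have "(\<Sum>j<N. if Suc j = i then coeff h (i + k) else 0) = (if i = 0 then 0 else coeff h (i + k))"
    proof (cases i)
      case (Suc l)
      then show ?thesis using i by (intro sum_pick[of l, THEN trans]) auto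
    qed simp
    finally show ?thesis using h by (auto simp: N_def coeff_eq_0)
  qed
  \<comment> \<open>By \<open>FY\<close> the product is symmetric, its first row and column being
    zero outside the corner. As \<open>Y\<close> is symmetric too, transposition yields
    \<open>inter\<close>.\<close>
  have sym: "transpose_mat (F * Y) = F * Y"
    by (rule eq_matI) (use Fc Yc in \<open>auto simp: FY add.commute simp del: index_mult_mat(1)\<close>)
  have inter: "F * Y = Y * transpose_mat F"
    using transpose_mult[OF Fc Yc] sym Yt by simp
  define Y' where "Y' = mat N N (\<lambda>(i,j). coeff h (Suc (N - Suc i + j)))"
  have Y'c: "Y' \<in> carrier_mat N N" by (simp add: Y'_def)
  have "det Y' = prod_list (diag_mat Y')"
    by (rule det_lower_triangular[OF _ Y'c]) (auto simp: Y'_def N_def intro!: coeff_eq_0)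
  also have "diag_mat Y' = map (\<lambda>i. 1) [0..<N]"
    unfolding diag_mat_def using h by (auto simp: Y'_def N_def Suc_diff_Suc)
  finally have "det Y' \<noteq> 0" by auto
  from det_non_zero_imp_unit[OF Y'c this, of undefined]
  obtain Z where Z: "Z \<in> carrier_mat N N" "Z * Y' = 1\<^sub>m N"
    by (auto simp: Units_def ring_mat_def)
  \<comment> \<open>An inverse of the row-reversed matrix becomes an inverse of \<open>Y\<close>
    when its columns are reversed.\<close>
  define Z' where "Z' = mat N N (\<lambda>(i,j). Z $$ (i, N - Suc j))"
  have Z'c: "Z' \<in> carrier_mat N N" by (simp add: Z'_def)
  have Z'Y: "Z' * Y = 1\<^sub>m N"
  proof (rule eq_matI)
    fix i k assume "i < dim_row (1\<^sub>m N)" "k < dim_col (1\<^sub>m N)"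
    then have ik: "i < N" "k < N" by auto
    have "(Z' * Y) $$ (i,k) = (\<Sum>j<N. Z $$ (i, N - Suc j) * coeff h (Suc (j + k)))"
      using ik by (simp add: Z'_def Y_def scalar_prod_def lessThan_atLeast0)
    also have "\<dots> = (\<Sum>j<N. Z $$ (i, N - Suc (N - Suc j)) * coeff h (Suc (N - Suc j + k)))"
      by (rule sum.nat_diff_reindex[symmetric])
    also have "\<dots> = (Z * Y') $$ (i,k)"
      using ik Z(1) Y'c by (auto simp: Y'_def scalar_prod_def lessThan_atLeast0 intro!: sum.cong)
    finally show "(Z' * Y) $$ (i,k) = 1\<^sub>m N $$ (i,k)" unfolding Z(2) .
  qed (use Z'c Yc in auto)
  have YZ': "Y * Z' = 1\<^sub>m N" by (rule mat_mult_left_right_inverse[OF Z'c Yc Z'Y])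
  have Ft: "transpose_mat F \<in> carrier_mat N N" using Fc by simp
  have "transpose_mat F * Z' = 1\<^sub>m N * (transpose_mat F * Z')" using Ft Z'c by simp
  also have "\<dots> = Z' * Y * (transpose_mat F * Z')" unfolding Z'Y ..
  also have "\<dots> = Z' * (Y * transpose_mat F * Z')"
    using Z'c Yc Ft by (simp add: assoc_mult_mat[of _ N N _ N _ N])
  also have "\<dots> = Z' * (F * (Y * Z'))"
    unfolding inter[symmetric] using Z'c Yc Fc by (simp add: assoc_mult_mat[of _ N N _ N _ N])
  also have "\<dots> = Z' * F" unfolding YZ' using Fc by simp
  finally have inter': "transpose_mat F * Z' = Z' * F" .
  show ?thesis
    by (rule sol_dim_equivalent[OF _ _ _ _ Z'c Z'c Yc Yc Z'Y YZ' _ _ _ _ dim])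
      (use Fc Yc Z'c inter inter' in \<open>auto simp: R_fin_def F_def[symmetric] N_def[symmetric]\<close>)
qed

lemma sol_dim_R_fin:
  assumes h: "lead_coeff h = 1" "degree h > 0" and f: "homog (Suc e) f"
    and dim: "W0.has_dim (quotient_space h (dehom f) e) n"
  shows "sol_dim (plus_pair (R_fin h)) f e (2 * n)"
proof -
  have "sol_dim (R_fin h) f e n"
    by (rule sol_dim_affine[OF f]) (rule finite_block_solutions[OF h degree_dehom[OF f] dim])
  moreover from this have "sol_dim (transpose_mat (fst (R_fin h)), transpose_mat (snd (R_fin h))) f e n"
    by (rule sol_dim_companion_transpose[OF h])
  ultimately have "sol_dim (plus_pair (R_fin h)) f e (n + n)"
    by (intro sol_dim_plus[of _ "degree h" "degree h"]) (auto simp: R_fin_def companion_def Let_def)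
  then show ?thesis by (simp add: mult_2)
qed

lemma quotient_space_zero:
  assumes "h \<noteq> 0"
  shows "W0.has_dim (quotient_space h 0 e) 0"
proof -
  have "quotient_space h 0 e = {0}" using assms by (auto simp: quotient_space_def intro!: exI[of _ 0])
  then show ?thesis using W0.has_dim_zero by simp
qed

text \<open>Coprimality to \<open>f\<close> forces \<open>q^d\<close> to divide
  \<open>\<omega>\<close>, whose degree is too small for that unless it is zero.\<close>

lemma quotient_space_coprime:
  fixes q f :: "'a::field poly"
  assumes q: "irreducible q" "\<not> q dvd f"
  shows "W0.has_dim (quotient_space (q ^ d) f e) 0"
proof -
  obtain a b where ab: "a * q + b * f = 1" using irreducible_poly_bezout[OF q] .
  have step: "q dvd v" if "q dvd f * v" for v
  proof -
    have "v = (a * q + b * f) * v" using ab by simp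
    also have "\<dots> = q * (a * v) + b * (f * v)" by (simp add: algebra_simps)
    finally show ?thesis using that by (metis dvd_add dvd_mult dvd_triv_left)
  qed
  have power: "q ^ d dvd v" if "q ^ d dvd f * v" for v
    using that
  proof (induction d)
    case (Suc d)
    have "q ^ d dvd f * v" using Suc.prems by (meson dvd_trans le_imp_power_dvd lessI less_imp_le)
    then obtain s where s: "v = q ^ d * s" using Suc.IH by (auto elim: dvdE)
    have "q ^ d * q dvd q ^ d * (f * s)" using Suc.prems s by (simp add: mult_ac)
    moreover have "q \<noteq> 0" using q(1) by auto
    ultimately have "q dvd f * s" by simp
    then have "q dvd s" by (rule step)
    then show ?case unfolding s by (simp add: mult.commute mult_dvd_mono)
  qed simp
  have "r = 0" if r: "r \<in> quotient_space (q ^ d) f e" for r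
  proof -
    obtain \<omega> where \<omega>: "\<omega> \<in> polys_below (degree (q ^ d))" "q ^ d * r = f * \<omega>"
      using r unfolding quotient_space_def by blast
    then have "q ^ d dvd f * \<omega>" by (metis dvd_triv_left)
    then have "q ^ d dvd \<omega>" by (rule power)
    then have "\<omega> = 0" using \<omega>(1) dvd_imp_degree_le[of "q ^ d" \<omega>] unfolding polys_below_iff
      by (cases "\<omega> = 0") auto
    then show ?thesis using \<omega>(2) q(1) by auto
  qed
  moreover have "0 \<in> quotient_space (q ^ d) f e" by (auto simp: quotient_space_def intro!: bexI[of _ 0])
  ultimately have "quotient_space (q ^ d) f e = {0}" by blast
  then show ?thesis using W0.has_dim_zero by simp
qed

text \<open>Cancel the smaller power of \<open>q\<close>. For \<open>d \<le> j\<close> the equation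
  reads \<open>r = q^(j-d) \<omega>\<close> with \<open>\<omega>\<close> free of degree below
  \<open>d\<close> times that of \<open>q\<close>; for \<open>d > j\<close> it determines
  \<open>\<omega>\<close>, and \<open>r\<close> is free of degree below \<open>j\<close> times that
  of \<open>q\<close>.\<close>

lemma quotient_space_power:
  fixes q :: "'a::field poly"
  assumes q: "q \<noteq> 0" and e: "Suc e = j * degree q"
  shows "W0.has_dim (quotient_space (q ^ d) (q ^ j) e) (min d j * degree q)"
proof (cases "d \<le> j")
  case True
  interpret linear_map "smult :: 'a \<Rightarrow> _" smult "\<lambda>v. q ^ (j - d) * v"
    by unfold_locales (auto simp: algebra_simps)
  have split: "q ^ j = q ^ d * q ^ (j - d)" using True by (simp flip: power_add)
  have "quotient_space (q ^ d) (q ^ j) e = (\<lambda>v. q ^ (j - d) * v) ` polys_below (d * degree q)"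
  proof (intro equalityI subsetI)
    fix r assume "r \<in> quotient_space (q ^ d) (q ^ j) e"
    then obtain \<omega> where \<omega>: "\<omega> \<in> polys_below (d * degree q)" "q ^ d * r = q ^ j * \<omega>"
      using q unfolding quotient_space_def by (auto simp: degree_power_eq)
    then have "r = q ^ (j - d) * \<omega>" using q unfolding split by (simp add: mult.assoc)
    then show "r \<in> (\<lambda>v. q ^ (j - d) * v) ` polys_below (d * degree q)" using \<omega>(1) by blast
  next
    fix r assume "r \<in> (\<lambda>v. q ^ (j - d) * v) ` polys_below (d * degree q)"
    then obtain \<omega> where \<omega>: "\<omega> \<in> polys_below (d * degree q)" "r = q ^ (j - d) * \<omega>" by blast
    have "r \<in> polys_below (Suc e)"
    proof (cases "\<omega> = 0")
      case False
      then have "degree r = (j - d) * degree q + degree \<omega>"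
        using q \<omega> by (simp add: degree_mult_eq degree_power_eq)
      moreover have "degree \<omega> < d * degree q" using False \<omega>(1) by (simp add: polys_below_iff)
      moreover have "(j - d) * degree q + d * degree q = j * degree q" using True by (simp flip: add_mult_distrib)
      ultimately show ?thesis unfolding polys_below_iff e by linarith
    qed (simp add: \<omega>)
    moreover have "q ^ d * r = q ^ j * \<omega>" using \<omega>(2) unfolding split by (simp add: mult.assoc)
    ultimately show "r \<in> quotient_space (q ^ d) (q ^ j) e"
      using \<omega>(1) q unfolding quotient_space_def by (auto simp: degree_power_eq)
  qed
  moreover have "W0.has_dim ((\<lambda>v. q ^ (j - d) * v) ` polys_below (d * degree q)) (d * degree q)"
    by (rule has_dim_image[OF polys_below_subspace polys_below_dim]) (use q in auto)
  ultimately show ?thesis using True by (simp add: min_def)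
next
  case False
  have split: "q ^ d = q ^ j * q ^ (d - j)" using False by (simp flip: power_add)
  have "quotient_space (q ^ d) (q ^ j) e = polys_below (Suc e)"
  proof (intro equalityI subsetI)
    fix r :: "'a poly" assume r: "r \<in> polys_below (Suc e)"
    have "q ^ (d - j) * r \<in> polys_below (degree (q ^ d))"
    proof (cases "r = 0")
      case False': False
      then have "degree (q ^ (d - j) * r) = (d - j) * degree q + degree r"
        using q by (simp add: degree_mult_eq degree_power_eq)
      moreover have "degree r < j * degree q" using False' r unfolding polys_below_iff e by simp
      moreover have "(d - j) * degree q + j * degree q = d * degree q" using False by (simp flip: add_mult_distrib)
      ultimately show ?thesis using q by (simp add: polys_below_iff degree_power_eq)
    qed simp
    moreover have "q ^ d * r = q ^ j * (q ^ (d - j) * r)" unfolding split by (simp add: mult.assoc)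
    ultimately show "r \<in> quotient_space (q ^ d) (q ^ j) e" using r unfolding quotient_space_def by blast
  qed (simp add: quotient_space_def)
  then show ?thesis using polys_below_dim[of "Suc e"] False e by (simp add: min_def)
qed

section \<open>Multiplicities of the blocks\<close>

definition x1 :: "'a::field poly poly" where
  "x1 = [:0, 1:]"

lemma dehom_x1' [simp]: "dehom x1 = [:0, 1:]"
  by (simp add: x1_def)

lemma homog_x1: "homog 1 x1"
  by (auto simp: homog_def x1_def coeff_pCons coeff_1 split: nat.splits)

lemma PP_x1: "(x1 :: 'a::field poly poly) \<in> PP" "(x1 :: 'a poly poly) \<noteq> var_x2"
proof -
  have h: "irreducible [:0, 1 :: 'a:]" "lead_coeff [:0, 1 :: 'a:] = 1"
    by (auto intro: irreducible_linear_field_poly)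
  have "homogenize 1 (dehom (x1 :: 'a poly poly)) = x1" by (rule homogenize_dehom[OF homog_x1])
  then have "homogenize (degree [:0, 1 :: 'a:]) [:0, 1 :: 'a:] = x1" by simp
  then show "(x1 :: 'a poly poly) \<in> PP" "(x1 :: 'a poly poly) \<noteq> var_x2"
    using PP_homogenize[OF h] by simp_all
qed

text \<open>The dimension of the solution space of the block \<open>p\<close> for \<open>f = g ^ j\<close>, where \<open>\<delta>\<close> is the degree of \<open>g\<close>.\<close>

definition block_dim :: "'a::field poly poly \<Rightarrow> nat \<Rightarrow> nat \<Rightarrow> 'a poly poly option \<times> nat \<Rightarrow> nat" where
  "block_dim g \<delta> j p = (case fst p of None \<Rightarrow> j * \<delta> | Some q \<Rightarrow> if q = g then 2 * (min (snd p) j * \<delta>) else 0)"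

lemma PP_degree_pos:
  assumes "g \<in> PP" "homog \<delta> g"
  shows "\<delta> > 0"
proof (cases "g = var_x2")
  case True
  have "\<delta> = 1"
    by (rule homog_unique[OF assms(2)]) (simp_all add: True homog_x2[simplified], simp add: var_x2_def)
  then show ?thesis by simp
next
  case False
  have "g \<noteq> 0" using PP_monic[OF assms(1) False] by auto
  then have "\<delta> = degree (dehom g)" using homog_unique[OF assms(2) PP_dehom(3)[OF assms(1) False]] by simp
  then show ?thesis using irreducible_poly_degree[OF PP_dehom(1)[OF assms(1) False]] by simp
qed

lemma monic_irreducible_dvd_eq:
  fixes p q :: "'a::field poly"
  assumes "irreducible p" "irreducible q" "lead_coeff p = 1" "lead_coeff q = 1" "q dvd p"
  shows "q = p"
proof -
  obtain k where k: "p = q * k" using assms(5) by auto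
  have "is_unit k" using irreducibleD[OF assms(1) k] assms(2) by (auto simp: irreducible_def)
  then obtain c where c: "k = [:c:]" using is_unit_poly_iff by blast
  have "lead_coeff p = lead_coeff q * c" unfolding k c by simp
  then have "c = 1" using assms(3,4) by simp
  then show ?thesis using k c by (simp add: pCons_one)
qed

lemma monic_power: "lead_coeff q = 1 \<Longrightarrow> lead_coeff (q ^ n) = (1 :: 'a::field)"
  by (simp only: lead_coeff_power power_one)

lemma sol_dim_finite_PP:
  assumes g: "g \<in> PP" "homog \<delta> g" and q: "q \<in> PP" "q \<noteq> var_x2" and d: "1 \<le> d" and j: "1 \<le> j"
  shows "sol_dim (R_gd (Some q) d) (g ^ j) (j * \<delta> - 1) (block_dim g \<delta> j (Some q, d))"
proof -
  \<comment> \<open>Chosen so that \<open>g ^ j\<close> has degree \<open>e + 1\<close>; since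
    \<open>\<delta>\<close> and \<open>j\<close> are positive, the subtraction is exact.\<close>
  define e where "e = j * \<delta> - 1"
  have e: "Suc e = j * \<delta>" using PP_degree_pos[OF g] j by (simp add: e_def)
  define h where "h = dehom q ^ d"
  note qd = PP_dehom[OF q]
  have "dehom q \<noteq> 0" using qd(1) by auto
  then have h: "lead_coeff h = 1" "degree h > 0"
    unfolding h_def using monic_power[OF qd(2)] irreducible_poly_degree[OF qd(1)] d
    by (simp_all add: degree_power_eq)
  have R: "R_gd (Some q) d = plus_pair (R_fin h)" using q(2) by (simp add: R_gd_def h_def dehom_def)
  have f: "homog (Suc e) (g ^ j)" unfolding e by (rule homog_power[OF g(2)])
  have "W0.has_dim (quotient_space h (dehom (g ^ j)) e) (if q = g then min d j * \<delta> else 0)"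
  proof (cases "q = g")
    case True
    have "g \<noteq> 0" using g(1) by (auto simp: PP_def)
    then have "\<delta> = degree (dehom g)" using homog_unique[OF g(2)] qd(3) True by blast
    then show ?thesis
      using quotient_space_power[of "dehom g" e j d] e qd(1) True by (auto simp: h_def dehom_power)
  next
    case False
    have "\<not> dehom q dvd dehom (g ^ j)"
    proof
      assume dvd: "dehom q dvd dehom (g ^ j)"
      show False
      proof (cases "g = var_x2")
        case True
        then have "is_unit (dehom q)" using dvd by (simp add: dehom_power)
        then show False using qd(1) by (simp add: irreducible_def)
      next
        case g2: False
        note gd = PP_dehom[OF g(1) g2]
        have "dehom q dvd dehom g"
          using dvd field_poly_irreducible_imp_prime[OF qd(1)] unfolding dehom_power
          by (rule prime_elem_dvd_power[rotated])
        then have "dehom q = dehom g" using monic_irreducible_dvd_eq gd qd by blast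
        then have "q = g" using gd(4) qd(4) by metis
        with False show False ..
      qed
    qed
    then show ?thesis using quotient_space_coprime[OF qd(1)] False by (simp add: h_def)
  qed
  from sol_dim_R_fin[OF h f this] show ?thesis unfolding R e_def[symmetric] block_dim_def by (auto split: if_splits)
qed

text \<open>Exchanging the two variables turns the blocks of \<open>x2\<close> into those of \<open>x1\<close>, which are covered by
  \<open>sol_dim_finite_PP\<close>.\<close>

lemma swap_matrix:
  "\<exists>S :: 'a::field mat. S \<in> carrier_mat 2 2 \<and> invertible_mat S \<and>
    (\<forall>d\<ge>1. R_gd (Some var_x2) d = pair_act_right (R_gd (Some x1) d) S) \<and>
    gl_star (twist S) var_x2 = x1 \<and> gl_star (twist S) x1 = var_x2 \<and> twist S * twist S = 1\<^sub>m 2"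
proof -
  define S :: "'a mat" where "S = mat 2 2 (\<lambda>(i,j). if i = j then 0 else 1)"
  have Sc: "S \<in> carrier_mat 2 2" by (simp add: S_def)
  have SS: "S * S = 1\<^sub>m 2"
  proof (rule eq_matI)
    fix i j assume "i < dim_row (1\<^sub>m 2)" "j < dim_col (1\<^sub>m 2)"
    then have ij: "i < 2" "j < 2" by auto
    then have "i = 0 \<or> i = 1" "j = 0 \<or> j = 1" by auto
    then show "(S * S) $$ (i,j) = 1\<^sub>m 2 $$ (i,j)" unfolding index_mult_2[OF Sc Sc ij] by (auto simp: S_def)
  qed (auto simp: S_def)
  have inv: "invertible_mat S" using SS Sc unfolding invertible_mat_def inverts_mat_def by auto
  have "R_gd (Some var_x2) d = pair_act_right (R_gd (Some x1) d) S" if "d \<ge> 1" for d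
  proof -
    have p: "[:0, 1 :: 'a:] ^ d = monom 1 d" by (simp add: monom_altdef)
    have 1: "R_gd (Some (x1 :: 'a poly poly)) d = plus_pair (R_fin (monom 1 d))"
      by (simp add: R_gd_def p dehom_def[symmetric] PP_x1(2))
    have dim: "plus_mat (companion (monom 1 d)) \<in> carrier_mat (d + d) (d + d)"
      "plus_mat (1\<^sub>m d) \<in> carrier_mat (d + d) (d + d)" for d
      by (auto simp: plus_mat_def companion_def Let_def degree_monom_eq)
    have "0 \<cdot>\<^sub>m X + 1 \<cdot>\<^sub>m Y = Y" "1 \<cdot>\<^sub>m X + 0 \<cdot>\<^sub>m Y = X"
      if "X \<in> carrier_mat k k" "Y \<in> carrier_mat k k" for X Y :: "'a mat" and k
      by (rule eq_matI; use that in auto)+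
    note comb = this[OF dim(2,1), of d]
    show ?thesis unfolding 1
      by (simp add: R_gd_def pair_act_right_def R_inf_def R_fin_def plus_pair_def S_def degree_monom_eq comb)
  qed
  \<comment> \<open>The signs come from \<open>twist\<close>; passing to \<open>gl_star\<close>
    removes them, since it works up to scalars.\<close>
  moreover have act: "gl_act (twist S) var_x2 = [:[:-1:]:] * x1" "gl_act (twist S) x1 = [:[:-1:]:] * var_x2"
    unfolding x1_def gl_act_x1 gl_act_x2 by (simp_all add: lin2_def twist_def S_def var_x2_def)
  have "gl_star (twist S) var_x2 = x1" by (rule gl_star_eqI[OF PP_x1(1) _ act(1)]) simp
  moreover have "gl_star (twist S) x1 = var_x2" by (rule gl_star_eqI[OF PP_x2 _ act(2)]) simp
  moreover have "twist S * twist S = 1\<^sub>m 2" unfolding twist_mult[OF Sc Sc] SS by (rule twist_one)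
  ultimately show ?thesis using Sc inv by blast
qed

lemma R_gd_square: "\<exists>n. sq_pair (R_gd g d) n"
proof (cases g)
  case None
  then show ?thesis
    by (intro exI[of _ "d - 1 + d"]) (auto simp: sq_pair_def R_gd_def plus_pair_def plus_mat_def R_minus_def)
next
  case (Some q)
  let ?f = "map_poly (\<lambda>c. poly c 1) q ^ d"
  show ?thesis
  proof (cases "q = var_x2")
    case True
    with Some show ?thesis
      by (intro exI[of _ "d + d"]) (auto simp: sq_pair_def R_gd_def plus_pair_def plus_mat_def R_inf_def
        companion_def Let_def degree_monom_eq)
  next
    case False
    with Some show ?thesis
      by (intro exI[of _ "degree ?f + degree ?f"])
        (auto simp: sq_pair_def R_gd_def plus_pair_def plus_mat_def R_fin_def companion_def Let_def)
  qed
qed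

text \<open>An epsilon block contributes \<open>j \<delta>\<close> whatever its index, the number of
  free coefficients of one component. For a block of \<open>x2\<close> the variables are exchanged,
  which turns it into a block of \<open>x1\<close> and \<open>g\<close> into
  \<open>g'\<close>.\<close>

lemma sol_dim_R_gd:
  assumes g: "g \<in> PP" "homog \<delta> g" and p: "p \<in> PPt \<times> {1..}" and j: "1 \<le> j"
  shows "sol_dim (R_gd (fst p) (snd p)) (g ^ j) (j * \<delta> - 1) (block_dim g \<delta> j p)"
proof -
  obtain o' d where pd: "p = (o', d)" "1 \<le> d" "o' \<in> PPt" using p by (cases p) auto
  define e where "e = j * \<delta> - 1"
  have e: "Suc e = j * \<delta>" using PP_degree_pos[OF g] j by (simp add: e_def)
  show ?thesis
  proof (cases o')
    case None
    obtain m where m: "d = Suc m" using pd(2) by (cases d) auto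
    have f: "homog (Suc e) (g ^ j)" unfolding e by (rule homog_power[OF g(2)])
    have "W1.has_dim (affine_solutions (R_minus (Suc m)) (dehom (g ^ j)) e) (Suc e)"
    proof (cases "g = var_x2")
      case True
      then show ?thesis using R_minus_solutions_one by (simp add: dehom_power)
    next
      case False
      note gd = PP_dehom[OF g(1) False]
      have "g \<noteq> 0" using g(1) by (auto simp: PP_def)
      then have "\<delta> = degree (dehom g)" using homog_unique[OF g(2)] gd(3) by blast
      moreover have "dehom g \<noteq> 0" using gd(1) by auto
      ultimately have "degree (dehom (g ^ j)) = Suc e" "lead_coeff (dehom (g ^ j)) = 1"
        using e monic_power[OF gd(2), of j] unfolding dehom_power by (simp_all add: degree_power_eq)
      then show ?thesis by (rule R_minus_solutions_monic)
    qed
    from sol_dim_R_minus[OF f this] show ?thesis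
      unfolding e_def[symmetric] using None pd(1) m e by (simp add: R_gd_def block_dim_def)
  next
    case (Some q)
    then have q: "q \<in> PP" using pd(3) by (auto simp: PPt_def)
    show ?thesis
    proof (cases "q = var_x2")
      case False
      then show ?thesis using sol_dim_finite_PP[OF g q False pd(2) j] Some pd by simp
    next
      case True
      obtain S :: "'a mat" where S: "S \<in> carrier_mat 2 2" "invertible_mat S"
        "\<And>d. d \<ge> 1 \<Longrightarrow> R_gd (Some var_x2) d = pair_act_right (R_gd (Some x1) d) S"
        "gl_star (twist S) var_x2 = x1" "gl_star (twist S) x1 = var_x2" "twist S * twist S = 1\<^sub>m 2"
        using swap_matrix by blast
      note T = twist_carrier[of S] twist_invertible[OF S(1,2)]
      define g' where "g' = gl_star (twist S) g"
      obtain c where c: "c \<noteq> 0" "gl_act (twist S) g = [:[:c:]:] * g'"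
        using gl_star(2)[OF T g(1)] unfolding g'_def by blast
      have g': "g' \<in> PP" "homog \<delta> g'" using gl_star(1)[OF T g(1)] gl_star_homog[OF T g] by (auto simp: g'_def)
      \<comment> \<open>The exchange is an involution on unital forms, so \<open>g\<close> goes to
        \<open>x1\<close> exactly when it is \<open>x2\<close>.\<close>
      have iff: "x1 = g' \<longleftrightarrow> var_x2 = g"
        using gl_star_inverse[OF T T(1) S(6) T(2) g(1)] S(4,5) unfolding g'_def by metis
      have "sol_dim (R_gd (Some x1) d) (g' ^ j) e (block_dim g' \<delta> j (Some x1, d))"
        unfolding e_def by (rule sol_dim_finite_PP[OF g' PP_x1 pd(2) j])
      moreover have pw: "gl_act (twist S) (g ^ j) = [:[:c ^ j:]:] * g' ^ j"
        unfolding gl_act_power c(2) power_mult_distrib by (simp add: poly_const_pow)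
      ultimately have "sol_dim (R_gd (Some x1) d) (gl_act (twist S) (g ^ j)) e (block_dim g' \<delta> j (Some x1, d))"
        unfolding pw by (subst sol_dim_scalar) (use c in auto)
      moreover obtain n where "sq_pair (R_gd (Some (x1 :: 'a poly poly)) d) n" using R_gd_square by blast
      \<comment> \<open>A second substitution returns to \<open>g ^ j\<close> and at the same time
        turns the block of \<open>x1\<close> into that of \<open>x2\<close>.\<close>
      ultimately have "sol_dim (pair_act_right (R_gd (Some x1) d) S)
          (gl_act (twist S) (gl_act (twist S) (g ^ j))) e (block_dim g' \<delta> j (Some x1, d))"
        by (intro sol_dim_twist[OF _ _ S(1,2)]) (auto simp: sq_pair_def)
      moreover have "block_dim g' \<delta> j (Some x1, d) = block_dim g \<delta> j (Some var_x2, d)"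
        using iff by (simp add: block_dim_def)
      ultimately show ?thesis
        using gl_act_inverse[OF T(1) T(1) S(6)] S(3)[OF pd(2)] Some True pd(1)
        unfolding e_def[symmetric] by simp
    qed
  qed
qed

text \<open>The same for \<open>f = 0\<close>; the subtraction is truncated on purpose.\<close>

definition kernel_dim_at :: "nat \<Rightarrow> 'a::field poly poly option \<times> nat \<Rightarrow> nat" where
  "kernel_dim_at e p = (case fst p of None \<Rightarrow> Suc (Suc e) - snd p | Some q \<Rightarrow> 0)"

lemma sol_dim_R_gd_zero:
  assumes p: "p \<in> PPt \<times> {1..}"
  shows "sol_dim (R_gd (fst p) (snd p)) 0 e (kernel_dim_at e p)"
proof -
  obtain o' d where pd: "p = (o', d)" "1 \<le> d" "o' \<in> PPt" using p by (cases p) auto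
  have fin: "sol_dim (R_gd (Some q) d) 0 e 0" if q: "q \<in> PP" "q \<noteq> var_x2" for q :: "'a poly poly"
  proof -
    note qd = PP_dehom[OF q]
    have nz: "dehom q \<noteq> 0" using qd(1) by auto
    have h: "lead_coeff (dehom q ^ d) = 1" "degree (dehom q ^ d) > 0"
      using monic_power[OF qd(2)] irreducible_poly_degree[OF qd(1)] pd(2) nz
      by (auto simp: degree_power_eq)
    have "dehom q ^ d \<noteq> 0" using nz by simp
    then have "sol_dim (plus_pair (R_fin (dehom q ^ d))) 0 e (2 * 0)"
      by (intro sol_dim_R_fin[OF h]) (simp_all add: quotient_space_zero)
    then show ?thesis using q(2) by (simp add: R_gd_def dehom_def)
  qed
  show ?thesis
  proof (cases o')
    case None
    obtain m where m: "d = Suc m" using pd(2) by (cases d) auto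
    have "sol_dim (plus_pair (R_minus (Suc m))) (0 :: 'a poly poly) e (Suc e - m)"
      by (rule sol_dim_R_minus) (simp_all add: R_minus_solutions_zero)
    then show ?thesis using None pd m by (simp add: R_gd_def kernel_dim_at_def)
  next
    case (Some q)
    then have q: "q \<in> PP" using pd(3) by (auto simp: PPt_def)
    show ?thesis
    proof (cases "q = var_x2")
      case False
      then show ?thesis using fin[OF q False] Some pd by (simp add: kernel_dim_at_def)
    next
      case True
      obtain S :: "'a mat" where S: "S \<in> carrier_mat 2 2" "invertible_mat S"
        "\<And>d. d \<ge> 1 \<Longrightarrow> R_gd (Some var_x2) d = pair_act_right (R_gd (Some x1) d) S"
        using swap_matrix by blast
      obtain n where "sq_pair (R_gd (Some (x1 :: 'a poly poly)) d) n" using R_gd_square by blast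
      then have "sol_dim (pair_act_right (R_gd (Some x1) d) S) (gl_act (twist S) 0) e 0"
        by (intro sol_dim_twist[OF _ _ S(1,2) fin[OF PP_x1]]) (auto simp: sq_pair_def)
      then show ?thesis using S(3)[OF pd(2)] True Some pd by (simp add: kernel_dim_at_def)
    qed
  qed
qed

lemma dsum_list_square: "\<exists>n. sq_pair (dsum_list (map (\<lambda>(g,d). R_gd g d) L)) n"
proof (induction L)
  case Nil
  then show ?case by (intro exI[of _ 0]) (simp add: dsum_list_def sq_pair_def)
next
  case (Cons p L)
  obtain n m where "sq_pair (R_gd (fst p) (snd p)) n" "sq_pair (dsum_list (map (\<lambda>(g,d). R_gd g d) L)) m"
    using Cons R_gd_square by blast
  then have "sq_pair (dsum_pair (R_gd (fst p) (snd p)) (dsum_list (map (\<lambda>(g,d). R_gd g d) L))) (n + m)"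
    by (auto simp: sq_pair_def dsum_pair_def)
  then show ?case by (auto simp: dsum_list_def split_def)
qed

lemma sol_dim_dsum_list:
  assumes "\<And>p. p \<in> set L \<Longrightarrow> sol_dim (R_gd (fst p) (snd p)) f e (v p)"
  shows "sol_dim (dsum_list (map (\<lambda>(g,d). R_gd g d) L)) f e (sum_list (map v L))"
  using assms
proof (induction L)
  case Nil
  have "solutions 0 {..<0} (pencil (0\<^sub>m 0 0, 0\<^sub>m 0 0)) f e = {0}"
    by (auto simp: solutions_def fun_eq_iff)
  then show ?case using W2.has_dim_zero by (simp add: dsum_list_def sol_dim_def)
next
  case (Cons p L)
  obtain n m where "sq_pair (R_gd (fst p) (snd p)) n" "sq_pair (dsum_list (map (\<lambda>(g,d). R_gd g d) L)) m"
    using dsum_list_square R_gd_square by blast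
  then have "sol_dim (dsum_pair (R_gd (fst p) (snd p)) (dsum_list (map (\<lambda>(g,d). R_gd g d) L))) f e
      (v p + sum_list (map v L))"
    using Cons by (intro sol_dim_dsum) auto
  then show ?case by (simp add: dsum_list_def split_def)
qed

lemma count_list_eq_sum_list: "count_list L x = sum_list (map (\<lambda>p. if p = x then 1 else 0) L)"
  by (induction L) auto

lemma sum_list_relation:
  fixes a b c k :: "'b \<Rightarrow> nat"
  assumes "\<And>p. p \<in> set L \<Longrightarrow> 2 * a p = b p + c p + k p"
  shows "2 * sum_list (map a L) = sum_list (map b L) + sum_list (map c L) + sum_list (map k L)"
  using assms by (induction L) fastforce+

text \<open>As a function of \<open>j\<close>, \<open>min n j\<close> is linear except for a bend at
  \<open>j = n\<close>, and the epsilon term \<open>j \<delta>\<close> is linear throughout. The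
  second difference at \<open>j\<close> thus counts the blocks of index \<open>j\<close>; it is
  written with sums only, to avoid truncated subtraction.\<close>

lemma count_block:
  assumes "set L \<subseteq> PPt \<times> {1..}" "1 \<le> j"
  shows "2 * sum_list (map (block_dim g \<delta> j) L) = sum_list (map (block_dim g \<delta> (j - 1)) L)
    + sum_list (map (block_dim g \<delta> (Suc j)) L) + 2 * \<delta> * count_list L (Some g, j)"
proof -
  have "2 * \<delta> * count_list L (Some g, j) = sum_list (map (\<lambda>p. 2 * \<delta> * (if p = (Some g, j) then 1 else 0)) L)"
    unfolding count_list_eq_sum_list sum_list_const_mult ..
  moreover have "2 * block_dim g \<delta> j p = block_dim g \<delta> (j - 1) p + block_dim g \<delta> (Suc j) p
      + 2 * \<delta> * (if p = (Some g, j) then 1 else 0)" for p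
  proof (cases "fst p")
    case None
    obtain i where "j = Suc i" using assms(2) by (cases j) auto
    with None show ?thesis by (cases p) (auto simp: block_dim_def algebra_simps)
  next
    case (Some q)
    then obtain n where p: "p = (Some q, n)" by (cases p) auto
    have scaled: "2 * (2 * (a * \<delta>)) = 2 * (b * \<delta>) + 2 * (c * \<delta>) + 2 * \<delta> * k"
      if "2 * a = b + c + k" for a b c k :: nat
    proof -
      have "2 * (2 * (a * \<delta>)) = (2 * a) * (2 * \<delta>)" by simp
      also have "\<dots> = (b + c + k) * (2 * \<delta>)" unfolding that ..
      finally show ?thesis by (simp add: algebra_simps)
    qed
    have "2 * min n j = min n (j - 1) + min n (Suc j) + (if n = j then 1 else 0)"
      using assms(2) by (auto simp: min_def)
    from scaled[OF this] show ?thesis unfolding p block_dim_def by (cases "q = g") simp_all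
  qed
  ultimately show ?thesis by (subst sum_list_relation) auto
qed

text \<open>The truncated value \<open>e + 2 - d\<close> bends where it becomes positive. The second
  differences for \<open>d = 1\<close> and \<open>d = 2\<close> would reach negative
  \<open>e\<close>, where the dimension has to be read as 0, so these two indices get identities of
  their own.\<close>

lemma count_kernel_1:
  assumes "set L \<subseteq> PPt \<times> {1..}"
  shows "sum_list (map (kernel_dim_at 0) L) = count_list L (None, 1)"
  unfolding count_list_eq_sum_list using assms
  by (intro arg_cong[where f = sum_list] map_cong refl)
    (auto simp: kernel_dim_at_def split: option.splits)

lemma count_kernel_2:
  assumes "set L \<subseteq> PPt \<times> {1..}"
  shows "sum_list (map (kernel_dim_at 1) L) = 2 * sum_list (map (kernel_dim_at 0) L) + count_list L (None, 2)"
proof -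
  have "kernel_dim_at 1 p = 2 * kernel_dim_at 0 p + (if p = (None, 2) then 1 else 0)" if "p \<in> set L" for p
  proof -
    have "snd p \<ge> 1" using assms that by auto
    then show ?thesis by (cases p) (auto simp: kernel_dim_at_def split: option.splits)
  qed
  then have "sum_list (map (kernel_dim_at 1) L)
      = sum_list (map (\<lambda>p. 2 * kernel_dim_at 0 p + (if p = (None, 2) then 1 else 0)) L)"
    by (intro arg_cong[where f = sum_list] map_cong refl)
  then show ?thesis unfolding count_list_eq_sum_list by (simp add: sum_list_addf sum_list_const_mult)
qed

lemma count_kernel:
  "sum_list (map (kernel_dim_at (Suc (Suc e))) L) + sum_list (map (kernel_dim_at e) L)
    = 2 * sum_list (map (kernel_dim_at (Suc e)) L) + count_list L (None, e + 3)"
proof -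
  have "kernel_dim_at (Suc (Suc e)) p + kernel_dim_at e p
      = 2 * kernel_dim_at (Suc e) p + (if p = (None, e + 3) then 1 else 0)" for p :: "'a poly poly option \<times> nat"
    by (cases p) (auto simp: kernel_dim_at_def split: option.splits)
  then have "sum_list (map (\<lambda>p. kernel_dim_at (Suc (Suc e)) p + kernel_dim_at e p) L)
      = sum_list (map (\<lambda>p. 2 * kernel_dim_at (Suc e) p + (if p = (None, e + 3) then 1 else 0)) L)" by simp
  then show ?thesis unfolding count_list_eq_sum_list by (simp add: sum_list_addf sum_list_const_mult)
qed

section \<open>Comparison of weakly congruent direct sums\<close>

lemma finite_support_list:
  assumes "finite {x. \<rho> x \<noteq> (0::nat)}"
  shows "\<exists>L. \<forall>x. count_list L x = \<rho> x"
proof -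
  have "count (Abs_multiset \<rho>) = \<rho>" using assms by (intro count_Abs_multiset) simp
  moreover obtain L where "mset L = Abs_multiset \<rho>" using ex_mset by blast
  ultimately show ?thesis by (metis count_mset)
qed

lemma A_rho_list:
  assumes "\<rho> \<in> Ft"
  shows "\<exists>L. A_rho \<rho> = dsum_list (map (\<lambda>(g,d). R_gd g d) L) \<and> (\<forall>x. count_list L x = \<rho> x) \<and>
    set L \<subseteq> PPt \<times> {1..}"
proof -
  define L where "L = (SOME L. \<forall>x. count_list L x = \<rho> x)"
  have "\<exists>L. \<forall>x. count_list L x = \<rho> x"
    by (rule finite_support_list) (use assms in \<open>simp add: Ft_def\<close>)
  then have L: "\<forall>x. count_list L x = \<rho> x" unfolding L_def by (rule someI_ex)
  moreover have "set L \<subseteq> PPt \<times> {1..}"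
  proof
    fix p assume "p \<in> set L"
    then have "\<rho> (fst p, snd p) \<noteq> 0" using L by (metis count_list_0_iff prod.collapse)
    then have "fst p \<in> PPt \<and> 1 \<le> snd p" using assms unfolding Ft_def by blast
    then show "p \<in> PPt \<times> {1..}" by (cases p) auto
  qed
  ultimately show ?thesis unfolding A_rho_def L_def[symmetric] by blast
qed

text \<open>The substitution takes \<open>g^j\<close> to a scalar multiple of a power of the
  transformed form, which has the same degree. All dimensions for the two forms therefore agree, and
  with them the second differences. For epsilon the form 0 is used, which every substitution
  fixes.\<close>

lemma weakly_congruent_multiplicities:
  fixes \<rho> \<rho>' :: "'a::field rho"
  assumes \<rho>: "\<rho> \<in> Ft" "\<rho>' \<in> Ft" and Q: "Q \<in> carrier_mat 2 2" "invertible_mat Q"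
    and P: "P \<in> carrier_mat n n" "invertible_mat P" and sq: "sq_pair (A_rho \<rho>) n"
    and eq: "A_rho \<rho>' = pair_act_left P (pair_act_right (A_rho \<rho>) Q)"
    and g: "g \<in> PPt" and d: "1 \<le> d"
  shows "\<rho>' (gl_star_t (twist Q) g, d) = \<rho> (g, d)"
proof -
  obtain L where L: "A_rho \<rho> = dsum_list (map (\<lambda>(g,d). R_gd g d) L)" "\<And>x. count_list L x = \<rho> x"
    "set L \<subseteq> PPt \<times> {1..}" using A_rho_list[OF \<rho>(1)] by blast
  obtain L' where L': "A_rho \<rho>' = dsum_list (map (\<lambda>(g,d). R_gd g d) L')" "\<And>x. count_list L' x = \<rho>' x"
    "set L' \<subseteq> PPt \<times> {1..}" using A_rho_list[OF \<rho>(2)] by blast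
  have sq': "sq_pair (pair_act_right (A_rho \<rho>) Q) n" using sq by (auto simp: sq_pair_def pair_act_right_def)
  have transfer: "sol_dim (A_rho \<rho>') (gl_act (twist Q) f) e k" if "sol_dim (A_rho \<rho>) f e k" for f e k
    unfolding eq using sq
    by (intro sol_dim_congruent[OF sq' P] sol_dim_twist[OF _ _ Q that]) (auto simp: sq_pair_def)
  note T = twist_carrier[of Q] twist_invertible[OF Q]
  show ?thesis
  proof (cases g)
    case None
    have ker: "sum_list (map (kernel_dim_at e) L) = sum_list (map (kernel_dim_at e) L')" for e
    proof -
      have "sol_dim (A_rho \<rho>) 0 e (sum_list (map (kernel_dim_at e) L))" unfolding L(1)
        by (rule sol_dim_dsum_list, rule sol_dim_R_gd_zero) (use L(3) in blast)
      from transfer[OF this] have "sol_dim (A_rho \<rho>') 0 e (sum_list (map (kernel_dim_at e) L))" by simp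
      moreover have "sol_dim (A_rho \<rho>') 0 e (sum_list (map (kernel_dim_at e) L'))" unfolding L'(1)
        by (rule sol_dim_dsum_list, rule sol_dim_R_gd_zero) (use L'(3) in blast)
      ultimately show ?thesis unfolding sol_dim_def by (rule W2.has_dim_unique)
    qed
    have "count_list L (None, d) = count_list L' (None, d)"
    proof -
      consider "d = 1" | "d = 2" | e where "d = e + 3" using d that by (metis One_nat_def Suc_1 add.commute
          le_Suc_ex le_antisym not_less_eq_eq numeral_3_eq_3)
      then show ?thesis
      proof cases
        case 1
        then show ?thesis using count_kernel_1[OF L(3)] count_kernel_1[OF L'(3)] ker[of 0] by simp
      next
        case 2
        then show ?thesis using count_kernel_2[OF L(3)] count_kernel_2[OF L'(3)] ker[of 0] ker[of 1] by simp
      next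
        case 3
        then show ?thesis using count_kernel[of e L] count_kernel[of e L'] ker by simp
      qed
    qed
    then show ?thesis using None L(2) L'(2) by (simp add: gl_star_t_def)
  next
    case (Some q)
    then have q: "q \<in> PP" using g by (auto simp: PPt_def)
    obtain \<delta> where \<delta>: "homog \<delta> q" using PP_homog[OF q] .
    define q' where "q' = gl_star (twist Q) q"
    obtain c where c: "c \<noteq> 0" "gl_act (twist Q) q = [:[:c:]:] * q'"
      using gl_star(2)[OF T q] unfolding q'_def by blast
    have q': "q' \<in> PP" "homog \<delta> q'" using gl_star(1)[OF T q] gl_star_homog[OF T q \<delta>] by (auto simp: q'_def)
    have dims: "sum_list (map (block_dim q \<delta> j) L) = sum_list (map (block_dim q' \<delta> j) L')" for j
    proof (cases "j = 0")
      case True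
      \<comment> \<open>The value at \<open>j = 0\<close> enters the second difference at index
        1.\<close>
      have "block_dim g \<delta> 0 = (\<lambda>p. 0)" for g :: "'a poly poly"
        by (auto simp: block_dim_def fun_eq_iff split: option.split)
      with True show ?thesis by simp
    next
      case False
      then have j: "1 \<le> j" by simp
      have "sol_dim (A_rho \<rho>) (q ^ j) (j * \<delta> - 1) (sum_list (map (block_dim q \<delta> j) L))" unfolding L(1)
        by (rule sol_dim_dsum_list, rule sol_dim_R_gd[OF q \<delta> _ j]) (use L(3) in blast)
      from transfer[OF this]
      have "sol_dim (A_rho \<rho>') ([:[:c ^ j:]:] * q' ^ j) (j * \<delta> - 1) (sum_list (map (block_dim q \<delta> j) L))"
        unfolding gl_act_power c(2) power_mult_distrib poly_const_pow .
      then have "sol_dim (A_rho \<rho>') (q' ^ j) (j * \<delta> - 1) (sum_list (map (block_dim q \<delta> j) L))"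
        using sol_dim_scalar[of "c ^ j" "A_rho \<rho>'" "q' ^ j"] c(1) by simp
      moreover have "sol_dim (A_rho \<rho>') (q' ^ j) (j * \<delta> - 1) (sum_list (map (block_dim q' \<delta> j) L'))" unfolding L'(1)
        by (rule sol_dim_dsum_list, rule sol_dim_R_gd[OF q' _ j]) (use L'(3) in blast)
      ultimately show ?thesis unfolding sol_dim_def by (rule W2.has_dim_unique)
    qed
    have "2 * \<delta> * count_list L (Some q, d) = 2 * \<delta> * count_list L' (Some q', d)"
      using count_block[OF L(3) d, of q \<delta>] count_block[OF L'(3) d, of q' \<delta>] unfolding dims by linarith
    then have "count_list L (Some q, d) = count_list L' (Some q', d)"
      using PP_degree_pos[OF q \<delta>] by simp
    then show ?thesis using Some L(2) L'(2) by (simp add: gl_star_t_def q'_def)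
  qed
qed

text \<open>Multiplicities are transported along \<open>twist Q\<close> from \<open>\<rho>\<close>
  to \<open>\<rho>'\<close>. Evaluating this at the image of \<open>g\<close> under
  \<open>R\<close>, the inverse of \<open>twist Q\<close>, expresses \<open>\<rho>'\<close> through
  \<open>\<rho>\<close>; outside the index set both sides are zero.\<close>

lemma rho_act_if_weakly_congruent:
  fixes \<rho> \<rho>' :: "'a::field rho"
  assumes \<rho>: "\<rho> \<in> Ft" "\<rho>' \<in> Ft" and Q: "Q \<in> carrier_mat 2 2" "invertible_mat Q"
    and P: "P \<in> carrier_mat n n" "invertible_mat P" and sq: "sq_pair (A_rho \<rho>) n"
    and eq: "A_rho \<rho>' = pair_act_left P (pair_act_right (A_rho \<rho>) Q)"
    and R: "R \<in> carrier_mat 2 2" "invertible_mat R" "R * twist Q = 1\<^sub>m 2"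
  shows "\<rho>' = rho_act \<rho> R"
proof
  fix x :: "'a poly poly option \<times> nat"
  obtain g d where x: "x = (g, d)" by (cases x)
  show "\<rho>' x = rho_act \<rho> R x"
  proof (cases "g \<in> PPt \<and> 1 \<le> d")
    case True
    note T = twist_carrier[of Q] twist_invertible[OF Q]
    have "gl_star_t R g \<in> PPt" using True gl_star(1)[OF R(1,2)] by (auto simp: gl_star_t_def PPt_def)
    moreover have "gl_star_t (twist Q) (gl_star_t R g) = g"
      using True gl_star_inverse[OF T R(1,3,2)] by (auto simp: gl_star_t_def PPt_def)
    ultimately show ?thesis
      using weakly_congruent_multiplicities[OF \<rho> Q P sq eq, of "gl_star_t R g" d] True
      by (simp add: x rho_act_def)
  next
    case False
    then show ?thesis using \<rho>(2) unfolding x rho_act_def Ft_def by auto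
  qed
qed

section \<open>Skew-symmetry of the canonical pairs, and the theorem\<close>

lemma plus_mat_skew:
  assumes "R \<in> carrier_mat r s"
  shows "plus_mat R \<in> carrier_mat (r + s) (r + s)" "transpose_mat (plus_mat R) = - plus_mat R"
proof -
  show c: "plus_mat R \<in> carrier_mat (r + s) (r + s)" using assms by (auto simp: plus_mat_def)
  show "transpose_mat (plus_mat R) = - plus_mat R"
    using assms by (intro eq_matI) (auto simp: plus_mat_def)
qed

text \<open>Serves to apply the existence half to a canonical pair that has been changed by
  GL(2).\<close>

definition skew_pair :: "'a::field mpair \<Rightarrow> bool" where
  "skew_pair A \<longleftrightarrow> transpose_mat (fst A) = - fst A \<and> transpose_mat (snd A) = - snd A"

lemma skew_pair_R_gd: "skew_pair (R_gd g d)"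
proof -
  have "skew_pair (plus_pair R)" for R :: "'a mpair"
    using plus_mat_skew(2)[of "fst R" "dim_row (fst R)" "dim_col (fst R)"]
      plus_mat_skew(2)[of "snd R" "dim_row (snd R)" "dim_col (snd R)"]
    by (simp add: skew_pair_def plus_pair_def)
  then show ?thesis by (auto simp: R_gd_def split: option.split)
qed

lemma skew_pair_dsum:
  assumes "sq_pair A n" "sq_pair B m" "skew_pair A" "skew_pair B"
  shows "skew_pair (dsum_pair A B)"
proof -
  have key: "transpose_mat (four_block_mat X (0\<^sub>m n m) (0\<^sub>m m n) Y) = - four_block_mat X (0\<^sub>m n m) (0\<^sub>m m n) Y"
    if X: "X \<in> carrier_mat n n" "transpose_mat X = - X" and Y: "Y \<in> carrier_mat m m" "transpose_mat Y = - Y"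
    for X Y :: "'a mat"
  proof -
    have e: "M $$ (j,i) = - M $$ (i,j)" if "M \<in> carrier_mat k k" "transpose_mat M = - M" "i < k" "j < k"
      for M :: "'a mat" and k i j
    proof -
      have "M $$ (j,i) = transpose_mat M $$ (i,j)" using that(1,3,4) by simp
      also have "\<dots> = - M $$ (i,j)" unfolding that(2) using that(1,3,4) by simp
      finally show ?thesis .
    qed
    show ?thesis
    proof (rule eq_matI)
      fix i j assume "i < dim_row (- four_block_mat X (0\<^sub>m n m) (0\<^sub>m m n) Y)"
        "j < dim_col (- four_block_mat X (0\<^sub>m n m) (0\<^sub>m m n) Y)"
      then have ij: "i < n + m" "j < n + m" using X Y by auto
      then show "transpose_mat (four_block_mat X (0\<^sub>m n m) (0\<^sub>m m n) Y) $$ (i,j)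
          = (- four_block_mat X (0\<^sub>m n m) (0\<^sub>m m n) Y) $$ (i,j)"
        using X(1) Y(1) e[OF X, of i j] e[OF Y, of "i - n" "j - n"]
        by (cases "i < n"; cases "j < n") auto
    qed (use X Y in auto)
  qed
  show ?thesis using assms key[of "fst A" "fst B"] key[of "snd A" "snd B"]
    by (auto simp: skew_pair_def sq_pair_def dsum_pair_def)
qed

lemma skew_pair_dsum_list: "skew_pair (dsum_list (map (\<lambda>(g,d). R_gd g d) L))"
proof (induction L)
  case Nil
  show ?case by (auto simp: dsum_list_def skew_pair_def)
next
  case (Cons p L)
  obtain n m where "sq_pair (R_gd (fst p) (snd p)) n" "sq_pair (dsum_list (map (\<lambda>(g,d). R_gd g d) L)) m"
    using dsum_list_square R_gd_square by blast
  from skew_pair_dsum[OF this skew_pair_R_gd Cons] show ?case by (simp add: dsum_list_def split_def)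
qed

lemma invertible_one_mat: "invertible_mat (1\<^sub>m n :: 'a::field mat)"
  unfolding invertible_mat_def inverts_mat_def by (auto intro!: exI[of _ "1\<^sub>m n"])

lemma pair_act_right_one:
  "sq_pair A n \<Longrightarrow> pair_act_right A (1\<^sub>m 2) = A"
  by (cases A) (auto simp: pair_act_right_def sq_pair_def)

lemma weakly_congruentI:
  assumes "sq_pair A n" "sq_pair B n" "P \<in> carrier_mat n n" "invertible_mat P"
    "Q \<in> carrier_mat 2 2" "invertible_mat Q" "B = pair_act_left P (pair_act_right A Q)"
  shows "weakly_congruent A B"
  unfolding weakly_congruent_def by (intro exI conjI) (fact assms)+

lemma sq_pair_act_left: "P \<in> carrier_mat n n \<Longrightarrow> sq_pair A n \<Longrightarrow> sq_pair (pair_act_left P A) n"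
  by (auto simp: sq_pair_def pair_act_left_def)

theorem theorem3p5:
  fixes dummy :: "'a::field"
  assumes char: "(2::'a) \<noteq> 0"
  shows "(\<forall>n (A1::'a mat) A2. A1 \<in> carrier_mat n n \<and> A2 \<in> carrier_mat n n \<and>
            transpose_mat A1 = - A1 \<and> transpose_mat A2 = - A2 \<longrightarrow>
            (\<exists>\<rho>\<in>Ft. weakly_congruent (A1, A2) (A_rho \<rho>)))
       \<and> (\<forall>\<rho>\<in>(Ft :: 'a rho set). \<forall>\<rho>'\<in>Ft.
            weakly_congruent (A_rho \<rho>) (A_rho \<rho>') \<longleftrightarrow>
            (\<exists>Q. Q \<in> carrier_mat 2 2 \<and> invertible_mat Q \<and> \<rho>' = rho_act \<rho> Q))"
proof (intro conjI allI impI ballI iffI)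
  fix n and A1 A2 :: "'a mat"
  assume A: "A1 \<in> carrier_mat n n \<and> A2 \<in> carrier_mat n n \<and>
    transpose_mat A1 = - A1 \<and> transpose_mat A2 = - A2"
  then obtain \<rho> P where *: "\<rho> \<in> Ft" "P \<in> carrier_mat n n" "invertible_mat P"
    "A_rho \<rho> = pair_act_left P (A1, A2)"
    using skew_pair_canonical_form[OF char] by metis
  have sq: "sq_pair (A1, A2) n" using A by (simp add: sq_pair_def)
  have "sq_pair (A_rho \<rho>) n" unfolding *(4) by (rule sq_pair_act_left[OF *(2) sq])
  moreover have "A_rho \<rho> = pair_act_left P (pair_act_right (A1, A2) (1\<^sub>m 2))"
    unfolding pair_act_right_one[OF sq] by (rule *(4))
  ultimately have "weakly_congruent (A1, A2) (A_rho \<rho>)"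
    by (rule weakly_congruentI[OF sq _ *(2,3) one_carrier_mat invertible_one_mat])
  with *(1) show "\<exists>\<rho>\<in>Ft. weakly_congruent (A1, A2) (A_rho \<rho>)" by blast
next
  fix \<rho> \<rho>' :: "'a rho"
  assume \<rho>: "\<rho> \<in> Ft" "\<rho>' \<in> Ft" and "weakly_congruent (A_rho \<rho>) (A_rho \<rho>')"
  then obtain n P Q where *: "sq_pair (A_rho \<rho>) n" "P \<in> carrier_mat n n" "invertible_mat P"
    "Q \<in> carrier_mat 2 2" "invertible_mat Q" "A_rho \<rho>' = pair_act_left P (pair_act_right (A_rho \<rho>) Q)"
    unfolding weakly_congruent_def by blast
  obtain R where "R \<in> carrier_mat 2 2" "R * twist Q = 1\<^sub>m 2" "invertible_mat R"
    using invertible_mat2E[OF twist_carrier twist_invertible[OF *(4,5)]] by metis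
  then show "\<exists>Q. Q \<in> carrier_mat 2 2 \<and> invertible_mat Q \<and> \<rho>' = rho_act \<rho> Q"
    using rho_act_if_weakly_congruent[OF \<rho> *(4,5,2,3,1,6)] by blast
next
  fix \<rho> \<rho>' :: "'a rho"
  assume \<rho>: "\<rho> \<in> Ft" "\<rho>' \<in> Ft"
    and "\<exists>Q. Q \<in> carrier_mat 2 2 \<and> invertible_mat Q \<and> \<rho>' = rho_act \<rho> Q"
  then obtain R where R: "R \<in> carrier_mat 2 2" "invertible_mat R" "\<rho>' = rho_act \<rho> R" by blast
  obtain R' where R': "R' \<in> carrier_mat 2 2" "R * R' = 1\<^sub>m 2" "invertible_mat R'"
    using invertible_mat2E[OF R(1,2)] by metis
  \<comment> \<open>Chosen so that \<open>twist Q\<close> is inverse to \<open>R\<close>; the change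
    of the pair by \<open>Q\<close> then corresponds to the action of \<open>R\<close> on
    multiplicities.\<close>
  define Q where "Q = twist R'"
  have Q: "Q \<in> carrier_mat 2 2" "invertible_mat Q" "R * twist Q = 1\<^sub>m 2"
    using R' twist_invertible[OF R'(1,3)] twist_twist[OF R'(1)] by (auto simp: Q_def)
  obtain L where L: "A_rho \<rho> = dsum_list (map (\<lambda>(g,d). R_gd g d) L)" using A_rho_list[OF \<rho>(1)] by blast
  obtain n where sq: "sq_pair (A_rho \<rho>) n" using dsum_list_square unfolding L by blast
  have sk: "skew_pair (A_rho \<rho>)" unfolding L by (rule skew_pair_dsum_list)
  obtain B1 B2 where B: "pair_act_right (A_rho \<rho>) Q = (B1, B2)" by (cases "pair_act_right (A_rho \<rho>) Q")
  have Bc: "B1 \<in> carrier_mat n n" "B2 \<in> carrier_mat n n"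
    using sq B by (auto simp: sq_pair_def pair_act_right_def)
  have comb: "transpose_mat (a \<cdot>\<^sub>m X + b \<cdot>\<^sub>m Y) = - (a \<cdot>\<^sub>m X + b \<cdot>\<^sub>m Y)"
    if X: "X \<in> carrier_mat n n" "transpose_mat X = - X" and Y: "Y \<in> carrier_mat n n" "transpose_mat Y = - Y"
    for X Y :: "'a mat" and a b
  proof (rule eq_matI)
    fix i j assume "i < dim_row (- (a \<cdot>\<^sub>m X + b \<cdot>\<^sub>m Y))" "j < dim_col (- (a \<cdot>\<^sub>m X + b \<cdot>\<^sub>m Y))"
    then have ij: "i < n" "j < n" using X Y by auto
    have "transpose_mat X $$ (i,j) = - X $$ (i,j)" "transpose_mat Y $$ (i,j) = - Y $$ (i,j)"
      unfolding X(2) Y(2) using X(1) Y(1) ij by auto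
    then show "transpose_mat (a \<cdot>\<^sub>m X + b \<cdot>\<^sub>m Y) $$ (i,j) = (- (a \<cdot>\<^sub>m X + b \<cdot>\<^sub>m Y)) $$ (i,j)"
      using X(1) Y(1) ij by simp
  qed (use X Y in auto)
  have Bs: "transpose_mat B1 = - B1" "transpose_mat B2 = - B2"
    using comb sq sk B by (auto simp: sq_pair_def skew_pair_def pair_act_right_def)
  obtain \<sigma> P where *: "\<sigma> \<in> Ft" "P \<in> carrier_mat n n" "invertible_mat P"
    "A_rho \<sigma> = pair_act_left P (pair_act_right (A_rho \<rho>) Q)"
    using skew_pair_canonical_form[OF char Bc Bs] unfolding B by metis
  \<comment> \<open>Existence provides some \<open>\<sigma>\<close> for the transformed pair;
    uniqueness identifies it with \<open>rho_act \<rho> R\<close>, which is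
    \<open>\<rho>'\<close>.\<close>
  have "\<sigma> = rho_act \<rho> R"
    by (rule rho_act_if_weakly_congruent[OF \<rho>(1) *(1) Q(1,2) *(2,3) sq *(4) R(1,2) Q(3)])
  then have eq: "A_rho \<rho>' = pair_act_left P (pair_act_right (A_rho \<rho>) Q)" using *(4) R(3) by simp
  have "sq_pair (pair_act_right (A_rho \<rho>) Q) n" using Bc unfolding B by (simp add: sq_pair_def)
  then have "sq_pair (A_rho \<rho>') n" unfolding eq by (rule sq_pair_act_left[OF *(2)])
  then show "weakly_congruent (A_rho \<rho>) (A_rho \<rho>')"
    using eq by (rule weakly_congruentI[OF sq _ *(2,3) Q(1,2)])
qed

end
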